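(* Let $n,m,l,\nu$ be non-negative integers with $1 \leq n \leq l \leq m$ and $m \geq n+\nu+1$. Let $T$ be an $(n+\nu)\times l$ truncation (submatrix) of a Haar distributed unitary matrix $U$ of size $m\times m$. Let $X$ be a non-random complex matrix of size $l\times n$ whose squared singular values $x_1,\ldots,x_n$ are non-zero and pairwise distinct. Then the squared singular values $y_1,\ldots,y_n$ of $Y=TX$ have a joint probability density function on $[0,\infty)^n$ proportional to \[ \left(\prod_{j=1}^n x_j^{-m+n}\right)\left(\prod_{j=1}^n y_j^{\nu}\right)\det\left[(x_k-y_j)_+^{m-n-\nu-1}\right]_{j,k=1}^n\frac{\Delta(y)}{\Delta(x)}, \] where the proportionality constant depends only on $n,m,\nu$ and is independent of $X$.
   Context: For real $a$, $(a)_+=\max(0,a)$. For $z=(z_1,\ldots,z_n)$, $\Delta(z)=\prod_{1\le j<k\le n}(z_k-z_j)$ is the Vandermonde determinant. The squared singular values of a matrix $Y$ are the eigenvalues of $Y^*Y$. *)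

theory Defs
  imports "HOL-Probability.Probability" "HOL-Computational_Algebra.Polynomial"
begin

definition cadj :: "complex^'m^'m \<Rightarrow> complex^'m^'m" where
  "cadj U = (\<chi> i j. cnj (U $ j $ i))"

definition unitary_mat :: "complex^'m^'m \<Rightarrow> bool" where
  "unitary_mat U \<longleftrightarrow> cadj U ** U = mat 1"

definition haar_unitary :: "(complex^'m^'m) measure" where
  "haar_unitary = (THE \<mu>. prob_space \<mu> \<and> sets \<mu> = sets borel
       \<and> emeasure \<mu> {U. unitary_mat U} = 1
       \<and> (\<forall>V. unitary_mat V \<longrightarrow> distr \<mu> borel (\<lambda>U. V ** U) = \<mu>))"

definition charpoly :: "complex^'n^'n \<Rightarrow> complex poly" where
  "charpoly A = det (\<chi> i j. (if i = j then [:0, 1:] else 0) - [:A $ i $ j:])"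

definition real_eigvals :: "complex^'n^'n \<Rightarrow> real^'n \<Rightarrow> bool" where
  "real_eigvals A y \<longleftrightarrow> charpoly A = (\<Prod>i\<in>UNIV. [:- complex_of_real (y $ i), 1:])"

definition gram :: "'m set \<Rightarrow> complex^'n^'m \<Rightarrow> complex^'n^'n" where
  "gram S A = (\<chi> k k'. \<Sum>j\<in>S. cnj (A $ j $ k) * A $ j $ k')"

text \<open>Product of the truncation U[R,L] with a matrix X whose rows are indexed by L
  (rows of X outside L are ignored); the result has rows indexed by R
  (rows outside R are irrelevant and later discarded by gram R).\<close>
definition trunc_mult :: "'m set \<Rightarrow> complex^'m^'m \<Rightarrow> complex^'n^'m \<Rightarrow> complex^'n^'m" where
  "trunc_mult L U X = (\<chi> i k. \<Sum>j\<in>L. U $ i $ j * X $ j $ k)"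

text \<open>Truncated power (a)_+^k, with the standard convention (a)_+^0 = Heaviside step.\<close>
definition pos_pow :: "real \<Rightarrow> nat \<Rightarrow> real" where
  "pos_pow a k = (if a > 0 then a ^ k else 0)"

definition vandermonde :: "real^'n::{finite,linorder} \<Rightarrow> real" where
  "vandermonde z = (\<Prod>(j,k)\<in>{(j,k). j < k}. z $ k - z $ j)"

definition sym_set :: "(real^'n) set \<Rightarrow> bool" where
  "sym_set A \<longleftrightarrow> (\<forall>\<sigma>. \<sigma> permutes (UNIV::'n set) \<longrightarrow> (\<forall>y. y \<in> A \<longleftrightarrow> (\<chi> i. y $ \<sigma> i) \<in> A))"

end

theory Submission
  imports Defs
begin

text \<open>
  Rows of the Haar unitary are removed one at a time. By unitary invariance, removing one of the
  rows of \<open>W\<close> amounts to replacing \<open>W\<^sup>* W\<close> by \<open>W\<^sup>* (1 - u u\<^sup>*) W\<close> for a uniformly distributed unit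
  vector \<open>u\<close>, represented as a normalised Gaussian vector. If \<open>W\<^sup>* W\<close> has eigenvalues \<open>x\<close>,
  the characteristic polynomial of the new matrix is determined by \<open>x\<close> and by the weights
  \<open>\<bar>u\<^sub>i\<bar>\<^sup>2\<close>, which are Dirichlet distributed; its roots interlace with \<open>x\<close>, and the Jacobian of the map
  from roots to weights is a Cauchy determinant. This gives the one-step density, whose determinant
  is the indicator of interlacing. The steps are composed with Andreief's identity,
  which turns products of truncated powers into truncated powers of higher degree.

  Unordered eigenvalues are handled through the coefficients of the characteristic polynomial, a
  Borel function of the matrix. Haar measure exists as the law of the Gram-Schmidt
  orthonormalisation of a matrix uniformly distributed in a ball, and its uniqueness follows from Fubini's theorem.
\<close>

section \<open>Lebesgue measure on finite products\<close>

text \<open>The parameter \<open>l\<close> enters only through padding \<open>X\<close> by zero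
  rows, so the process starts from the whole of \<open>U\<close> times a fixed matrix. Each step
  needs a positive, pairwise distinct spectrum; for \<open>X\<close> this comes from the hypotheses,
  for later matrices it holds almost surely because the preceding law already has a density.
  Gaussian vectors are convenient because their squared moduli are independent exponential variables
  and the unitary that diagonalises the problem is absorbed by rotation invariance. The kernel from
  M to N rows carries the powers x_j^(n-M) and y_j^(N-n) and a quotient of Vandermonde factors, so
  in a composition everything in the middle variable cancels except two determinants. Its
  nonnegativity is not visible from the formula once the determinant is no longer an indicator; it
  is inherited from the composition integral. The constant collects, per removed row, the Dirichlet
  normaliser divided by n! for the orderings of the new spectrum and, per composition, n! from
  Andreief's identity over the n-th power of the new exponent.\<close>

lemma borel_measurable_vec_nth [measurable]:
  "(\<lambda>v::'a::euclidean_space^'m. v $ i) \<in> borel_measurable borel"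
  by (intro borel_measurable_continuous_onI continuous_intros)

lemma borel_measurable_vec_lambda:
  fixes f :: "'m::finite \<Rightarrow> 'b \<Rightarrow> 'a::euclidean_space"
  assumes "\<And>i. f i \<in> borel_measurable M"
  shows "(\<lambda>x. \<chi> i. f i x) \<in> borel_measurable M"
proof -
  have eq: "(\<lambda>x. \<chi> i. f i x) = (\<lambda>x. \<Sum>i\<in>UNIV. axis i (f i x))"
    by (auto simp: vec_eq_iff axis_def if_distrib cong: if_cong)
  have "linear (axis i :: 'a \<Rightarrow> 'a^'m)" for i
    by (auto intro!: linearI simp: vec_eq_iff axis_def)
  then have "(axis i :: 'a \<Rightarrow> 'a^'m) \<in> borel_measurable borel" for i
    by (intro borel_measurable_continuous_onI linear_continuous_on) (simp add: linear_conv_bounded_linear)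
  then have "(\<lambda>x. axis i (f i x)) \<in> borel_measurable M" for i
    using assms by (rule measurable_compose_rev)
  then show ?thesis
    unfolding eq by (intro borel_measurable_sum)
qed

lemma box_vec: "box l u = {v::'a::euclidean_space^'m. \<forall>i. v $ i \<in> box (l $ i) (u $ i)}"
  by (auto simp: mem_box Basis_vec_def inner_axis)

lemma prod_Basis_vec: 
  "(\<Prod>b\<in>Basis. g b) = (\<Prod>i\<in>UNIV. \<Prod>b\<in>Basis. g (axis i (b::'a::euclidean_space)) :: 'c::comm_monoid_mult)"
proof -
  have "(\<Prod>i\<in>UNIV. \<Prod>b\<in>Basis. g (axis i b)) = (\<Prod>(i,b)\<in>UNIV \<times> Basis. g (axis i b))"
    by (rule prod.cartesian_product)
  also have "\<dots> = (\<Prod>b\<in>(\<lambda>(i,b). axis i b) ` (UNIV \<times> Basis). g b)"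
    by (subst prod.reindex) (auto simp: inj_on_def axis_eq_axis split_def)
  also have "(\<lambda>(i,b). axis i b) ` (UNIV \<times> (Basis::'a set)) = Basis"
    by (auto simp: Basis_vec_def)
  finally show ?thesis ..
qed

lemma emeasure_lborel_box_vec:
  "emeasure lborel (box l (u::'a::euclidean_space^'m)) = (\<Prod>i\<in>UNIV. emeasure lborel (box (l $ i) (u $ i)))"
proof (cases "\<forall>i. \<forall>b\<in>Basis. l $ i \<bullet> b \<le> u $ i \<bullet> b")
  case True
  then have "\<forall>b\<in>Basis. l \<bullet> b \<le> u \<bullet> b"
    by (auto simp: Basis_vec_def inner_axis)
  with True show ?thesis
    by (simp add: emeasure_lborel_box_eq prod_Basis_vec inner_axis prod_ennreal prod_nonneg inner_diff)
next
  case False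
  then obtain i b where ib: "b \<in> Basis" "l $ i \<bullet> b > u $ i \<bullet> b"
    by (auto simp: not_le)
  then have "box (l $ i) (u $ i) = {}"
    by (auto simp: box_eq_empty intro!: bexI[of _ b])
  moreover from this have "box l u = {}"
    unfolding box_vec by blast
  ultimately show ?thesis
    by (simp add: prod_zero_iff) (metis emeasure_empty)
qed

text \<open>Agreement on boxes identifies the two measures; product-measure results (Fubini,
  independence, product integrals) thereby become available for vectors.\<close>

lemma distr_PiM_lborel_vec:
  "distr (PiM UNIV (\<lambda>_::'m::finite. lborel)) borel (\<lambda>f. \<chi> i. f i)
    = (lborel :: ('a::euclidean_space^'m) measure)"
proof (rule lborel_eqI[symmetric])
  interpret product_sigma_finite "\<lambda>_::'m. lborel :: 'a measure"
    by standard
  fix l u :: "'a^'m"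
  assume le: "\<And>b. b \<in> Basis \<Longrightarrow> l \<bullet> b \<le> u \<bullet> b"
  have m: "(\<lambda>f. \<chi> i. f i) \<in> measurable (PiM UNIV (\<lambda>_::'m. lborel :: 'a measure)) borel"
    by (intro borel_measurable_vec_lambda) (auto intro: measurable_component_singleton)
  have "(\<lambda>f. \<chi> i. f i) -` box l u \<inter> space (PiM UNIV (\<lambda>_::'m. lborel :: 'a measure)) = PiE UNIV (\<lambda>i. box (l $ i) (u $ i))"
    by (auto simp: box_vec space_PiM PiE_def)
  then have "emeasure (distr (PiM UNIV (\<lambda>_::'m. lborel)) borel (\<lambda>f. \<chi> i. f i)) (box l u)
      = (\<Prod>i\<in>UNIV. emeasure lborel (box (l $ i) (u $ i)))"
    using m by (simp add: emeasure_distr emeasure_PiM)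
  also have "\<dots> = (\<Prod>b\<in>Basis. (u - l) \<bullet> b)"
    using le by (subst emeasure_lborel_box_vec[symmetric]) (simp add: emeasure_lborel_box_eq)
  finally show "emeasure (distr (PiM UNIV (\<lambda>_::'m. lborel)) borel (\<lambda>f. \<chi> i. f i)) (box l u) = (\<Prod>b\<in>Basis. (u - l) \<bullet> b)" .
qed simp

lemma distr_lborel_reindex:
  fixes f :: "'b::finite \<Rightarrow> 'a::finite"
  assumes f: "bij f"
  shows "distr lborel borel (\<lambda>v::real^'a. \<chi> i. v $ f i) = lborel"
proof (rule lborel_eqI[symmetric])
  fix l u :: "real^'b"
  assume le: "\<And>b. b \<in> Basis \<Longrightarrow> l \<bullet> b \<le> u \<bullet> b"
  have m: "(\<lambda>v::real^'a. \<chi> i. v $ f i) \<in> borel_measurable borel"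
    by (intro borel_measurable_vec_lambda borel_measurable_vec_nth)
  have inv: "inv f (f i) = i" "f (inv f j) = j" for i j
    using f by (auto simp: bij_is_inj bij_is_surj surj_f_inv_f)
  have "(\<lambda>v::real^'a. \<chi> i. v $ f i) -` box l u = box (\<chi> j. l $ inv f j) (\<chi> j. u $ inv f j)"
    by (auto simp: box_vec) (metis inv)+
  then have "emeasure (distr lborel borel (\<lambda>v::real^'a. \<chi> i. v $ f i)) (box l u)
     = (\<Prod>j\<in>UNIV. emeasure lborel (box (l $ inv f j) (u $ inv f j)))"
    using m by (simp add: emeasure_distr emeasure_lborel_box_vec)
  also have "\<dots> = (\<Prod>i\<in>UNIV. emeasure lborel (box (l $ i) (u $ i)))"
    by (rule prod.reindex_bij_betw) (use f in \<open>simp add: bij_betw_inv_into\<close>)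
  also have "\<dots> = (\<Prod>b\<in>Basis. (u - l) \<bullet> b)"
    using le by (subst emeasure_lborel_box_vec[symmetric]) (simp add: emeasure_lborel_box_eq)
  finally show "emeasure (distr lborel borel (\<lambda>v::real^'a. \<chi> i. v $ f i)) (box l u) = (\<Prod>b\<in>Basis. (u - l) \<bullet> b)" .
qed simp

lemma lborel_distr_minus: "distr lborel borel (\<lambda>x. c - x :: 'a::euclidean_space) = lborel"
proof -
  have "lborel = density (distr lborel borel (\<lambda>x. c + (-1) *\<^sub>R x :: 'a)) (\<lambda>_. ennreal (\<bar>-1\<bar>^DIM('a)))"
    by (rule lborel_affine) simp
  then show ?thesis
    by (simp add: density_1)
qed

text \<open>The image measure \<open>M\<close> is translation invariant and gives every centred ball
  its Lebesgue measure. Translation-invariant sigma-finite measures are proportional, and the unit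
  ball fixes the factor as one. Unitary invariance of the Gaussian law and of the matrix law behind
  Haar measure rests on this.\<close>

lemma lborel_distr_isometry:
  fixes f :: "'a::euclidean_space \<Rightarrow> 'a"
  assumes lin: "linear f" and iso: "\<And>x. norm (f x) = norm x"
  shows "distr lborel borel f = lborel"
proof -
  define M where "M = distr lborel borel f"
  have [measurable]: "f \<in> borel_measurable borel"
    using lin by (intro borel_measurable_continuous_onI linear_continuous_on linear_linear[THEN iffD2])
  have inj: "inj f"
    by (metis iso lin linear_injective_0 norm_eq_zero)
  then obtain g where g: "f (g y) = y" for y
    by (metis lin linear_injective_imp_surjective surj_def)
  have sM[measurable_cong]: "sets M = sets borel"
    by (simp add: M_def)
  \<comment> \<open>Translation by \<open>y\<close> on the image side is translation by the preimage
    \<open>g y\<close> on the Lebesgue side; an injective linear endomorphism is onto, so preimages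
    exist.\<close>
  have trans: "(\<integral>\<^sup>+x. h (x - y) \<partial>M) = (\<integral>\<^sup>+x. h x \<partial>M)"
    if [measurable]: "h \<in> borel_measurable borel" for h :: "'a \<Rightarrow> ennreal" and y
  proof -
    have "(\<integral>\<^sup>+x. h (x - y) \<partial>M) = (\<integral>\<^sup>+x. h (f (- g y + x)) \<partial>lborel)"
      by (simp add: M_def nn_integral_distr linear_diff[OF lin] g)
    also have "\<dots> = (\<integral>\<^sup>+x. h (f x) \<partial>distr lborel borel ((+) (- g y)))"
      by (simp add: nn_integral_distr)
    also have "\<dots> = (\<integral>\<^sup>+x. h x \<partial>M)"
      by (simp add: lborel_distr_plus M_def nn_integral_distr)
    finally show ?thesis .
  qed
  have ball: "emeasure M (ball 0 r) = emeasure lborel (ball (0::'a) r)" for r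
  proof -
    have "f -` ball 0 r = ball 0 r" by (auto simp: iso)
    then show ?thesis by (simp add: M_def emeasure_distr)
  qed
  interpret M: sigma_finite_measure M
  proof
    show "\<exists>A. countable A \<and> A \<subseteq> sets M \<and> \<Union> A = space M \<and> (\<forall>a\<in>A. emeasure M a \<noteq> \<infinity>)"
    proof (intro exI[of _ "range (\<lambda>n. ball 0 (real n))"] conjI ballI)
      show "\<Union> (range (\<lambda>n. ball 0 (real n))) = space M"
        by (auto simp: M_def reals_Archimedean2)
      show "emeasure M a \<noteq> \<infinity>" if "a \<in> range (\<lambda>n. ball 0 (real n))" for a
        using that emeasure_lborel_ball_finite by (auto simp: ball less_top)
    qed (auto simp: sM)
  qed
  interpret P: pair_sigma_finite M "lborel :: 'a measure" ..
  have "emeasure lborel A = emeasure M A" if [measurable]: "A \<in> sets borel" for A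
  proof -
    define B where "B = ball (0::'a) 1"
    have [measurable]: "B \<in> sets borel" by (simp add: B_def)
    have shift: "(\<integral>\<^sup>+y. indicator B (x + y) \<partial>lborel) = emeasure lborel B" for x
    proof -
      have "(\<integral>\<^sup>+y. indicator B (x + y) \<partial>lborel) = (\<integral>\<^sup>+y. indicator B y \<partial>distr lborel borel ((+) x))"
        by (subst nn_integral_distr) auto
      then show ?thesis by (simp add: lborel_distr_plus)
    qed
    have reflect: "(\<integral>\<^sup>+y. indicator A (x - y) \<partial>lborel) = emeasure lborel A" for x
    proof -
      have "(\<integral>\<^sup>+y. indicator A (x - y) \<partial>lborel) = (\<integral>\<^sup>+y. indicator A y \<partial>distr lborel borel (\<lambda>y. x - y))"
        by (subst nn_integral_distr) auto
      then show ?thesis by (simp add: lborel_distr_minus)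
    qed
    \<comment> \<open>The mass of the pairs with \<open>x\<close> in \<open>A\<close> and
      \<open>x + y\<close> in \<open>B\<close> is computed twice: integrating over \<open>y\<close>
      at once gives \<open>M A\<close> times the volume of \<open>B\<close>; shifting
      \<open>x\<close> by invariance of \<open>M\<close> and then reflecting \<open>y\<close> gives
      the volume of \<open>A\<close> times \<open>M B\<close>.\<close>
    have "emeasure M A * emeasure lborel B = (\<integral>\<^sup>+x. \<integral>\<^sup>+y. indicator A x * indicator B (x + y) \<partial>lborel \<partial>M)"
      by (simp add: nn_integral_cmult nn_integral_multc shift)
    also have "\<dots> = (\<integral>\<^sup>+y. \<integral>\<^sup>+x. indicator A x * indicator B (x + y) \<partial>M \<partial>lborel)"
      by (rule P.Fubini'[symmetric]) simp
    also have "\<dots> = (\<integral>\<^sup>+y. \<integral>\<^sup>+x. indicator A (x - y) * indicator B x \<partial>M \<partial>lborel)"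
    proof (rule nn_integral_cong)
      show "(\<integral>\<^sup>+x. indicator A x * indicator B (x + y) \<partial>M) = (\<integral>\<^sup>+x. indicator A (x - y) * indicator B x \<partial>M)" for y
        using trans[of "\<lambda>x. indicator A x * indicator B (x + y)" y] by simp
    qed
    also have "\<dots> = (\<integral>\<^sup>+x. \<integral>\<^sup>+y. indicator A (x - y) * indicator B x \<partial>lborel \<partial>M)"
      by (rule P.Fubini') simp
    also have "\<dots> = emeasure lborel A * emeasure M B"
      by (simp add: nn_integral_cmult nn_integral_multc reflect)
    finally have eq: "emeasure M A * emeasure lborel B = emeasure lborel A * emeasure lborel B"
      by (simp add: B_def ball)
    moreover have "emeasure lborel B \<noteq> 0"
      using content_ball_pos[of 1 "0::'a"] by (auto simp: B_def measure_def)
    moreover have "emeasure lborel B \<noteq> top"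
      using emeasure_lborel_ball_finite[of 0 1] by (auto simp: B_def less_top)
    ultimately have "emeasure M A = emeasure lborel A"
      by (metis ennreal_mult_cancel_left mult.commute)
    then show ?thesis by simp
  qed
  then show ?thesis
    unfolding M_def[symmetric] by (intro measure_eqI) (auto simp: sM)
qed

lemma AE_lborel_hyperplane:
  assumes "a \<noteq> 0"
  shows "AE v in lborel. a \<bullet> v \<noteq> (b::real)"
proof -
  have "negligible {v. a \<bullet> v = b}"
    using assms by (intro negligible_hyperplane) simp
  then have "{v. a \<bullet> v = b} \<in> null_sets lborel"
    by (simp add: negligible_iff_null_sets null_sets_completion_iff)
  then show ?thesis
    by (rule AE_I') auto
qed

lemma AE_lborel_vec_nth_neq:
  fixes i j :: "'n::finite"
  assumes "i \<noteq> j"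
  shows "AE v in lborel. (v::real^'n) $ i \<noteq> v $ j"
proof -
  have "axis i 1 - axis j 1 \<noteq> (0 :: real^'n)"
    using assms by (auto simp: vec_eq_iff axis_def)
  from AE_lborel_hyperplane[OF this, of 0] show ?thesis
    by (simp add: inner_diff_left inner_axis')
qed

lemma AE_lborel_vec_nth_neq_const: "AE v in lborel. (v::real^'n) $ i \<noteq> c"
proof -
  have "axis i 1 \<noteq> (0 :: real^'n)"
    by (auto simp: vec_eq_iff axis_def)
  from AE_lborel_hyperplane[OF this, of c] show ?thesis
    by (simp add: inner_axis')
qed

section \<open>Change of variables over an arbitrary finite index type\<close>

lemma det_reindex:
  fixes A :: "'c::comm_ring_1^'a^'a" and f :: "'b::finite \<Rightarrow> 'a::finite"
  assumes f: "bij f"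
  shows "det (\<chi> i j. A $ f i $ f j) = det A"
proof -
  have inj: "inj f" and surj: "range f = UNIV" using f by (auto simp: bij_def)
  have "det A = (\<Sum>p | p permutes UNIV. of_int (sign (map_permutation UNIV f p)) * (\<Prod>i\<in>UNIV. A $ i $ map_permutation UNIV f p i))"
    unfolding det_def
  proof (rule sum.reindex_bij_betw[symmetric])
    \<comment> \<open>Conjugation by \<open>f\<close> matches the permutations of the two index
      types; it also preserves signs.\<close>
    show "bij_betw (map_permutation UNIV f) {p. p permutes UNIV} {p. p permutes UNIV}"
      by (rule bij_betw_byWitness[where f' = "map_permutation UNIV (inv f)"])
        (use f in \<open>auto simp: map_permutation_compose_inv map_permutation_permutes inv_f_f[OF inj] surj_f_inv_f[OF surj] bij_imp_bij_inv\<close>)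
  qed
  also have "\<dots> = (\<Sum>p | p permutes UNIV. of_int (sign p) * (\<Prod>i\<in>UNIV. A $ f i $ f (p i)))"
  proof (intro sum.cong refl)
    fix p :: "'b \<Rightarrow> 'b" assume p: "p \<in> {p. p permutes UNIV}"
    have "(\<Prod>i\<in>UNIV. A $ i $ map_permutation UNIV f p i) = (\<Prod>i\<in>UNIV. A $ f i $ map_permutation UNIV f p (f i))"
      by (rule prod.reindex_bij_betw[OF f, symmetric])
    then show "of_int (sign (map_permutation UNIV f p)) * (\<Prod>i\<in>UNIV. A $ i $ map_permutation UNIV f p i)
      = of_int (sign p) * (\<Prod>i\<in>UNIV. A $ f i $ f (p i))"
      using p inj by (simp add: sign_map_permutation map_permutation_apply)
  qed
  finally show ?thesis
    by (simp add: det_def)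
qed

text \<open>Both sides integrate \<open>h\<close> against measures on the image side, so it suffices
  to compare these on a Borel set \<open>A\<close>. There the formula for the measure of a
  differentiable injective image applies to the points of \<open>S\<close> mapped into
  \<open>A\<close>; boundedness of \<open>T\<close> keeps that measure finite.\<close>

lemma nn_integral_change_of_variables_wellorder:
  fixes g :: "real^'n::{finite,wellorder} \<Rightarrow> real^'n::_"
  assumes S: "S \<in> sets borel" and T: "T \<in> sets borel" "bounded T"
    and g: "g \<in> borel_measurable borel" 
    and der: "\<And>x. x \<in> S \<Longrightarrow> (g has_derivative g' x) (at x within S)"
    and inj: "inj_on g S" and img: "g ` S = T"
    and J: "J \<in> borel_measurable borel" "\<And>x. x \<in> S \<Longrightarrow> \<bar>det (matrix (g' x))\<bar> = J x"
    and h: "h \<in> borel_measurable borel"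
  shows "(\<integral>\<^sup>+y. h y * indicator T y \<partial>lborel) = (\<integral>\<^sup>+x. h (g x) * ennreal (J x) * indicator S x \<partial>lborel)"
proof -
  note [measurable] = S T g J h
  have "density lborel (indicator T) = distr (density lborel (\<lambda>x. ennreal (J x) * indicator S x)) borel g"
  proof (rule measure_eqI)
    fix A assume "A \<in> sets (density lborel (indicator T))"
    then have [measurable]: "A \<in> sets borel" by simp
    define S' where "S' = S \<inter> g -` A"
    have "g -` A \<in> sets borel" using measurable_sets_borel[of g borel A] by simp
    then have [measurable]: "S' \<in> sets borel" by (auto simp: S'_def)
    have img': "g ` S' = A \<inter> T"
      using img by (auto simp: S'_def)
    have fin: "emeasure lborel (A \<inter> T) < \<infinity>"
      using emeasure_bounded_finite[of T] T emeasure_mono[of "A \<inter> T" T lborel] by (auto simp: less_top top_unique)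
    then have "A \<inter> T \<in> lmeasurable"
      by (auto simp: fmeasurable_def)
    moreover have "(g has_derivative g' x) (at x within S')" if "x \<in> S'" for x
      using der[of x] that by (auto simp: S'_def intro: has_derivative_subset)
    moreover have "inj_on g S'"
      using inj by (auto simp: S'_def inj_on_def)
    ultimately have "((\<lambda>x. \<bar>det (matrix (g' x))\<bar>) has_integral measure lebesgue (A \<inter> T)) S'"
      using has_measure_differentiable_image[of S' g g' "measure lebesgue (A \<inter> T)"] by (simp add: img')
    then have "(J has_integral measure lebesgue (A \<inter> T)) S'"
      by (subst (asm) has_integral_cong[where g = J]) (auto simp: S'_def J)
    moreover have "0 \<le> J x" if "x \<in> S'" for x
      using J(2)[of x] that by (auto simp: S'_def)
    ultimately have "(\<integral>\<^sup>+x. ennreal (J x) * indicator S' x \<partial>lborel) = ennreal (measure lebesgue (A \<inter> T))"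
      by (intro nn_integral_has_integral_lebesgue') auto
    also have "\<dots> = emeasure lborel (A \<inter> T)"
      using fin by (simp add: emeasure_eq_ennreal_measure less_top)
    finally have *: "(\<integral>\<^sup>+x. ennreal (J x) * indicator S' x \<partial>lborel) = emeasure lborel (A \<inter> T)" .
    have "emeasure (distr (density lborel (\<lambda>x. ennreal (J x) * indicator S x)) borel g) A
       = (\<integral>\<^sup>+x. ennreal (J x) * indicator S x * indicator (g -` A) x \<partial>lborel)"
      using measurable_sets_borel[of g borel A] by (subst emeasure_distr) (auto simp: emeasure_density)
    also have "\<dots> = (\<integral>\<^sup>+x. ennreal (J x) * indicator S' x \<partial>lborel)"
      by (intro nn_integral_cong) (auto simp: S'_def indicator_def)
    also have "\<dots> = emeasure (density lborel (indicator T)) A"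
      unfolding * by (subst emeasure_density) (auto simp: indicator_inter_arith[symmetric] Int_commute)
    finally show "emeasure (density lborel (indicator T)) A = emeasure (distr (density lborel (\<lambda>x. ennreal (J x) * indicator S x)) borel g) A" ..
  qed simp
  then have "(\<integral>\<^sup>+y. h y \<partial>density lborel (indicator T)) = (\<integral>\<^sup>+y. h y \<partial>distr (density lborel (\<lambda>x. ennreal (J x) * indicator S x)) borel g)"
    by simp
  then show ?thesis
    by (simp add: nn_integral_density nn_integral_distr mult_ac)
qed

text \<open>The library's change of variables theorem requires a well-ordered index type, so every finite
  index type gets a well-ordered copy.\<close>
typedef 'a wo = "UNIV :: 'a set" morphisms wo_rep wo_abs ..

instance wo :: (finite) finite
proof
  have "(UNIV :: 'a wo set) = range wo_abs"
    by (metis UNIV_eq_I rangeI wo_rep_inverse)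
  then show "finite (UNIV :: 'a wo set)"
    by (metis finite finite_imageI)
qed

instantiation wo :: (finite) wellorder
begin

definition less_eq_wo :: "'a wo \<Rightarrow> 'a wo \<Rightarrow> bool" where
  "x \<le> y \<longleftrightarrow> to_nat (wo_rep x) \<le> to_nat (wo_rep y)"

definition less_wo :: "'a wo \<Rightarrow> 'a wo \<Rightarrow> bool" where
  "x < y \<longleftrightarrow> to_nat (wo_rep x) < to_nat (wo_rep y)"

instance
proof
  fix P :: "'a wo \<Rightarrow> bool" and a :: "'a wo"
  assume *: "\<And>x. (\<And>y. y < x \<Longrightarrow> P y) \<Longrightarrow> P x"
  show "P a"
  proof (induction a rule: measure_induct_rule[of "\<lambda>x. to_nat (wo_rep x)"])
    case (less x)
    show ?case by (rule *) (rule less, simp add: less_wo_def)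
  qed
qed (auto simp: less_eq_wo_def less_wo_def wo_rep_inject)

end

text \<open>Coordinates are relabelled by the well-ordered copy on both sides. Relabelling preserves
  Lebesgue measure and only reindexes the Jacobian matrix, so its determinant is unchanged.\<close>

lemma nn_integral_change_of_variables:
  fixes g :: "real^'n \<Rightarrow> real^'n"
  assumes S: "S \<in> sets borel" and T: "T \<in> sets borel" "bounded T"
    and g: "g \<in> borel_measurable borel"
    and der: "\<And>x. x \<in> S \<Longrightarrow> (g has_derivative g' x) (at x within S)"
    and inj: "inj_on g S" and img: "g ` S = T"
    and J: "J \<in> borel_measurable borel" "\<And>x. x \<in> S \<Longrightarrow> \<bar>det (matrix (g' x))\<bar> = J x"
    and h: "h \<in> borel_measurable borel"
  shows "(\<integral>\<^sup>+y. h y * indicator T y \<partial>lborel) = (\<integral>\<^sup>+x. h (g x) * ennreal (J x) * indicator S x \<partial>lborel)"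
proof -
  define \<phi> where "\<phi> v = (\<chi> i. v $ wo_rep i)" for v :: "real^'n"
  define \<psi> where "\<psi> w = (\<chi> i. w $ wo_abs i)" for w :: "real^'n wo"
  have bij: "bij (wo_rep :: 'n wo \<Rightarrow> 'n)" "bij (wo_abs :: 'n \<Rightarrow> 'n wo)"
    by (auto intro!: bijI' simp: wo_rep_inject wo_abs_inject) (metis wo_abs_inverse UNIV_I, metis wo_rep_inverse)
  have [simp]: "\<psi> (\<phi> v) = v" "\<phi> (\<psi> w) = w" for v w
    by (simp_all add: \<phi>_def \<psi>_def wo_abs_inverse wo_rep_inverse vec_eq_iff)
  have [measurable]: "\<phi> \<in> borel_measurable borel" "\<psi> \<in> borel_measurable borel"
    unfolding \<phi>_def \<psi>_def by (intro borel_measurable_vec_lambda borel_measurable_vec_nth)+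
  have lin: "linear \<phi>" "linear \<psi>"
    by (auto intro!: linearI simp: \<phi>_def \<psi>_def vec_eq_iff)
  have d\<phi>: "distr lborel borel \<phi> = lborel" 
    unfolding \<phi>_def using bij(1) by (rule distr_lborel_reindex)
  have d\<psi>: "distr lborel borel \<psi> = lborel"
    unfolding \<psi>_def using bij(2) by (rule distr_lborel_reindex)
  define g2' where "g2' w = \<phi> \<circ> g' (\<psi> w) \<circ> \<psi>" for w
  note [measurable] = S T g J h
  have pre: "\<psi> -` A \<in> sets borel" if "A \<in> sets borel" for A
    using that measurable_sets_borel[of \<psi> borel A] by simp
  have "(\<integral>\<^sup>+y. h y * indicator T y \<partial>lborel) = (\<integral>\<^sup>+y. h (\<psi> y) * indicator (\<psi> -` T) y \<partial>lborel)"
    by (subst d\<psi>[symmetric], subst nn_integral_distr) (auto simp: indicator_def)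
  also have "\<dots> = (\<integral>\<^sup>+x. h (\<psi> (\<phi> (g (\<psi> x)))) * ennreal (J (\<psi> x)) * indicator (\<psi> -` S) x \<partial>lborel)"
  proof (rule nn_integral_change_of_variables_wellorder[where g' = g2'])
    have "\<psi> -` T = \<phi> ` T" by (auto simp: image_iff) (metis \<open>\<And>w. \<phi> (\<psi> w) = w\<close>)
    then show "bounded (\<psi> -` T)"
      using T(2) lin by (simp add: bounded_linear_image linear_conv_bounded_linear)
    show "((\<lambda>x. \<phi> (g (\<psi> x))) has_derivative g2' x) (at x within \<psi> -` S)" if "x \<in> \<psi> -` S" for x
    proof -
      have "(\<psi> has_derivative \<psi>) (at x within \<psi> -` S)"
        using lin by (intro bounded_linear_imp_has_derivative) (simp add: linear_conv_bounded_linear)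
      moreover have "(g has_derivative g' (\<psi> x)) (at (\<psi> x) within \<psi> ` (\<psi> -` S))"
        using der[of "\<psi> x"] that by (auto intro: has_derivative_subset)
      ultimately have "((g \<circ> \<psi>) has_derivative (g' (\<psi> x) \<circ> \<psi>)) (at x within \<psi> -` S)"
        by (rule diff_chain_within)
      then have "((\<lambda>x. \<phi> ((g \<circ> \<psi>) x)) has_derivative (\<lambda>y. \<phi> ((g' (\<psi> x) \<circ> \<psi>) y))) (at x within \<psi> -` S)"
        using lin(1)[unfolded linear_conv_bounded_linear] by (rule bounded_linear.has_derivative[rotated])
      then show ?thesis by (simp add: g2'_def comp_def)
    qed
    show "inj_on (\<lambda>x. \<phi> (g (\<psi> x))) (\<psi> -` S)"
      using inj by (auto simp: inj_on_def) (metis \<open>\<And>v. \<psi> (\<phi> v) = v\<close> \<open>\<And>w. \<phi> (\<psi> w) = w\<close>)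
    show "(\<lambda>x. \<phi> (g (\<psi> x))) ` (\<psi> -` S) = \<psi> -` T"
    proof (intro equalityI subsetI)
      fix w assume "w \<in> \<psi> -` T"
      then obtain v where "v \<in> S" "\<psi> w = g v" by (auto simp: img[symmetric])
      then have "\<phi> v \<in> \<psi> -` S" "w = \<phi> (g (\<psi> (\<phi> v)))"
        by (simp_all flip: \<open>\<psi> w = g v\<close>)
      then show "w \<in> (\<lambda>x. \<phi> (g (\<psi> x))) ` (\<psi> -` S)" by blast
    qed (auto simp: img[symmetric])
    show "\<bar>det (matrix (g2' x))\<bar> = J (\<psi> x)" if "x \<in> \<psi> -` S" for x
    proof -
      have "matrix (g2' x) = (\<chi> i j. matrix (g' (\<psi> x)) $ wo_rep i $ wo_rep j)"
      proof -
        have ax: "\<psi> (axis j 1) = axis (wo_rep j) 1" for j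
          by (auto simp: \<psi>_def vec_eq_iff axis_def wo_abs_inverse wo_rep_inverse)
        show ?thesis
          by (simp add: g2'_def matrix_def \<phi>_def vec_eq_iff ax)
      qed
      then show ?thesis
        using J(2)[of "\<psi> x"] that det_reindex[OF bij(1), of "matrix (g' (\<psi> x))"] by simp
    qed
  qed (use pre S T in auto)
  also have "\<dots> = (\<integral>\<^sup>+x. h (g (\<psi> x)) * ennreal (J (\<psi> x)) * indicator S (\<psi> x) \<partial>lborel)"
    by (simp add: indicator_def)
  also have "\<dots> = (\<integral>\<^sup>+x. h (g x) * ennreal (J x) * indicator S x \<partial>distr lborel borel \<psi>)"
    by (subst nn_integral_distr) auto
  finally show ?thesis
    by (simp add: d\<psi>)
qed

section \<open>Unitary matrices and characteristic polynomials\<close>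

definition cdot :: "complex^'m \<Rightarrow> complex^'m \<Rightarrow> complex" where
  "cdot v w = (\<Sum>i\<in>UNIV. cnj (v $ i) * w $ i)"

lemma cdot_self: "cdot v v = of_real ((norm v)\<^sup>2)"
proof -
  have "(norm v)\<^sup>2 = (\<Sum>i\<in>UNIV. (norm (v $ i))\<^sup>2)"
    by (simp add: norm_vec_def L2_set_def sum_nonneg)
  moreover have "cnj z * z = of_real ((norm z)\<^sup>2)" for z
    by (metis complex_norm_square mult.commute of_real_power)
  ultimately show ?thesis
    by (simp add: cdot_def)
qed

lemma cdot_scale: "cdot (a *s v) (b *s w) = cnj a * b * cdot v w"
  by (simp add: cdot_def sum_distrib_left mult_ac)

lemma cnj_cdot: "cnj (cdot v w) = cdot w v"
  by (simp add: cdot_def mult_ac)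

lemma cdot_mult_vec: "cdot v (A *v w) = cdot (cadj A *v v) w"
proof -
  have "cdot v (A *v w) = (\<Sum>i\<in>UNIV. \<Sum>j\<in>UNIV. cnj (v $ i) * A $ i $ j * w $ j)"
    by (simp add: cdot_def matrix_vector_mult_def sum_distrib_left mult_ac)
  also have "\<dots> = (\<Sum>j\<in>UNIV. \<Sum>i\<in>UNIV. cnj (v $ i) * A $ i $ j * w $ j)"
    by (rule sum.swap)
  also have "\<dots> = cdot (cadj A *v v) w"
    by (simp add: cdot_def matrix_vector_mult_def cadj_def sum_distrib_right sum_distrib_left mult_ac)
  finally show ?thesis .
qed

lemma cadj_cadj [simp]: "cadj (cadj A) = A"
  by (simp add: cadj_def vec_eq_iff)

lemma cadj_mult: "cadj (A ** B) = cadj B ** cadj A"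
  by (simp add: cadj_def matrix_matrix_mult_def vec_eq_iff mult_ac)

lemma unitary_mat_right: "unitary_mat U \<Longrightarrow> U ** cadj U = mat 1"
  by (simp add: unitary_mat_def matrix_left_right_inverse)

lemma unitary_cadj: "unitary_mat U \<Longrightarrow> unitary_mat (cadj U)"
  using unitary_mat_right[of U] by (simp add: unitary_mat_def)

lemma unitary_iff_columns:
  "unitary_mat U \<longleftrightarrow> (\<forall>i j. cdot (column i U) (column j U) = (if i = j then 1 else 0))"
  by (simp add: unitary_mat_def cdot_def column_def cadj_def matrix_matrix_mult_def mat_def vec_eq_iff)

lemma unitary_norm: "unitary_mat U \<Longrightarrow> norm (U *v x) = norm x"
proof -
  assume "unitary_mat U"
  then have "cdot (U *v x) (U *v x) = cdot x x"
    by (simp add: cdot_mult_vec matrix_vector_mul_assoc unitary_mat_def)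
  then show ?thesis
    by (simp add: cdot_self flip: of_real_power)
qed

lemma norm_matrix_sq: "(norm (A :: complex^'n^'m))\<^sup>2 = (\<Sum>j\<in>UNIV. (norm (column j A))\<^sup>2)"
proof -
  have "(norm A)\<^sup>2 = (\<Sum>i\<in>UNIV. \<Sum>j\<in>UNIV. (norm (A $ i $ j))\<^sup>2)"
    by (simp add: norm_vec_def L2_set_def sum_nonneg)
  also have "\<dots> = (\<Sum>j\<in>UNIV. \<Sum>i\<in>UNIV. (norm (A $ i $ j))\<^sup>2)"
    by (rule sum.swap)
  finally show ?thesis
    by (simp add: norm_vec_def L2_set_def sum_nonneg column_def)
qed

lemma unitary_norm_matrix:
  assumes "unitary_mat U"
  shows "norm (U ** A) = norm A"
proof -
  have "column j (U ** A) = U *v column j A" for j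
    by (simp add: column_def matrix_matrix_mult_def matrix_vector_mult_def vec_eq_iff)
  then have "(norm (U ** A))\<^sup>2 = (norm A)\<^sup>2"
    using assms by (simp add: norm_matrix_sq unitary_norm)
  then show ?thesis by simp
qed

lemma exists_kernel_vector:
  fixes A :: "complex^'m^'m"
  assumes "det A = 0"
  obtains v where "cdot v v = 1" "A *v v = 0"
proof -
  have "\<not> (\<exists>B. B ** A = mat 1)"
    using assms invertible_det_nz[of A] invertible_left_inverse[of A] by blast
  then obtain x where x: "A *v x = 0" "x \<noteq> 0"
    by (auto simp: matrix_left_invertible_ker)
  define v where "v = complex_of_real (1 / norm x) *s x"
  have "cdot v v = cnj (complex_of_real (1 / norm x)) * complex_of_real (1 / norm x) * cdot x x"
    unfolding v_def by (rule cdot_scale)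
  also have "\<dots> = 1"
    using x by (simp add: cdot_self power2_eq_square)
  finally have "cdot v v = 1" .
  moreover have "A *v v = 0"
    using x by (simp add: v_def vector_scalar_commute)
  ultimately show ?thesis ..
qed

text \<open>One vector is added at a time: a new unit vector that is orthogonal to the family and
  supported in \<open>R\<close> is found as a kernel vector of a singular square matrix.\<close>

lemma exists_orthonormal_extension:
  fixes v :: "'m::finite \<Rightarrow> complex^'m"
  assumes "finite F" "D \<inter> F = {}" "D \<union> F \<subseteq> R"
    and "\<forall>i\<in>D. \<forall>j\<in>D. cdot (v i) (v j) = (if i = j then 1 else 0)"
    and "\<forall>i\<in>D. \<forall>k. k \<notin> R \<longrightarrow> v i $ k = 0"
  shows "\<exists>w. (\<forall>i\<in>D. w i = v i) \<and> (\<forall>i\<in>D\<union>F. \<forall>j\<in>D\<union>F. cdot (w i) (w j) = (if i = j then 1 else 0))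
    \<and> (\<forall>i\<in>D\<union>F. \<forall>k. k \<notin> R \<longrightarrow> w i $ k = 0)"
  using assms(1-3)
proof (induction F)
  case empty
  then show ?case using assms by (intro exI[of _ v]) auto
next
  case (insert k F)
  then obtain w where w: "\<forall>i\<in>D. w i = v i" "\<forall>i\<in>D\<union>F. \<forall>j\<in>D\<union>F. cdot (w i) (w j) = (if i = j then 1 else 0)"
    "\<forall>i\<in>D\<union>F. \<forall>k. k \<notin> R \<longrightarrow> w i $ k = 0"
    by auto
  have k: "k \<notin> D \<union> F" "k \<in> R" using insert by auto
  \<comment> \<open>Rows of vectors already present enforce orthogonality, rows outside
    \<open>R\<close> force the coordinate there to vanish, and the remaining rows are zero. Row
    \<open>k\<close> is one of the latter, so \<open>B\<close> is singular.\<close>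
  define B where "B = (\<chi> i. if i \<in> D \<union> F then (\<chi> j. cnj (w i $ j)) else if i \<in> R then 0 else axis i 1)"
  have "row k B = 0" using k by (simp add: B_def row_def vec_eq_iff)
  then have "det B = 0" by (rule det_zero_row)
  then obtain u where u: "cdot u u = 1" "B *v u = 0"
    by (rule exists_kernel_vector)
  have uR: "u $ j = 0" if "j \<notin> R" for j
  proof -
    have "j \<notin> D \<union> F" using that insert.prems by auto
    then have "(B *v u) $ j = u $ j"
      using that by (simp add: B_def matrix_vector_mult_def axis_def if_distrib[where f="\<lambda>a. a * _"] cong: if_cong)
    then show ?thesis by (simp add: u)
  qed
  have wu: "cdot (w i) u = 0" if "i \<in> D \<union> F" for i
  proof -
    have "(B *v u) $ i = cdot (w i) u"
      using that by (simp add: B_def matrix_vector_mult_def cdot_def)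
    then show ?thesis by (simp add: u)
  qed
  have uw: "cdot u (w i) = 0" if "i \<in> D \<union> F" for i
    using wu[OF that] cnj_cdot[of "w i" u] by simp
  show ?case
    using w k u uR wu uw by (intro exI[of _ "w(k := u)"]) auto
qed

text \<open>Acting as the identity outside \<open>R\<close>, the unitary rotates only the rows still
  present. This is how the removal of one row is applied after others have already been
  removed.\<close>

lemma exists_unitary_extension:
  fixes v :: "'m::finite \<Rightarrow> complex^'m"
  assumes "D \<subseteq> R"
    and "\<And>i j. i \<in> D \<Longrightarrow> j \<in> D \<Longrightarrow> cdot (v i) (v j) = (if i = j then 1 else 0)"
    and "\<And>i k. i \<in> D \<Longrightarrow> k \<notin> R \<Longrightarrow> v i $ k = 0"
  obtains V where "unitary_mat V" "\<And>i. i \<in> D \<Longrightarrow> column i V = v i"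
    "\<And>i j. i \<notin> R \<or> j \<notin> R \<Longrightarrow> V $ i $ j = (if i = j then 1 else 0)"
proof -
  have "D \<inter> (R - D) = {}" "D \<union> (R - D) = R" using assms(1) by auto
  then obtain w where w: "\<forall>i\<in>D. w i = v i" "\<forall>i\<in>R. \<forall>j\<in>R. cdot (w i) (w j) = (if i = j then 1 else 0)"
    "\<forall>i\<in>R. \<forall>k. k \<notin> R \<longrightarrow> w i $ k = 0"
    using exists_orthonormal_extension[of "R - D" D R v] assms by auto
  define V where "V = (\<chi> i j. (if j \<in> R then w j else axis j 1) $ i)"
  have col: "column j V = (if j \<in> R then w j else axis j 1)" for j
    by (simp add: V_def column_def vec_eq_iff)
  have "cdot (axis i 1) x = x $ i" "cdot x (axis i 1) = cnj (x $ i)" for x :: "complex^'m" and i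
    by (simp_all add: cdot_def axis_def if_distrib[where f="\<lambda>a. a * _"] if_distrib[where f="\<lambda>a. _ * a"] if_distrib[where f=cnj] cong: if_cong)
  then have "unitary_mat V"
    using w by (auto simp: unitary_iff_columns col) (auto simp: axis_def)
  moreover have "column i V = v i" if "i \<in> D" for i
    using w that assms(1) by (auto simp: col)
  moreover have "V $ i $ j = (if i = j then 1 else 0)" if "i \<notin> R \<or> j \<notin> R" for i j
    using that w by (auto simp: V_def axis_def)
  ultimately show ?thesis ..
qed

section \<open>Characteristic polynomials, diagonalisation and rank-one updates\<close>

lemma poly_charpoly: "poly (charpoly A) t = det (\<chi> i j. (if i = j then t else 0) - A $ i $ j)"
proof -
  have "poly (charpoly A) t = (\<Sum>p | p permutes UNIV. of_int (sign p) * (\<Prod>i\<in>UNIV. (if i = p i then t else 0) - A $ i $ p i))"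
    by (simp add: charpoly_def det_def poly_sum poly_prod) (simp add: if_distrib[where f = "\<lambda>q. poly q t"] cong: if_cong)
  then show ?thesis by (simp add: det_def)
qed

lemma charpoly_unitary_conj:
  fixes A W :: "complex^'n^'n"
  assumes "unitary_mat W"
  shows "charpoly (cadj W ** A ** W) = charpoly A"
proof -
  have "poly (charpoly (cadj W ** A ** W)) t = poly (charpoly A) t" for t
  proof -
    define D where "D = ((\<chi> i j. if i = j then t else 0) :: complex^'n^'n)"
    have DW: "D ** W = (\<chi> i j. t * W $ i $ j)"
      by (simp add: D_def matrix_matrix_mult_def vec_eq_iff if_distrib[where f="\<lambda>a. a * _"] cong: if_cong)
    have "cadj W ** (\<chi> i j. t * W $ i $ j) = (\<chi> i j. t * (cadj W ** W) $ i $ j)"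
      by (simp add: matrix_matrix_mult_def vec_eq_iff sum_distrib_left mult_ac)
    then have WDW: "cadj W ** D ** W = D"
      using assms by (simp add: DW matrix_mul_assoc[symmetric] unitary_mat_def) (simp add: D_def mat_def vec_eq_iff)
    have sub: "cadj W ** (D - A) ** W = cadj W ** D ** W - cadj W ** A ** W"
      by (simp add: matrix_matrix_mult_def vec_eq_iff sum_subtractf[symmetric] algebra_simps sum_distrib_left sum_distrib_right)
    have ev: "poly (charpoly B) t = det (D - B)" for B :: "complex^'n^'n"
      unfolding poly_charpoly D_def by (rule arg_cong[where f=det]) (simp add: vec_eq_iff)
    have "det (cadj W) * det W = 1"
      using assms by (metis det_I det_mul unitary_mat_def)
    then have "det (cadj W ** (D - A) ** W) = det (D - A)"
      by (simp add: det_mul)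
    then show ?thesis
      by (simp add: ev sub WDW)
  qed
  then show ?thesis by (simp add: poly_eq_poly_eq_iff[symmetric] fun_eq_iff)
qed

text \<open>Distinct eigenvalues replace the usual deflation: each root of the characteristic
  polynomial yields a unit eigenvector, and Hermitian symmetry makes eigenvectors of different
  eigenvalues orthogonal.\<close>

lemma exists_unitary_diagonalization:
  fixes M :: "complex^'n^'n" and x :: "real^'n"
  assumes herm: "cadj M = M" and x: "real_eigvals M x" and dist: "\<And>j k. j \<noteq> k \<Longrightarrow> x $ j \<noteq> x $ k"
  obtains W where "unitary_mat W" "cadj W ** M ** W = (\<chi> i j. if i = j then complex_of_real (x $ i) else 0)"
proof -
  have "\<exists>v. cdot v v = 1 \<and> M *v v = complex_of_real (x $ k) *s v" for k
  proof -
    define B where "B = (\<chi> i j. (if i = j then complex_of_real (x $ k) else 0) - M $ i $ j)"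
    have "det B = poly (\<Prod>i\<in>UNIV. [:- complex_of_real (x $ i), 1:]) (x $ k)"
      using x poly_charpoly[of M "complex_of_real (x $ k)"] by (simp add: B_def real_eigvals_def)
    also have "\<dots> = 0" by (auto simp: poly_prod prod_zero_iff)
    finally obtain v where v: "cdot v v = 1" "B *v v = 0" by (rule exists_kernel_vector)
    have "B *v v = complex_of_real (x $ k) *s v - M *v v"
      by (simp add: B_def matrix_vector_mult_def vec_eq_iff left_diff_distrib sum_subtractf if_distrib[where f="\<lambda>a. a * _"] cong: if_cong)
    with v show ?thesis by auto
  qed
  then obtain w where w: "cdot (w k) (w k) = 1" "M *v w k = complex_of_real (x $ k) *s w k" for k
    by metis
  define W where "W = (\<chi> i j. w j $ i)"
  have col: "column j W = w j" for j by (simp add: W_def column_def vec_eq_iff)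
  have scale: "cdot (w j) (complex_of_real a *s w k) = a * cdot (w j) (w k)"
    "cdot (complex_of_real a *s w j) (w k) = a * cdot (w j) (w k)" for a j k
    using cdot_scale[of 1 "w j" a "w k"] cdot_scale[of a "w j" 1 "w k"] by simp_all
  have orth: "cdot (w j) (w k) = 0" if "j \<noteq> k" for j k
  proof -
    \<comment> \<open>Moving \<open>M\<close> across \<open>cdot\<close> evaluates the same number
      with either eigenvalue; these are real, so no conjugate appears.\<close>
    have "complex_of_real (x $ k) * cdot (w j) (w k) = complex_of_real (x $ j) * cdot (w j) (w k)"
      using cdot_mult_vec[of "w j" M "w k"] by (simp add: herm w scale)
    then show ?thesis using dist[OF that] by simp
  qed
  have U: "unitary_mat W" using w orth by (auto simp: unitary_iff_columns col)
  have "(cadj W ** M ** W) $ i $ j = cdot (w i) (M *v w j)" for i j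
    by (simp add: matrix_mul_assoc[symmetric]) 
       (simp add: cdot_def matrix_matrix_mult_def matrix_vector_mult_def cadj_def W_def)
  then have "cadj W ** M ** W = (\<chi> i j. if i = j then complex_of_real (x $ i) else 0)"
    using w orth by (simp add: vec_eq_iff scale)
  with U show ?thesis ..
qed

text \<open>With row \<open>k\<close> equal to \<open>b\<close>, every other contribution
  \<open>a i * b j\<close> is a multiple of row \<open>k\<close> and can be cleared, one row at a
  time.\<close>

lemma det_diag_rank_one_aux:
  fixes a b d :: "'n::finite \<Rightarrow> 'a::comm_ring_1"
  assumes "finite S" "k \<notin> S"
  shows "det (\<chi> i j. if i = k then b j else (if i = j then d i else 0) + (if i \<in> S then a i * b j else 0))
    = b k * (\<Prod>i\<in>UNIV-{k}. d i)"
  using assms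
proof (induction S)
  case empty
  define D where "D = ((\<chi> i j. if i = k then b j else if i = j then d i else 0) :: 'a^'n^'n)"
  have "det D = (\<Sum>p | p permutes UNIV. of_int (sign p) * (\<Prod>i\<in>UNIV. D $ i $ p i))"
    by (simp add: det_def)
  also have "\<dots> = (\<Sum>p\<in>{id}. of_int (sign p) * (\<Prod>i\<in>UNIV. D $ i $ p i))"
  proof (rule sum.mono_neutral_right)
    show "\<forall>p\<in>{p. p permutes UNIV} - {id}. of_int (sign p) * (\<Prod>i\<in>UNIV. D $ i $ p i) = 0"
    proof
      fix p assume p: "p \<in> {p. p permutes (UNIV::'n set)} - {id}"
      have "\<exists>i. i \<noteq> k \<and> p i \<noteq> i"
      proof (rule ccontr)
        assume "\<nexists>i. i \<noteq> k \<and> p i \<noteq> i"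
        then have "p permutes {k}"
          using p permutes_superset[of p UNIV "{k}"] by auto
        then show False using p by (simp add: permutes_sing)
      qed
      then obtain i where "i \<noteq> k" "p i \<noteq> i" by blast
      then have "D $ i $ p i = 0" by (auto simp: D_def dest: sym)
      then show "of_int (sign p) * (\<Prod>i\<in>UNIV. D $ i $ p i) = 0"
        by (metis (no_types, lifting) UNIV_I finite prod_zero mult_zero_right)
    qed
  qed (auto simp: permutes_id)
  also have "\<dots> = b k * (\<Prod>i\<in>UNIV-{k}. d i)"
    by (simp add: D_def prod.remove[of UNIV k])
  finally show ?case by (simp add: D_def cong: if_cong)
next
  case (insert l S)
  let ?c = "\<lambda>i. \<chi> j. if i = k then b j else (if i = j then d i else 0) + (if i \<in> S then a i * b j else 0)"
  have l: "l \<notin> S" "l \<noteq> k" using insert by auto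
  have 1: "(\<chi> i j. if i = k then b j else (if i = j then d i else 0) + (if i \<in> insert l S then a i * b j else 0))
    = (\<chi> i. if i = l then (\<chi> j. if l = j then d l else 0) + a l *s (\<chi> j. b j) else ?c i)"
    using l by (simp add: vec_eq_iff)
  have 2: "(\<chi> i. if i = l then (\<chi> j. if l = j then d l else 0) else ?c i)
     = (\<chi> i j. if i = k then b j else (if i = j then d i else 0) + (if i \<in> S then a i * b j else 0))"
    using l by (simp add: vec_eq_iff)
  have 3: "det (\<chi> i. if i = l then (\<chi> j. b j) else ?c i) = 0"
    using l by (intro det_identical_rows[of l k]) (auto simp: row_def vec_eq_iff)
  show ?case
    using insert l unfolding 1 by (simp only: det_row_add det_row_mul 2 3) simp
qed

text \<open>The matrix determinant lemma in a form without division by the \<open>d i\<close>. The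
  rank-one part is added row by row; two rank-one rows never contribute together, since both are
  multiples of \<open>b\<close>.\<close>

lemma det_diag_rank_one:
  fixes a b d :: "'n::finite \<Rightarrow> 'a::comm_ring_1"
  shows "det (\<chi> i j. (if i = j then d i else 0) + a i * b j)
    = (\<Prod>i\<in>UNIV. d i) + (\<Sum>i\<in>UNIV. a i * b i * (\<Prod>j\<in>UNIV-{i}. d j))"
proof -
  have "det (\<chi> i j. (if i = j then d i else 0) + (if i \<in> S then a i * b j else 0))
    = (\<Prod>i\<in>UNIV. d i) + (\<Sum>i\<in>S. a i * b i * (\<Prod>j\<in>UNIV-{i}. d j))" if "finite S" for S
    using that
  proof (induction S)
    case empty
    have "det (\<chi> i j. if i = j then d i else 0) = (\<Prod>i\<in>UNIV. d i)"
      by (subst det_diagonal) auto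
    then show ?case by simp
  next
    case (insert l S)
    let ?c = "\<lambda>i. \<chi> j. (if i = j then d i else 0) + (if i \<in> S then a i * b j else 0)"
    have 1: "(\<chi> i j. (if i = j then d i else 0) + (if i \<in> insert l S then a i * b j else 0))
      = (\<chi> i. if i = l then (\<chi> j. if l = j then d l else 0) + a l *s (\<chi> j. b j) else ?c i)"
      using insert.hyps by (simp add: vec_eq_iff)
    have 2: "(\<chi> i. if i = l then (\<chi> j. if l = j then d l else 0) else ?c i)
       = (\<chi> i j. (if i = j then d i else 0) + (if i \<in> S then a i * b j else 0))"
      using insert.hyps by (simp add: vec_eq_iff)
    have 3: "(\<chi> i. if i = l then (\<chi> j. b j) else ?c i)
       = (\<chi> i j. if i = l then b j else (if i = j then d i else 0) + (if i \<in> S then a i * b j else 0))"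
      by (simp add: vec_eq_iff)
    have 4: "det (\<chi> i j. if i = l then b j else (if i = j then d i else 0) + (if i \<in> S then a i * b j else 0))
       = b l * (\<Prod>i\<in>UNIV-{l}. d i)"
      using insert by (intro det_diag_rank_one_aux) auto
    show ?case
      using insert.hyps insert.IH unfolding 1 by (simp only: det_row_add det_row_mul 2 3 4) (simp add: algebra_simps)
  qed
  from this[of UNIV] show ?thesis by simp
qed

section \<open>Vandermonde and interlacing determinants\<close>

text \<open>The rank of an index in its linear order, from 0 to n - 1. It supplies the exponents of
  Vandermonde matrices over an abstract index type.\<close>

definition pos :: "'n::{finite,linorder} \<Rightarrow> nat" where
  "pos k = card {i. i < k}"

lemma pos_mono: "i < j \<Longrightarrow> pos i < pos j"
  unfolding pos_def by (rule psubset_card_mono) (auto intro: less_trans)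

lemma pos_less_iff [simp]: "pos i < pos j \<longleftrightarrow> i < j"
  by (metis pos_mono linorder_neqE order_less_asym order_less_irrefl)

lemma pos_eq_iff [simp]: "pos i = pos j \<longleftrightarrow> i = j"
  by (metis pos_mono linorder_neqE order_less_irrefl)

lemma pos_le_iff [simp]: "pos i \<le> pos j \<longleftrightarrow> i \<le> j"
  by (simp flip: not_less)

lemma bij_betw_pos: "bij_betw pos (UNIV :: 'n::{finite,linorder} set) {..<CARD('n)}"
proof -
  have "pos k < CARD('n)" for k :: 'n
    unfolding pos_def by (rule psubset_card_mono) auto
  then have "pos ` (UNIV :: 'n set) \<subseteq> {..<CARD('n)}" by auto
  moreover have "inj (pos :: 'n \<Rightarrow> nat)" by (auto simp: inj_on_def)
  then have "card (pos ` (UNIV :: 'n set)) = CARD('n)" by (rule card_image)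
  ultimately show ?thesis
    by (metis \<open>inj pos\<close> bij_betw_def card_lessThan card_subset_eq finite_lessThan)
qed

text \<open>A permutation preserves the sum of all ranks, so no single rank can drop.\<close>

lemma permutes_le_imp_id:
  fixes p :: "'n::{finite,linorder} \<Rightarrow> 'n"
  assumes p: "p permutes UNIV" and le: "\<And>i. p i \<le> i"
  shows "p = id"
proof -
  have "(\<Sum>i\<in>UNIV. pos (p i)) = (\<Sum>i\<in>(UNIV :: 'n set). pos i)"
    using sum.reindex_bij_betw[OF permutes_imp_bij[OF p], of pos] .
  then have "pos (p i) = pos i" for i
    by (rule sum_mono_inv) (auto simp: le)
  then show ?thesis by auto
qed

lemma det_lower_triangular:
  fixes A :: "'a::comm_ring_1^'n::{finite,linorder}^'n::_"
  assumes ld: "\<And>i j. i < j \<Longrightarrow> A$i$j = 0"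
  shows "det A = (\<Prod>i\<in>UNIV. A$i$i)"
proof -
  have "(\<Sum>p | p permutes UNIV. of_int (sign p) * (\<Prod>i\<in>UNIV. A$i$p i)) = (\<Sum>p\<in>{id}. of_int (sign p) * (\<Prod>i\<in>UNIV. A$i$p i))"
  proof (rule sum.mono_neutral_right)
    show "\<forall>p\<in>{p. p permutes UNIV} - {id}. of_int (sign p) * (\<Prod>i\<in>UNIV. A$i$p i) = 0"
    proof
      fix p assume "p \<in> {p. p permutes (UNIV :: 'n set)} - {id}"
      then obtain i where "i < p i"
        using permutes_le_imp_id[of p] by (auto simp: not_le[symmetric])
      then show "of_int (sign p) * (\<Prod>i\<in>UNIV. A$i$p i) = 0"
        by (metis ld UNIV_I finite prod_zero mult_zero_right)
    qed
  qed (auto simp: permutes_id)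
  then show ?thesis by (simp add: det_def)
qed

lemma det_upper_triangular:
  fixes A :: "'a::comm_ring_1^'n::{finite,linorder}^'n::_"
  assumes "\<And>i j. j < i \<Longrightarrow> A$i$j = 0"
  shows "det A = (\<Prod>i\<in>UNIV. A$i$i)"
  using det_lower_triangular[of "transpose A"] assms by (simp add: transpose_def flip: det_transpose[of A])

lemma poly_eq_sum_pos:
  fixes p :: "'a::comm_semiring_1 poly"
  assumes "degree p < CARD('n::{finite,linorder})"
  shows "poly p t = (\<Sum>k\<in>(UNIV::'n set). t ^ pos k * coeff p (pos k))"
proof -
  have "poly p t = (\<Sum>d<CARD('n). t ^ d * coeff p d)"
    unfolding poly_altdef
    by (rule sum.mono_neutral_cong_left) (use assms in \<open>auto simp: coeff_eq_0 mult.commute\<close>)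
  also have "\<dots> = (\<Sum>k\<in>(UNIV::'n set). t ^ pos k * coeff p (pos k))"
    by (rule sum.reindex_bij_betw[OF bij_betw_pos, symmetric])
  finally show ?thesis .
qed

lemma prod_pairs_less:
  "(\<Prod>(j,k)\<in>{(j,k). j < k}. f j k) = (\<Prod>k\<in>(UNIV::'n::{finite,linorder} set). \<Prod>j | j < k. f j k)"
proof -
  have "(\<Prod>k\<in>(UNIV::'n set). \<Prod>j | j < k. f j k) = (\<Prod>(k,j)\<in>(SIGMA k:UNIV. {j. j < k}). f j k)"
    by (rule prod.Sigma) auto
  also have "\<dots> = (\<Prod>(j,k)\<in>{(j,k). j < k}. f j k)"
    by (rule prod.reindex_bij_witness[of _ prod.swap prod.swap]) auto
  finally show ?thesis ..
qed

lemma degree_prod_linear: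
  "degree (\<Prod>k\<in>S. [:- y k, 1:] :: 'a::idom poly) = card S"
  by (subst degree_prod_sum_eq) auto

text \<open>The Newton polynomials of the nodes have a unit upper triangular coefficient matrix and
  a lower triangular matrix of values at the nodes; the diagonal values multiply to the Vandermonde
  product.\<close>

lemma det_powers_eq_vandermonde:
  "det (\<chi> i j. x $ i ^ pos j) = vandermonde (x :: real^'n::{finite,linorder})"
proof -
  define p where "p j = (\<Prod>k | k < j. [:- x $ k, 1:])" for j :: 'n
  have deg: "degree (p j) = pos j" for j
    by (simp add: p_def pos_def degree_prod_linear)
  have lead: "coeff (p j) (pos j) = 1" for j
    using lead_coeff_prod[of "\<lambda>k. [:- x $ k, 1:]" "{k. k < j}"] by (simp add: deg[symmetric]) (simp add: p_def)
  define C :: "real^'n::_^'n::_" where "C = (\<chi> k j. coeff (p j) (pos k))"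
  have "det C = 1"
    using deg by (subst det_upper_triangular) (auto simp: C_def lead coeff_eq_0)
  have "pos j < CARD('n)" for j :: 'n
    using bij_betw_pos[where 'n='n] by (auto simp: bij_betw_def)
  then have "(\<chi> i j. poly (p j) (x $ i)) = (\<chi> i j. x $ i ^ pos j) ** C"
    by (simp add: vec_eq_iff matrix_matrix_mult_def C_def deg poly_eq_sum_pos[where 'n='n])
  then have "det (\<chi> i j. x $ i ^ pos j) = det (\<chi> i j. poly (p j) (x $ i))"
    by (simp add: det_mul \<open>det C = 1\<close>)
  also have "\<dots> = (\<Prod>j\<in>UNIV. poly (p j) (x $ j))"
    by (subst det_lower_triangular) (auto simp: p_def poly_prod prod_zero_iff)
  also have "\<dots> = vandermonde x"
    by (simp add: vandermonde_def prod_pairs_less p_def poly_prod algebra_simps)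
  finally show ?thesis .
qed

lemma vandermonde_permute:
  fixes y :: "real^'n::{finite,linorder}"
  assumes "\<sigma> permutes UNIV"
  shows "vandermonde (\<chi> i. y $ \<sigma> i) = of_int (sign \<sigma>) * vandermonde y"
  using det_permute_rows[OF assms, of "\<chi> i j. y $ i ^ pos j"]
  by (simp add: det_powers_eq_vandermonde[symmetric])

lemma vandermonde_eq_0_iff: "vandermonde (y :: real^'n::{finite,linorder}) = 0 \<longleftrightarrow> (\<exists>i j. i \<noteq> j \<and> y $ i = y $ j)"
proof -
  have "vandermonde y = 0 \<longleftrightarrow> (\<exists>i j. i < j \<and> y $ j = y $ i)"
    by (auto simp: vandermonde_def prod_zero_iff)
  then show ?thesis by (metis linorder_neqE order_less_irrefl)
qed

lemma vandermonde_pos: "(\<And>i j. i < j \<Longrightarrow> y $ i < y $ j) \<Longrightarrow> vandermonde y > 0"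
  unfolding vandermonde_def by (rule prod_pos) auto

text \<open>This is the Cauchy determinant with denominators cleared. Column \<open>j\<close> holds
  values of the polynomial with roots \<open>y $ k\<close>, \<open>k \<noteq> j\<close>, so the
  power matrix of \<open>x\<close> splits off and leaves a coefficient matrix \<open>Q\<close> that
  depends on \<open>y\<close> alone.\<close>

lemma abs_det_prod_diff:
  fixes x y :: "real^'n::{finite,linorder}"
  assumes y: "\<And>i j. i \<noteq> j \<Longrightarrow> y $ i \<noteq> y $ j"
  shows "\<bar>det (\<chi> i j. \<Prod>k\<in>UNIV-{j}. x $ i - y $ k)\<bar> = \<bar>vandermonde x\<bar> * \<bar>vandermonde y\<bar>"
proof -
  define q where "q j = (\<Prod>k\<in>UNIV-{j}. [:- y $ k, 1:])" for j
  define Q :: "real^'n::_^'n::_" where "Q = (\<chi> k j. coeff (q j) (pos k))"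
  have deg: "degree (q j) < CARD('n)" for j
    by (simp add: q_def degree_prod_linear card_Diff_singleton)
  have poly_q: "poly (q j) t = (\<Prod>k\<in>UNIV-{j}. t - y $ k)" for j t
    by (simp add: q_def poly_prod)
  have fac: "(\<chi> i j. \<Prod>k\<in>UNIV-{j}. z $ i - y $ k) = (\<chi> i j. z $ i ^ pos j) ** Q" for z :: "real^'n::_"
    using poly_q by (simp add: vec_eq_iff matrix_matrix_mult_def Q_def flip: poly_eq_sum_pos[OF deg])
  \<comment> \<open>Taking \<open>x = y\<close> makes the matrix diagonal, which determines the
    modulus of \<open>det Q\<close>.\<close>
  have "vandermonde y * det Q = det (\<chi> i j. \<Prod>k\<in>UNIV-{j}. y $ i - y $ k)"
    by (simp add: fac det_mul det_powers_eq_vandermonde)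
  also have "\<dots> = (\<Prod>j\<in>UNIV. \<Prod>k\<in>UNIV-{j}. y $ j - y $ k)"
    by (subst det_diagonal) (auto simp: prod_zero_iff)
  also have "\<bar>\<dots>\<bar> = (\<Prod>j\<in>UNIV. \<Prod>k\<in>UNIV-{j}. \<bar>y $ k - y $ j\<bar>)"
    by (simp add: abs_prod abs_minus_commute)
  also have "\<dots> = (\<Prod>j\<in>UNIV. (\<Prod>k | k < j. \<bar>y $ k - y $ j\<bar>) * (\<Prod>k | j < k. \<bar>y $ k - y $ j\<bar>))"
    by (intro prod.cong refl, subst prod.union_disjoint[symmetric]) (auto intro!: prod.cong)
  also have "\<dots> = \<bar>vandermonde y\<bar> * \<bar>vandermonde y\<bar>"
  proof -
    have 1: "(\<Prod>j\<in>UNIV. \<Prod>k | k < j. \<bar>y $ k - y $ j\<bar>) = \<bar>vandermonde y\<bar>"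
      by (simp add: vandermonde_def prod_pairs_less abs_prod abs_minus_commute)
    have "(\<Prod>j\<in>UNIV. \<Prod>k | j < k. \<bar>y $ k - y $ j\<bar>) = (\<Prod>(j,k)\<in>(SIGMA j:UNIV. {k. j < k}). \<bar>y $ k - y $ j\<bar>)"
      by (rule prod.Sigma) auto
    also have "(SIGMA j:UNIV. {k. j < k}) = {(j, k :: 'n). j < k}" by auto
    also have "(\<Prod>(j,k)\<in>\<dots>. \<bar>y $ k - y $ j\<bar>) = \<bar>vandermonde y\<bar>"
      by (simp add: vandermonde_def abs_prod split_def)
    finally show ?thesis by (simp add: prod.distrib 1)
  qed
  finally have "\<bar>vandermonde y\<bar> * \<bar>det Q\<bar> = \<bar>vandermonde y\<bar> * \<bar>vandermonde y\<bar>"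
    by (simp add: abs_mult)
  moreover have "vandermonde y \<noteq> 0" using y by (auto simp: vandermonde_eq_0_iff)
  ultimately have "\<bar>det Q\<bar> = \<bar>vandermonde y\<bar>" by (metis abs_eq_0 mult_cancel_left)
  then show ?thesis by (simp add: fac det_mul det_powers_eq_vandermonde abs_mult)
qed

text \<open>The mixture of strict and weak inequalities matches \<open>pos_pow a 0\<close>, which is
  1 for positive \<open>a\<close> and 0 otherwise, also at \<open>a = 0\<close>.\<close>

definition interlace :: "real^'n::{finite,linorder} \<Rightarrow> real^'n::_ \<Rightarrow> bool" where
  "interlace x y \<longleftrightarrow> (\<forall>k. y $ k < x $ k) \<and> (\<forall>j k. k < j \<longrightarrow> x $ k \<le> y $ j)"

text \<open>Interlacing makes the 0-1 matrix upper triangular with ones on the diagonal. If it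
  fails, either a block of zeros is too large for any permutation to avoid, or two rows
  coincide.\<close>

lemma det_step_interlace:
  fixes x y :: "real^'n::{finite,linorder}"
  assumes x: "\<And>i j. i < j \<Longrightarrow> x $ i < x $ j" and y: "\<And>i j. i < j \<Longrightarrow> y $ i < y $ j"
  shows "det (\<chi> j k. pos_pow (x $ k - y $ j) 0) = (if interlace x y then 1 else 0)"
proof (cases "interlace x y")
  case True
  have "y $ j < x $ k" if "j \<le> k" for j k
    using True x[of j k] that unfolding interlace_def by (metis less_trans order_le_less)
  then have "det (\<chi> j k. pos_pow (x $ k - y $ j) 0) = 1"
    using True by (subst det_upper_triangular) (auto simp: interlace_def pos_pow_def not_less[symmetric])
  with True show ?thesis by simp
next
  case False
  have xm: "x $ i \<le> x $ j" if "i \<le> j" for i j using x that by (cases "i = j") (auto simp: less_imp_le)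
  have ym: "y $ i \<le> y $ j" if "i \<le> j" for i j using y that by (cases "i = j") (auto simp: less_imp_le)
  from False consider k where "x $ k \<le> y $ k" | j k where "k < j" "y $ j < x $ k"
    by (auto simp: interlace_def not_less not_le)
  then have "det (\<chi> j k. pos_pow (x $ k - y $ j) 0) = 0"
  proof cases
    case (1 k)
    \<comment> \<open>Rows from \<open>k\<close> on and columns up to \<open>k\<close> meet in
      zeros. Their numbers add up to n + 1, so every permutation hits this block.\<close>
    have zero: "pos_pow (x $ i - y $ j) 0 = 0" if "i \<le> k" "k \<le> j" for i j
      using 1 xm[OF that(1)] ym[OF that(2)] by (simp add: pos_pow_def)
    have *: "(\<Prod>j\<in>UNIV. pos_pow (x $ p j - y $ j) 0) = 0" if p: "p permutes UNIV" for p
    proof -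
      have "\<exists>j\<ge>k. p j \<le> k"
      proof (rule ccontr)
        assume "\<not> ?thesis"
        then have "p ` {k..} \<subseteq> {k<..}" by auto
        then have "card (p ` {k..}) \<le> card {k<..}" by (intro card_mono) auto
        also have "\<dots> < card {k..}" by (rule psubset_card_mono) auto
        finally show False
          using p by (simp add: card_image permutes_inj_on)
      qed
      then show ?thesis using zero by (auto simp: prod_zero_iff)
    qed
    show ?thesis
      unfolding det_def by (intro sum.neutral ballI) (use * in simp)
  next
    case (2 j k)
    \<comment> \<open>A row with index at most \<open>j\<close> is a step function of the column,
      determined by \<open>c i\<close>, the first column holding a one. All these thresholds are at
      most \<open>k < j\<close>, hence two of the rows share one.\<close>
    define c where "c i = Min {l. y $ i < x $ l}" for i
    have k: "k \<in> {l. y $ i < x $ l}" if "i \<le> j" for i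
      using 2 ym[OF that] by simp
    have c: "y $ i < x $ l \<longleftrightarrow> c i \<le> l" if "i \<le> j" for i l
    proof
      assume "y $ i < x $ l" then show "c i \<le> l" unfolding c_def by (intro Min_le) auto
    next
      assume "c i \<le> l"
      moreover have "c i \<in> {l. y $ i < x $ l}" unfolding c_def using k[OF that] by (intro Min_in) auto
      ultimately show "y $ i < x $ l" using xm[of "c i" l] by simp
    qed
    have "c ` {..j} \<subseteq> {..k}" using c k by auto
    then have "card (c ` {..j}) \<le> card {..k}" by (intro card_mono) auto
    also have "\<dots> < card {..j}" using 2 by (intro psubset_card_mono) auto
    finally have "\<not> inj_on c {..j}" by (metis card_image less_irrefl)
    then obtain a b where ab: "a \<le> j" "b \<le> j" "a \<noteq> b" "c a = c b" by (auto simp: inj_on_def)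
    have "pos_pow (x $ l - y $ a) 0 = pos_pow (x $ l - y $ b) 0" for l
      using c[OF ab(1), of l] c[OF ab(2), of l] ab(4) by (simp add: pos_pow_def)
    then show ?thesis
      using ab(3) by (intro det_identical_rows[of a b]) (auto simp: row_def vec_eq_iff)
  qed
  with False show ?thesis by simp
qed

section \<open>Vectors up to permutation as polynomials\<close>

text \<open>Vectors up to permutation correspond to these polynomials. The coefficient function
  serves as the value of an unordered spectrum, because functions from \<open>nat\<close> to
  \<open>complex\<close> carry a Borel structure; it is complex to be comparable with
  \<open>charpoly\<close>.\<close>

definition rpoly :: "real^'n \<Rightarrow> complex poly" where
  "rpoly y = (\<Prod>i\<in>UNIV. [:- complex_of_real (y $ i), 1:])"

definition sorted_vecs :: "(real^'n::{finite,linorder}) set" where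
  "sorted_vecs = {y. \<forall>i j. i \<le> j \<longrightarrow> y $ i \<le> y $ j}"

definition symmetric :: "(real^'n \<Rightarrow> 'b) \<Rightarrow> bool" where
  "symmetric F \<longleftrightarrow> (\<forall>\<sigma> y. \<sigma> permutes UNIV \<longrightarrow> F (\<chi> i. y $ \<sigma> i) = F y)"

lemma real_eigvals_iff_rpoly: "real_eigvals A y \<longleftrightarrow> charpoly A = rpoly y"
  by (simp add: real_eigvals_def rpoly_def)

lemma proots_rpoly: "proots (rpoly y) = image_mset (\<lambda>i. complex_of_real (y $ i)) (mset_set UNIV)"
proof -
  have "proots (rpoly y) = (\<Sum>i\<in>UNIV. {#complex_of_real (y $ i)#})"
    unfolding rpoly_def by (subst proots_prod) auto
  also have "\<dots> = image_mset (\<lambda>i. complex_of_real (y $ i)) (mset_set UNIV)"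
    by (metis multiset.map_comp sum_unfold_sum_mset comp_def image_mset_cong sum_mset_singleton_mset)
  finally show ?thesis .
qed

lemma rpoly_permute: "\<sigma> permutes UNIV \<Longrightarrow> rpoly (\<chi> i. y $ \<sigma> i) = rpoly y"
  using prod.reindex_bij_betw[OF permutes_imp_bij, of \<sigma> UNIV "\<lambda>i. [:- complex_of_real (y $ i), 1:]"]
  by (simp add: rpoly_def)

lemma rpoly_eqE:
  assumes "rpoly y = rpoly z"
  obtains \<sigma> where "\<sigma> permutes UNIV" "y = (\<chi> i. z $ \<sigma> i)"
proof -
  have "image_mset (\<lambda>i. complex_of_real (y $ i)) (mset_set UNIV) = image_mset (\<lambda>i. complex_of_real (z $ i)) (mset_set UNIV)"
    using assms by (simp flip: proots_rpoly)
  then obtain p where "p permutes UNIV" "\<forall>i\<in>UNIV. complex_of_real (y $ i) = complex_of_real (z $ p i)"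
    by (rule image_mset_eq_implies_permutes[rotated]) auto
  then show ?thesis by (intro that[of p]) (auto simp: vec_eq_iff)
qed

lemma poly_rpoly: "poly (rpoly y) t = (\<Prod>i\<in>UNIV. t - complex_of_real (y $ i))"
  by (simp add: rpoly_def poly_prod)

lemma degree_rpoly: "degree (rpoly (y :: real^'n)) = CARD('n)"
  unfolding rpoly_def by (rule degree_prod_linear)

lemma lead_coeff_rpoly: "lead_coeff (rpoly y) = 1"
  by (simp add: rpoly_def lead_coeff_prod)

text \<open>A permutation that maximises the rank-weighted sum sorts the vector: swapping an
  out-of-order pair would increase the sum.\<close>

lemma exists_sorting_permutation:
  fixes y :: "real^'n::{finite,linorder}"
  obtains \<sigma> where "\<sigma> permutes UNIV" "(\<chi> i. y $ \<sigma> i) \<in> sorted_vecs"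
proof -
  define f where "f \<sigma> = (\<Sum>i\<in>UNIV. real (pos i) * y $ \<sigma> i)" for \<sigma> :: "'n \<Rightarrow> 'n"
  let ?P = "{\<sigma>. \<sigma> permutes (UNIV :: 'n set)}"
  have fin: "finite (f ` ?P)" by (simp add: finite_permutations)
  have "?P \<noteq> {}" using permutes_id by blast
  then have "Max (f ` ?P) \<in> f ` ?P" using fin by (intro Max_in) auto
  then obtain \<sigma> where \<sigma>: "\<sigma> permutes UNIV" and "f \<sigma> = Max (f ` ?P)" by auto
  then have max: "f \<tau> \<le> f \<sigma>" if "\<tau> permutes UNIV" for \<tau>
    using fin that by simp
  have "y $ \<sigma> i \<le> y $ \<sigma> j" if ij: "i < j" for i j
  proof (rule ccontr)
    assume less: "\<not> ?thesis"
    define \<tau> where "\<tau> = \<sigma> \<circ> Transposition.transpose i j"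
    have "\<tau> permutes UNIV"
      unfolding \<tau>_def using \<sigma> by (intro permutes_compose permutes_swap_id) auto
    moreover have "f \<tau> - f \<sigma> = (real (pos j) - real (pos i)) * (y $ \<sigma> i - y $ \<sigma> j)"
    proof -
      have "f \<tau> - f \<sigma> = (\<Sum>k\<in>UNIV. real (pos k) * (y $ \<tau> k - y $ \<sigma> k))"
        by (simp add: f_def sum_subtractf right_diff_distrib)
      also have "\<dots> = (\<Sum>k\<in>{i,j}. real (pos k) * (y $ \<tau> k - y $ \<sigma> k))"
        by (rule sum.mono_neutral_right) (auto simp: \<tau>_def transpose_def)
      also have "\<dots> = (real (pos j) - real (pos i)) * (y $ \<sigma> i - y $ \<sigma> j)"
        using ij by (simp add: \<tau>_def algebra_simps)
      finally show ?thesis .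
    qed
    moreover have "(real (pos j) - real (pos i)) * (y $ \<sigma> i - y $ \<sigma> j) > 0"
      using ij less by (intro mult_pos_pos) auto
    ultimately show False using max[of \<tau>] by simp
  qed
  then have "(\<chi> i. y $ \<sigma> i) \<in> sorted_vecs"
    by (auto simp: sorted_vecs_def order_le_less)
  with \<sigma> show ?thesis ..
qed

lemma inj_on_rpoly_sorted: "inj_on rpoly (sorted_vecs :: (real^'n::{finite,linorder}) set)"
proof (rule inj_onI)
  fix y z :: "real^'n::_" assume y: "y \<in> sorted_vecs" and z: "z \<in> sorted_vecs" and eq: "rpoly y = rpoly z"
  have aux: "y $ k \<le> z $ k" if y: "y \<in> sorted_vecs" and z: "z \<in> sorted_vecs" and eq: "rpoly y = rpoly z" for y z :: "real^'n::_" and k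
  proof -
    obtain \<sigma> where \<sigma>: "\<sigma> permutes UNIV" "y = (\<chi> i. z $ \<sigma> i)"
      using eq by (rule rpoly_eqE)
    \<comment> \<open>An injective map cannot send all indices from \<open>k\<close> on strictly
      above \<open>k\<close>.\<close>
    have "\<exists>j\<ge>k. \<sigma> j \<le> k"
    proof (rule ccontr)
      assume "\<not> ?thesis"
      then have "\<sigma> ` {k..} \<subseteq> {k<..}" by auto
      then have "card (\<sigma> ` {k..}) \<le> card {k<..}" by (intro card_mono) auto
      also have "\<dots> < card {k..}" by (rule psubset_card_mono) auto
      finally show False using \<sigma> by (simp add: card_image permutes_inj_on)
    qed
    then obtain j where j: "k \<le> j" "\<sigma> j \<le> k" by blast
    have "y $ k \<le> y $ j" using y j by (simp add: sorted_vecs_def)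
    also have "\<dots> = z $ \<sigma> j" by (simp add: \<sigma>)
    also have "\<dots> \<le> z $ k" using z j by (simp add: sorted_vecs_def)
    finally show ?thesis .
  qed
  show "y = z"
    using aux[OF y z eq] aux[OF z y eq[symmetric]] by (auto simp: vec_eq_iff intro: antisym)
qed

lemma continuous_on_coeff_prod:
  fixes f :: "'i \<Rightarrow> 'x::topological_space \<Rightarrow> complex poly"
  assumes "finite S" "\<And>i k. i \<in> S \<Longrightarrow> continuous_on A (\<lambda>x. coeff (f i x) k)"
  shows "continuous_on A (\<lambda>x. coeff (\<Prod>i\<in>S. f i x) k)"
  using assms
proof (induction S arbitrary: k)
  case (insert i S)
  then show ?case by (simp add: coeff_mult) (intro continuous_intros, auto)
qed (cases k; simp)

lemma continuous_on_coeff_rpoly: "continuous_on A (\<lambda>y :: real^'n. coeff (rpoly y))"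
proof (rule continuous_on_coordinatewise_then_product)
  fix k
  have "continuous_on A (\<lambda>y :: real^'n. coeff [:- complex_of_real (y $ i), 1:] l)" for i l
    by (cases l; cases "l - 1") (auto intro!: continuous_intros)
  then show "continuous_on A (\<lambda>y :: real^'n. coeff (rpoly y) k)"
    unfolding rpoly_def by (intro continuous_on_coeff_prod) auto
qed

lemma continuous_on_coeff_charpoly: "continuous_on A (\<lambda>M :: complex^'n^'n. coeff (charpoly M))"
proof (rule continuous_on_coordinatewise_then_product)
  fix k
  have "continuous_on A (\<lambda>M :: complex^'n^'n. coeff ((if i = j then [:0, 1:] else 0) - [:M $ i $ j:]) l)" for i j l
    by (cases l; cases "l - 1") (auto intro!: continuous_intros)
  then show "continuous_on A (\<lambda>M :: complex^'n^'n. coeff (charpoly M) k)"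
    unfolding charpoly_def det_def coeff_sum
    by (intro continuous_on_sum) 
       (simp add: of_int_poly continuous_on_mult_left continuous_on_coeff_prod)
qed

lemma closed_sorted_vecs: "closed (sorted_vecs :: (real^'n::{finite,linorder}) set)"
proof -
  have "sorted_vecs = (\<Inter>i. \<Inter>j\<in>{i..}. {y :: real^'n::_. y $ i \<le> y $ j})"
    by (auto simp: sorted_vecs_def)
  also have "closed \<dots>"
    by (intro closed_INT ballI closed_Collect_le continuous_intros)
  finally show ?thesis .
qed

text \<open>On sorted vectors the coefficient map is continuous and injective. Closed sets are
  countable unions of compact ones, so their images are Borel; injectivity carries this through
  complements to all Borel sets.\<close>

lemma image_coeff_rpoly_borel:
  fixes A :: "(real^'n::{finite,linorder}) set"
  assumes "A \<in> sets borel"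
  shows "(\<lambda>y. coeff (rpoly y)) ` (A \<inter> sorted_vecs) \<in> sets borel"
proof -
  let ?e = "\<lambda>y :: real^'n::_. coeff (rpoly y)"
  have inj: "inj_on ?e sorted_vecs"
    using inj_on_rpoly_sorted by (auto simp: inj_on_def coeff_inject)
  have closed: "?e ` (a \<inter> sorted_vecs) \<in> sets borel" if "closed a" for a
  proof -
    have "a \<inter> sorted_vecs = (\<Union>n::nat. a \<inter> sorted_vecs \<inter> cball 0 (real n))"
      by (auto simp: real_arch_simple)
    then have "?e ` (a \<inter> sorted_vecs) = (\<Union>n::nat. ?e ` (a \<inter> sorted_vecs \<inter> cball 0 (real n)))"
      by (metis image_UN)
    moreover have "?e ` (a \<inter> sorted_vecs \<inter> cball 0 (real n)) \<in> sets borel" for n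
      by (intro borel_closed compact_imp_closed compact_continuous_image continuous_on_coeff_rpoly
           closed_Int_compact[OF closed_Int[OF that closed_sorted_vecs]]) auto
    ultimately show ?thesis
      by (simp only:) (rule sets.countable_UN, auto)
  qed
  have "A \<in> sigma_sets UNIV {a. closed a}"
    using assms by (simp add: borel_eq_closed)
  then show ?thesis
  proof induction
    case (Basic a) then show ?case using closed by auto
  next
    case (Compl a)
    have "?e ` ((UNIV - a) \<inter> sorted_vecs) = ?e ` (UNIV \<inter> sorted_vecs) - ?e ` (a \<inter> sorted_vecs)"
      using inj by (auto simp: inj_on_def)
    then show ?case using Compl closed[of UNIV] by auto
  next
    case (Union a)
    have "?e ` (\<Union> (range a) \<inter> sorted_vecs) = (\<Union>i. ?e ` (a i \<inter> sorted_vecs))" by auto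
    then show ?case using Union by auto
  qed auto
qed

text \<open>A symmetric function of the eigenvalues becomes a Borel function of the characteristic
  polynomial, so it can be evaluated at a random matrix without choosing an ordering. The inverse of
  the coefficient map on sorted vectors is measurable because Borel sets have Borel images; off the
  image, \<open>\<Phi>\<close> is set to 0.\<close>

lemma symmetric_factor:
  fixes F :: "real^'n::{finite,linorder} \<Rightarrow> ennreal"
  assumes F: "F \<in> borel_measurable borel" and sym: "symmetric F"
  obtains \<Phi> where "\<Phi> \<in> borel_measurable borel" "\<And>y. \<Phi> (coeff (rpoly y)) = F y"
proof
  let ?e = "\<lambda>y :: real^'n::_. coeff (rpoly y)"
  define \<Phi> where "\<Phi> v = (if v \<in> ?e ` sorted_vecs then F (inv_into sorted_vecs ?e v) else 0)" for v
  have inj: "inj_on ?e sorted_vecs"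
    using inj_on_rpoly_sorted by (auto simp: inj_on_def coeff_inject)
  have *: "\<Phi> (?e y) = F y" if "y \<in> sorted_vecs" for y
    using that by (simp add: \<Phi>_def inv_into_f_f[OF inj that])
  show "\<Phi> (?e y) = F y" for y
  proof -
    obtain \<sigma> where \<sigma>: "\<sigma> permutes UNIV" "(\<chi> i. y $ \<sigma> i) \<in> sorted_vecs"
      by (rule exists_sorting_permutation)
    then show ?thesis using *[OF \<sigma>(2)] sym by (simp add: rpoly_permute symmetric_def)
  qed
  show "\<Phi> \<in> borel_measurable borel"
  proof (rule measurableI)
    fix B :: "ennreal set" assume B: "B \<in> sets borel"
    have "F -` B \<in> sets borel" using F B measurable_sets_borel[of F borel B] by simp
    then have 1: "?e ` (F -` B \<inter> sorted_vecs) \<in> sets borel" by (rule image_coeff_rpoly_borel)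
    have 2: "?e ` sorted_vecs \<in> sets borel" using image_coeff_rpoly_borel[of UNIV] by simp
    have "\<Phi> -` B = ?e ` (F -` B \<inter> sorted_vecs) \<union> (if 0 \<in> B then UNIV - ?e ` sorted_vecs else {})"
    proof (intro set_eqI)
      fix v
      show "v \<in> \<Phi> -` B \<longleftrightarrow> v \<in> ?e ` (F -` B \<inter> sorted_vecs) \<union> (if 0 \<in> B then UNIV - ?e ` sorted_vecs else {})"
      proof (cases "v \<in> ?e ` sorted_vecs")
        case True
        then obtain y where y: "y \<in> sorted_vecs" "v = ?e y" by auto
        have "v \<in> ?e ` (F -` B \<inter> sorted_vecs) \<longleftrightarrow> y \<in> F -` B \<inter> sorted_vecs"
          unfolding y(2) using inj y(1) by (intro inj_on_image_mem_iff) auto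
        then show ?thesis using y * True by simp
      next
        case False
        then have "\<Phi> v = 0" "v \<notin> ?e ` (F -` B \<inter> sorted_vecs)" unfolding \<Phi>_def by auto
        with False show ?thesis by simp
      qed
    qed
    then show "\<Phi> -` B \<inter> space borel \<in> sets borel" using 1 2 by auto
  qed simp
qed

section \<open>The change of variables from weights to roots\<close>

text \<open>The characteristic polynomial of diag(x) minus a rank-one matrix
  \<open>v v\<^sup>*\<close> whose vector has squared moduli \<open>p $ i * x $ i\<close>, expanded
  by the matrix determinant lemma.\<close>

definition pert_poly :: "real^'n \<Rightarrow> real^'n \<Rightarrow> complex poly" where
  "pert_poly x p = rpoly x + (\<Sum>i\<in>UNIV. smult (complex_of_real (p $ i * x $ i)) (\<Prod>j\<in>UNIV-{i}. [:- complex_of_real (x $ j), 1:]))"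

text \<open>Lagrange interpolation: at the node \<open>x $ i\<close> the perturbed polynomial
  involves only \<open>p $ i\<close>, which is therefore read off from the prescribed roots
  \<open>y\<close>.\<close>

definition root_weights :: "real^'n \<Rightarrow> real^'n \<Rightarrow> real^'n" where
  "root_weights x y = (\<chi> i. (\<Prod>j\<in>UNIV. x $ i - y $ j) / (x $ i * (\<Prod>j\<in>UNIV-{i}. x $ i - x $ j)))"

text \<open>Strict interlacing, with 0 as the lower bound below the smallest node. Strictness gives
  an exact bijection with the open simplex.\<close>

definition inter_box :: "real^'n::{finite,linorder} \<Rightarrow> (real^'n::_) set" where
  "inter_box x = {y. (\<forall>k. 0 < y $ k \<and> y $ k < x $ k) \<and> (\<forall>j k. j < k \<longrightarrow> x $ j < y $ k)}"

definition open_simplex :: "(real^'n) set" where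
  "open_simplex = {p. (\<forall>i. 0 < p $ i) \<and> (\<Sum>i\<in>UNIV. p $ i) < 1}"

lemma poly_pert_poly:
  "poly (pert_poly x p) t = (\<Prod>i\<in>UNIV. t - complex_of_real (x $ i))
    + (\<Sum>i\<in>UNIV. complex_of_real (p $ i * x $ i) * (\<Prod>j\<in>UNIV-{i}. t - complex_of_real (x $ j)))"
  by (simp add: pert_poly_def poly_rpoly poly_sum poly_prod)

lemma poly_pert_poly_node:
  "poly (pert_poly x p) (complex_of_real (x $ i)) = complex_of_real (p $ i * x $ i * (\<Prod>j\<in>UNIV-{i}. x $ i - x $ j))"
proof -
  have "(\<Sum>l\<in>UNIV. complex_of_real (p $ l * x $ l) * (\<Prod>j\<in>UNIV-{l}. complex_of_real (x $ i) - complex_of_real (x $ j)))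
    = (\<Sum>l\<in>{i}. complex_of_real (p $ l * x $ l) * (\<Prod>j\<in>UNIV-{l}. complex_of_real (x $ i) - complex_of_real (x $ j)))"
    by (rule sum.mono_neutral_right) (auto simp: prod_zero_iff)
  moreover have "(\<Prod>j\<in>UNIV. complex_of_real (x $ i) - complex_of_real (x $ j)) = 0"
    by (auto simp: prod_zero_iff)
  ultimately show ?thesis by (simp add: poly_pert_poly)
qed

lemma degree_pert_sum:
  "degree (\<Sum>i\<in>(UNIV :: 'n::finite set). smult (a i) (\<Prod>j\<in>UNIV-{i}. [:- complex_of_real (x $ j), 1:])) < CARD('n)"
proof -
  have "degree (smult (a i) (\<Prod>j\<in>UNIV-{i}. [:- complex_of_real (x $ j), 1:])) \<le> CARD('n) - 1" for i
    using degree_smult_le[of "a i" "\<Prod>j\<in>UNIV-{i}. [:- complex_of_real (x $ j), 1:]"]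
    by (simp add: degree_prod_linear card_Diff_singleton)
  then have "degree (\<Sum>i\<in>UNIV. smult (a i) (\<Prod>j\<in>UNIV-{i}. [:- complex_of_real (x $ j), 1:])) \<le> CARD('n) - 1"
    by (intro degree_sum_le) auto
  then show ?thesis by (simp add: order_le_less_trans)
qed

lemma degree_pert_poly:
  "degree (pert_poly x (p :: real^'n)) \<le> CARD('n)" "coeff (pert_poly x (p :: real^'n)) CARD('n) = 1"
proof -
  let ?s = "\<Sum>i\<in>UNIV. smult (complex_of_real (p $ i * x $ i)) (\<Prod>j\<in>UNIV-{i}. [:- complex_of_real (x $ j), 1:])"
  have s: "degree ?s < CARD('n)" by (rule degree_pert_sum)
  then show "degree (pert_poly x p) \<le> CARD('n)"
    unfolding pert_poly_def by (intro degree_add_le) (auto simp: degree_rpoly)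
  show "coeff (pert_poly x p) CARD('n) = 1"
    using lead_coeff_rpoly[of x] s by (simp add: pert_poly_def degree_rpoly coeff_eq_0)
qed

text \<open>Both polynomials are monic of degree n, so n points decide. The points \<open>z\<close>
  are left free, since both the old nodes and the new roots serve.\<close>

lemma pert_poly_eq_rpolyI:
  fixes x y z p :: "real^'n"
  assumes z: "\<And>i j. i \<noteq> j \<Longrightarrow> z $ i \<noteq> z $ j"
    and eq: "\<And>i. poly (pert_poly x p) (complex_of_real (z $ i)) = poly (rpoly y) (complex_of_real (z $ i))"
  shows "pert_poly x p = rpoly y"
proof (rule poly_eqI_degree_lead_coeff)
  have "inj (\<lambda>i. complex_of_real (z $ i))" using z by (auto simp: inj_on_def)
  then show "CARD('n) \<le> card (range (\<lambda>i. complex_of_real (z $ i)))" by (simp add: card_image)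
  show "coeff (pert_poly x p) CARD('n) = coeff (rpoly y) CARD('n)"
    using degree_pert_poly(2)[of x p] lead_coeff_rpoly[of y] by (simp add: degree_rpoly)
qed (use eq degree_pert_poly(1)[of x p] degree_rpoly[of y] in auto)

lemma pert_poly_eq_rpoly_iff:
  assumes x: "\<And>i j. i \<noteq> j \<Longrightarrow> x $ i \<noteq> x $ j" "\<And>i. x $ i \<noteq> 0"
  shows "pert_poly x p = rpoly y \<longleftrightarrow> p = root_weights x y"
proof -
  have "(\<Prod>j\<in>UNIV-{i}. x $ i - x $ j) \<noteq> 0" for i
    using x(1) by (auto simp: prod_zero_iff)
  then have eq: "poly (pert_poly x p) (complex_of_real (x $ i)) = poly (rpoly y) (complex_of_real (x $ i)) \<longleftrightarrow> p $ i = root_weights x y $ i" for i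
    using x(2)[of i] by (simp add: poly_pert_poly_node poly_rpoly root_weights_def field_simps flip: of_real_diff of_real_prod of_real_mult)
  show ?thesis
  proof
    assume "pert_poly x p = rpoly y"
    then show "p = root_weights x y" using eq by (auto simp: vec_eq_iff)
  next
    assume "p = root_weights x y"
    then show "pert_poly x p = rpoly y" using eq x(1) by (intro pert_poly_eq_rpolyI[of x]) auto
  qed
qed

lemma mult_prod_minus:
  fixes x :: "real^'n"
  shows "a * x $ i * (\<Prod>j\<in>UNIV-{i}. - x $ j) = - a * (\<Prod>j\<in>UNIV. - x $ j)"
  by (simp add: prod.remove[of UNIV i "\<lambda>j. - x $ j"])

text \<open>Evaluation of the polynomial at 0. Powers of this complementary Dirichlet weight produce
  the powers of \<open>y $ j\<close> and part of those of \<open>1 / x $ j\<close> in the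
  kernel.\<close>

lemma one_minus_sum_root_weights:
  assumes x: "\<And>i j. i \<noteq> j \<Longrightarrow> x $ i \<noteq> x $ j" "\<And>i. x $ i \<noteq> 0"
  shows "1 - (\<Sum>i\<in>UNIV. root_weights x y $ i) = (\<Prod>i\<in>UNIV. y $ i) / (\<Prod>i\<in>UNIV. x $ i)"
proof -
  define p where "p = root_weights x y"
  have nz: "(\<Prod>i\<in>UNIV. x $ i) \<noteq> 0" using x(2) by (auto simp: prod_zero_iff)
  have "poly (rpoly y) 0 = poly (pert_poly x p) 0"
    using pert_poly_eq_rpoly_iff[OF x, of p y] by (simp add: p_def)
  also have "\<dots> = complex_of_real ((\<Prod>i\<in>UNIV. - x $ i) + (\<Sum>i\<in>UNIV. p $ i * x $ i * (\<Prod>j\<in>UNIV-{i}. - x $ j)))"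
    by (simp add: poly_pert_poly)
  also have "(\<Sum>i\<in>UNIV. p $ i * x $ i * (\<Prod>j\<in>UNIV-{i}. - x $ j)) = (\<Sum>i\<in>UNIV. - p $ i * (\<Prod>j\<in>UNIV. - x $ j))"
    by (simp add: mult_prod_minus)
  also have "poly (rpoly y) 0 = complex_of_real (\<Prod>i\<in>UNIV. - y $ i)"
    by (simp add: poly_rpoly)
  finally have "(\<Prod>i\<in>UNIV. - y $ i) = (\<Prod>i\<in>UNIV. - x $ i) - (\<Sum>i\<in>UNIV. p $ i) * (\<Prod>i\<in>UNIV. - x $ i)"
    by (simp only: of_real_eq_iff) (simp add: sum_distrib_right sum_negf)
  then have "(-1) ^ CARD('a) * (\<Prod>i\<in>UNIV. y $ i) = (-1) ^ CARD('a) * ((\<Prod>i\<in>UNIV. x $ i) * (1 - (\<Sum>i\<in>UNIV. p $ i)))"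
    by (simp add: prod_uminus algebra_simps)
  then have "(\<Prod>i\<in>UNIV. y $ i) = (\<Prod>i\<in>UNIV. x $ i) * (1 - (\<Sum>i\<in>UNIV. p $ i))"
    by simp
  then show ?thesis using nz by (simp add: p_def)
qed

lemma sgn_prod_diff_nodes:
  fixes x :: "real^'n::{finite,linorder}"
  assumes "\<And>j. j < k \<Longrightarrow> x $ j < t" "\<And>j. k < j \<Longrightarrow> t < x $ j"
  shows "0 < (-1) ^ card {j. k < j} * (\<Prod>j\<in>UNIV-{k}. t - x $ j)"
proof -
  have eq: "UNIV - {k} = {j. j < k} \<union> {j. k < j}" by auto
  have "(\<Prod>j\<in>UNIV-{k}. t - x $ j) = (\<Prod>j | j < k. t - x $ j) * (\<Prod>j | k < j. t - x $ j)"
    unfolding eq by (rule prod.union_disjoint) auto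
  also have "(\<Prod>j | k < j. t - x $ j) = (\<Prod>j | k < j. (-1) * (x $ j - t))" by simp
  also have "\<dots> = (-1) ^ card {j. k < j} * (\<Prod>j | k < j. x $ j - t)"
    by (simp only: prod.distrib prod_constant)
  finally have "(-1) ^ card {j. k < j} * (\<Prod>j\<in>UNIV-{k}. t - x $ j) 
     = ((-1) ^ card {j. k < j} * (-1) ^ card {j. k < j}) * ((\<Prod>j | j < k. t - x $ j) * (\<Prod>j | k < j. x $ j - t))"
    by (simp only: mult_ac)
  also have "\<dots> = (\<Prod>j | j < k. t - x $ j) * (\<Prod>j | k < j. x $ j - t)"
    by (simp flip: power_mult_distrib)
  also have "\<dots> > 0" using assms by (intro mult_pos_pos prod_pos) auto
  finally show ?thesis .
qed

text \<open>At \<open>x $ i\<close> the factors from indices above \<open>i\<close> are negative in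
  numerator and denominator alike, in equal number, so the signs cancel; the factor left over is
  \<open>(x $ i - y $ i) / x $ i\<close>.\<close>

lemma root_weights_pos:
  fixes x :: "real^'n::{finite,linorder}"
  assumes x: "\<And>i j. i < j \<Longrightarrow> x $ i < x $ j" "\<And>i. 0 < x $ i" and y: "y \<in> inter_box x"
  shows "0 < root_weights x y $ i"
proof -
  have 1: "0 < (-1) ^ card {j. i < j} * (\<Prod>j\<in>UNIV-{i}. x $ i - x $ j)"
    using x by (intro sgn_prod_diff_nodes) auto
  have "y $ j < x $ i" if "j < i" for j
    using y x(1)[OF that] by (auto simp: inter_box_def intro: less_trans)
  then have 2: "0 < (-1) ^ card {j. i < j} * (\<Prod>j\<in>UNIV-{i}. x $ i - y $ j)"
    using y by (intro sgn_prod_diff_nodes) (auto simp: inter_box_def)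
  have "0 < (-1) ^ card {j. i < j} * (\<Prod>j\<in>UNIV-{i}. x $ i - y $ j) / ((-1) ^ card {j. i < j} * (\<Prod>j\<in>UNIV-{i}. x $ i - x $ j))"
    by (rule divide_pos_pos[OF 2 1])
  also have "\<dots> = (\<Prod>j\<in>UNIV-{i}. x $ i - y $ j) / (\<Prod>j\<in>UNIV-{i}. x $ i - x $ j)"
    by simp
  finally have "0 < (\<Prod>j\<in>UNIV-{i}. x $ i - y $ j) / (\<Prod>j\<in>UNIV-{i}. x $ i - x $ j)" .
  moreover have "0 < (x $ i - y $ i) / x $ i"
    using x(2) y by (auto simp: inter_box_def)
  ultimately have "0 < (x $ i - y $ i) / x $ i * ((\<Prod>j\<in>UNIV-{i}. x $ i - y $ j) / (\<Prod>j\<in>UNIV-{i}. x $ i - x $ j))"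
    by (rule mult_pos_pos[rotated])
  also have "\<dots> = root_weights x y $ i"
    by (simp add: root_weights_def prod.remove[of UNIV i])
  finally show ?thesis .
qed

text \<open>Surjectivity is the intermediate value theorem: for weights in the simplex the perturbed
  polynomial alternates in sign along 0 and the increasing nodes, so each gap contains a root, and n
  roots exhaust it.\<close>

lemma root_weights_image:
  fixes x :: "real^'n::{finite,linorder}"
  assumes x: "\<And>i j. i < j \<Longrightarrow> x $ i < x $ j" "\<And>i. 0 < x $ i"
  shows "root_weights x ` inter_box x = open_simplex"
proof (intro equalityI subsetI)
  have x': "\<And>i j. i \<noteq> j \<Longrightarrow> x $ i \<noteq> x $ j" "\<And>i. x $ i \<noteq> 0"
    using x by (metis linorder_neqE order_less_irrefl)+
  fix p assume "p \<in> root_weights x ` inter_box x"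
  then obtain y where y: "y \<in> inter_box x" "p = root_weights x y" by auto
  have "0 < (\<Prod>i\<in>UNIV. y $ i) / (\<Prod>i\<in>UNIV. x $ i)"
    using y x by (intro divide_pos_pos prod_pos) (auto simp: inter_box_def)
  then show "p \<in> open_simplex"
    using root_weights_pos[OF x y(1)] one_minus_sum_root_weights[OF x', of y] y(2) by (simp add: open_simplex_def)
next
  have x': "\<And>i j. i \<noteq> j \<Longrightarrow> x $ i \<noteq> x $ j" "\<And>i. x $ i \<noteq> 0"
    using x by (metis linorder_neqE order_less_irrefl)+
  fix p :: "real^'n::_" assume p: "p \<in> open_simplex"
  define P where "P t = (\<Prod>i\<in>UNIV. t - x $ i) + (\<Sum>i\<in>UNIV. p $ i * x $ i * (\<Prod>j\<in>UNIV-{i}. t - x $ j))" for t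
  have P: "poly (pert_poly x p) (complex_of_real t) = complex_of_real (P t)" for t
    by (simp add: poly_pert_poly P_def)
  have cont: "continuous_on A P" for A
    unfolding P_def by (intro continuous_intros)
  have node: "0 < (-1) ^ card {j. k < j} * P (x $ k)" for k
  proof -
    have "P (x $ k) = p $ k * x $ k * (\<Prod>j\<in>UNIV-{k}. x $ k - x $ j)"
      using P[of "x $ k"] unfolding poly_pert_poly_node by (simp only: of_real_eq_iff)
    moreover have "0 < (p $ k * x $ k) * ((-1) ^ card {j. k < j} * (\<Prod>j\<in>UNIV-{k}. x $ k - x $ j))"
      using p x by (intro mult_pos_pos sgn_prod_diff_nodes) (auto simp: open_simplex_def)
    ultimately show ?thesis by (simp add: mult_ac)
  qed
  have zero: "0 < (-1) ^ CARD('n) * P 0"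
  proof -
    have "(\<Sum>i\<in>UNIV. p $ i * x $ i * (\<Prod>j\<in>UNIV-{i}. - x $ j)) = (\<Sum>i\<in>UNIV. - p $ i * (\<Prod>j\<in>UNIV. - x $ j))"
      by (simp add: mult_prod_minus)
    then have "P 0 = (-1) ^ CARD('n) * ((\<Prod>i\<in>UNIV. x $ i) * (1 - (\<Sum>i\<in>UNIV. p $ i)))"
      by (simp add: P_def sum_negf prod_uminus algebra_simps flip: sum_distrib_right)
    moreover have "0 < (\<Prod>i\<in>UNIV. x $ i) * (1 - (\<Sum>i\<in>UNIV. p $ i))"
      using p x by (intro mult_pos_pos prod_pos) (auto simp: open_simplex_def)
    ultimately show ?thesis by (simp flip: mult.assoc power_mult_distrib)
  qed
  have "\<exists>y. 0 < y \<and> y < x $ k \<and> (\<forall>j<k. x $ j < y) \<and> P y = 0" for k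
  proof -
    \<comment> \<open>\<open>l\<close> is the left end of the gap below \<open>x $ k\<close>: the
      preceding node, or 0 for the least index. In both cases the sign there is opposite to the sign
      at \<open>x $ k\<close>.\<close>
    have "\<exists>l. 0 \<le> l \<and> l < x $ k \<and> (\<forall>j<k. x $ j \<le> l) \<and> 0 < (-1) ^ card {j. k \<le> j} * P l"
    proof (cases "\<exists>j. j < k")
      case False
      then have "{j. k \<le> j} = UNIV" by (auto simp: not_less)
      then show ?thesis using zero x False by (intro exI[of _ 0]) auto
    next
      case True
      define i where "i = Max {j. j < k}"
      have i: "i < k" using Max_in[of "{j. j < k}"] True by (auto simp: i_def)
      have le: "j \<le> i" if "j < k" for j unfolding i_def using that by (intro Max_ge) auto
      have eq: "{j. k \<le> j} = {j. i < j}" using i le by (auto simp: not_le[symmetric])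
      have xle: "x $ j \<le> x $ i" if "j < k" for j
        using le[OF that] x(1)[of j i] by (auto simp: order_le_less)
      show ?thesis using i x xle node[of i] by (intro exI[of _ "x $ i"]) (auto simp: eq less_imp_le)
    qed
    then obtain l where l: "0 \<le> l" "l < x $ k" "\<forall>j<k. x $ j \<le> l" "0 < (-1) ^ card {j. k \<le> j} * P l"
      by blast
    have "{j. k \<le> j} = insert k {j. k < j}" by auto
    then have "(-1::real) ^ card {j. k \<le> j} = - ((-1) ^ card {j. k < j})" by simp
    with l(4) have neg: "(-1) ^ card {j. k < j} * P l < 0" by simp
    define Q where "Q t = (-1) ^ card {j. k < j} * P t" for t
    have Q: "Q l < 0" "0 < Q (x $ k)" using neg node[of k] by (auto simp: Q_def)
    have "\<exists>y\<ge>l. y \<le> x $ k \<and> Q y = 0"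
      using Q l by (intro IVT') (auto simp: Q_def intro!: continuous_intros cont)
    then obtain y where y: "l \<le> y" "y \<le> x $ k" "Q y = 0" by blast
    then have "y \<noteq> l" "y \<noteq> x $ k" using Q by auto
    with y l have "0 < y" "y < x $ k" "\<forall>j<k. x $ j < y" by (auto simp: order_le_less intro: le_less_trans)
    moreover have "P y = 0" using y(3) by (simp add: Q_def)
    ultimately show ?thesis by blast
  qed
  then obtain y where y: "0 < y k" "y k < x $ k" "\<And>j. j < k \<Longrightarrow> x $ j < y k" "P (y k) = 0" for k
    by metis
  define z where "z = (\<chi> k. y k)"
  have z: "z \<in> inter_box x" using y by (auto simp: inter_box_def z_def)
  have "y i < y j" if "i < j" for i j using y(2)[of i] y(3)[OF that] by simp
  then have "z $ i \<noteq> z $ j" if "i \<noteq> j" for i j using that unfolding z_def by (metis linorder_neqE order_less_irrefl vec_lambda_beta)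
  moreover have "poly (rpoly z) (complex_of_real (z $ i)) = 0" for i by (auto simp: poly_rpoly prod_zero_iff)
  ultimately have "pert_poly x p = rpoly z"
    using y(4) by (intro pert_poly_eq_rpolyI[of z]) (auto simp: P z_def)
  then have "p = root_weights x z" using pert_poly_eq_rpoly_iff[OF x'] by simp
  with z show "p \<in> root_weights x ` inter_box x" by blast
qed

lemma inter_box_sorted: 
  assumes "y \<in> inter_box x"
  shows "y \<in> sorted_vecs" "i < j \<Longrightarrow> y $ i < y $ j"
proof -
  show *: "y $ i < y $ j" if "i < j" for i j
    using assms that unfolding inter_box_def by (auto intro: less_trans)
  then show "y \<in> sorted_vecs" by (auto simp: sorted_vecs_def order_le_less)
qed

lemma inj_on_root_weights:
  fixes x :: "real^'n::{finite,linorder}"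
  assumes x: "\<And>i j. i < j \<Longrightarrow> x $ i < x $ j" "\<And>i. 0 < x $ i"
  shows "inj_on (root_weights x) (inter_box x)"
proof (rule inj_onI)
  have x': "\<And>i j. i \<noteq> j \<Longrightarrow> x $ i \<noteq> x $ j" "\<And>i. x $ i \<noteq> 0"
    using x by (metis linorder_neqE order_less_irrefl)+
  fix y z assume yz: "y \<in> inter_box x" "z \<in> inter_box x" "root_weights x y = root_weights x z"
  then have "rpoly y = rpoly z"
    using pert_poly_eq_rpoly_iff[OF x'] by metis
  then show "y = z" using inj_on_rpoly_sorted yz inter_box_sorted by (auto dest: inj_onD)
qed

lemma prod_prod_diff_eq_vandermonde:
  fixes x :: "real^'n::{finite,linorder}"
  assumes x: "\<And>i j. i \<noteq> j \<Longrightarrow> x $ i \<noteq> x $ j"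
  shows "(\<Prod>i\<in>UNIV. \<bar>\<Prod>j\<in>UNIV-{i}. x $ i - x $ j\<bar>) = \<bar>vandermonde x\<bar> * \<bar>vandermonde x\<bar>"
proof -
  have "det (\<chi> i j. \<Prod>k\<in>UNIV-{j}. x $ i - x $ k) = (\<Prod>j\<in>UNIV. \<Prod>k\<in>UNIV-{j}. x $ j - x $ k)"
    by (subst det_diagonal) (auto simp: prod_zero_iff)
  then show ?thesis
    using abs_det_prod_diff[of x x, OF x] by (simp add: abs_prod)
qed

lemma root_weights_has_derivative:
  fixes x :: "real^'n"
  shows "(root_weights x has_derivative (\<lambda>v. \<chi> i. (\<Sum>j\<in>UNIV. - v $ j * (\<Prod>k\<in>UNIV-{j}. x $ i - y $ k)) / (x $ i * (\<Prod>j\<in>UNIV-{i}. x $ i - x $ j)))) (at y within S)"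
proof -
  have 1: "((\<lambda>y. \<Prod>j\<in>UNIV. x $ i - y $ j) has_derivative (\<lambda>v. \<Sum>j\<in>UNIV. - v $ j * (\<Prod>k\<in>UNIV-{j}. x $ i - y $ k))) (at y within S)" for i
  proof (rule has_derivative_prod)
    fix j
    have "((\<lambda>y. y $ j) has_derivative (\<lambda>v. v $ j)) (at y within S)"
      by (intro bounded_linear_imp_has_derivative bounded_linear_vec_nth)
    from has_derivative_diff[OF has_derivative_const this]
    show "((\<lambda>y. x $ i - y $ j) has_derivative (\<lambda>v. - v $ j)) (at y within S)" by simp
  qed
  have 2: "((\<lambda>y. (\<Prod>j\<in>UNIV. x $ i - y $ j) * (1 / c)) has_derivative
      (\<lambda>v. (\<Sum>j\<in>UNIV. - v $ j * (\<Prod>k\<in>UNIV-{j}. x $ i - y $ k)) * (1 / c))) (at y within S)" for i c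
    by (rule has_derivative_mult_left[OF 1])
  show ?thesis
    unfolding has_derivative_componentwise_within[of "root_weights x"]
    using 2 by (auto simp: Basis_vec_def inner_axis root_weights_def)
qed

text \<open>Up to a scaling of each row the Jacobian matrix is the cleared Cauchy matrix. The
  scalings put the square of the Vandermonde factor of \<open>x\<close> in the denominator, and the
  determinant cancels one of the two.\<close>

lemma abs_det_root_weights:
  fixes x y :: "real^'n::{finite,linorder}"
  assumes x: "\<And>i j. i \<noteq> j \<Longrightarrow> x $ i \<noteq> x $ j" "\<And>i. 0 < x $ i" and y: "\<And>i j. i \<noteq> j \<Longrightarrow> y $ i \<noteq> y $ j"
  shows "\<bar>det (matrix (\<lambda>v. \<chi> i. (\<Sum>j\<in>UNIV. - v $ j * (\<Prod>k\<in>UNIV-{j}. x $ i - y $ k)) / (x $ i * (\<Prod>j\<in>UNIV-{i}. x $ i - x $ j))))\<bar>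
    = \<bar>vandermonde y\<bar> / ((\<Prod>i\<in>UNIV. x $ i) * \<bar>vandermonde x\<bar>)" (is "\<bar>det (matrix ?g)\<bar> = _")
proof -
  define c where "c i = - 1 / (x $ i * (\<Prod>j\<in>UNIV-{i}. x $ i - x $ j))" for i
  have "?g (axis j 1) $ i = c i * (\<Prod>k\<in>UNIV-{j}. x $ i - y $ k)" for i j
    by (simp add: axis_def c_def if_distrib[where f="\<lambda>a. a * _"] if_distrib[where f=uminus] sum_negf cong: if_cong)
  then have "matrix ?g = (\<chi> i. c i *s (\<chi> j. \<Prod>k\<in>UNIV-{j}. x $ i - y $ k))"
    by (simp add: matrix_def vec_eq_iff)
  then have "\<bar>det (matrix ?g)\<bar> = \<bar>\<Prod>i\<in>UNIV. c i\<bar> * (\<bar>vandermonde x\<bar> * \<bar>vandermonde y\<bar>)"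
    using abs_det_prod_diff[of y x, OF y] by (simp add: det_rows_mul abs_mult)
  also have "\<bar>\<Prod>i\<in>UNIV. c i\<bar> = 1 / ((\<Prod>i\<in>UNIV. x $ i) * (\<bar>vandermonde x\<bar> * \<bar>vandermonde x\<bar>))"
  proof -
    have "\<bar>\<Prod>i\<in>UNIV. c i\<bar> = 1 / ((\<Prod>i\<in>UNIV. x $ i) * (\<Prod>i\<in>UNIV. \<bar>\<Prod>j\<in>UNIV-{i}. x $ i - x $ j\<bar>))"
      using x(2) by (simp add: c_def prod_dividef abs_prod abs_mult prod.distrib less_imp_le)
    moreover have "(\<Prod>i\<in>UNIV. \<bar>\<Prod>j\<in>UNIV-{i}. x $ i - x $ j\<bar>) = \<bar>vandermonde x\<bar> * \<bar>vandermonde x\<bar>"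
      using x(1) by (intro prod_prod_diff_eq_vandermonde) auto
    ultimately show ?thesis by simp
  qed
  finally have "\<bar>det (matrix ?g)\<bar> = 1 / ((\<Prod>i\<in>UNIV. x $ i) * (\<bar>vandermonde x\<bar> * \<bar>vandermonde x\<bar>)) * (\<bar>vandermonde x\<bar> * \<bar>vandermonde y\<bar>)" .
  also have "\<dots> = \<bar>vandermonde y\<bar> / ((\<Prod>i\<in>UNIV. x $ i) * \<bar>vandermonde x\<bar>)"
  proof -
    have "\<bar>vandermonde x\<bar> \<noteq> 0"
      using x(1) vandermonde_eq_0_iff[of x] by auto
    then show ?thesis by (simp del: abs_mult_self_eq abs_eq_0)
  qed
  finally show ?thesis .
qed

lemma inter_box_borel [measurable]: "inter_box (x :: real^'n::{finite,linorder}) \<in> sets borel"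
  unfolding inter_box_def by measurable

lemma open_simplex_borel [measurable]: "(open_simplex :: (real^'n) set) \<in> sets borel"
  unfolding open_simplex_def by measurable

lemma bounded_open_simplex: "bounded (open_simplex :: (real^'n) set)"
proof (rule bounded_subset)
  show "bounded (cbox 0 1 :: (real^'n) set)" by simp
  have "p $ i \<le> 1" if "p \<in> open_simplex" for p :: "real^'n" and i
  proof -
    have "p $ i \<le> (\<Sum>i\<in>UNIV. p $ i)"
      using that by (intro member_le_sum) (auto simp: open_simplex_def less_imp_le)
    then show ?thesis using that by (simp add: open_simplex_def)
  qed
  then show "open_simplex \<subseteq> (cbox 0 1 :: (real^'n) set)"
    by (auto simp: mem_box_cart open_simplex_def less_imp_le)
qed

lemma borel_measurable_vandermonde [measurable]: "vandermonde \<in> borel_measurable borel"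
  unfolding vandermonde_def by measurable

lemma nn_integral_root_weights:
  fixes x :: "real^'n::{finite,linorder}"
  assumes x: "\<And>i j. i < j \<Longrightarrow> x $ i < x $ j" "\<And>i. 0 < x $ i"
    and h: "h \<in> borel_measurable borel"
  shows "(\<integral>\<^sup>+p. h p * indicator open_simplex p \<partial>lborel)
    = (\<integral>\<^sup>+y. h (root_weights x y) * ennreal (\<bar>vandermonde y\<bar> / ((\<Prod>i\<in>UNIV. x $ i) * \<bar>vandermonde x\<bar>)) * indicator (inter_box x) y \<partial>lborel)"
proof (rule nn_integral_change_of_variables[OF inter_box_borel open_simplex_borel bounded_open_simplex _ root_weights_has_derivative
      inj_on_root_weights[OF x] root_weights_image[OF x] _ _ h])
  show "root_weights x \<in> borel_measurable borel"
    unfolding root_weights_def by (intro borel_measurable_vec_lambda) measurable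
  show "\<bar>det (matrix (\<lambda>v. \<chi> i. (\<Sum>j\<in>UNIV. - v $ j * (\<Prod>k\<in>UNIV-{j}. x $ i - y $ k)) / (x $ i * (\<Prod>j\<in>UNIV-{i}. x $ i - x $ j))))\<bar>
    = \<bar>vandermonde y\<bar> / ((\<Prod>i\<in>UNIV. x $ i) * \<bar>vandermonde x\<bar>)" if "y \<in> inter_box x" for y
    using x that inter_box_sorted(2)[OF that] by (intro abs_det_root_weights) (metis linorder_neqE order_less_irrefl)+
qed measurable

section \<open>Gaussian vectors and the Dirichlet distribution\<close>

lemma PiM_density_lborel:
  fixes \<phi> :: "'a::euclidean_space \<Rightarrow> ennreal"
  assumes \<phi>[measurable]: "\<phi> \<in> borel_measurable borel" and prob: "prob_space (density lborel \<phi>)"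
  shows "PiM (UNIV::'m::finite set) (\<lambda>_. density lborel \<phi>) = density (PiM UNIV (\<lambda>_. lborel)) (\<lambda>f. \<Prod>i\<in>UNIV. \<phi> (f i))"
proof -
  interpret L: product_sigma_finite "\<lambda>_::'m. lborel :: 'a measure" by standard
  interpret D: prob_space "density lborel \<phi>" by fact
  interpret P: product_sigma_finite "\<lambda>_::'m. density lborel \<phi>" by standard
  show ?thesis
  proof (rule P.PiM_eqI[symmetric])
    show "sets (density (PiM UNIV (\<lambda>_::'m. lborel)) (\<lambda>f. \<Prod>i\<in>UNIV. \<phi> (f i))) = sets (PiM UNIV (\<lambda>_. density lborel \<phi>))"
      by (simp cong: sets_PiM_cong)
    fix A :: "'m \<Rightarrow> 'a set" assume "\<And>i. i \<in> UNIV \<Longrightarrow> A i \<in> sets (density lborel \<phi>)"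
    then have [measurable]: "A i \<in> sets borel" for i by simp
    have "emeasure (density (PiM UNIV (\<lambda>_. lborel)) (\<lambda>f. \<Prod>i\<in>UNIV. \<phi> (f i))) (PiE UNIV A)
      = (\<integral>\<^sup>+f. (\<Prod>i\<in>UNIV. \<phi> (f i) * indicator (A i) (f i)) \<partial>PiM UNIV (\<lambda>_. lborel))"
      by (subst emeasure_density) (auto intro!: nn_integral_cong simp: prod.distrib indicator_def prod_zero_iff PiE_iff)
    also have "\<dots> = (\<Prod>i\<in>UNIV. \<integral>\<^sup>+x. \<phi> x * indicator (A i) x \<partial>lborel)"
      by (rule L.product_nn_integral_prod) auto
    also have "\<dots> = (\<Prod>i\<in>UNIV. emeasure (density lborel \<phi>) (A i))"
      by (simp add: emeasure_density)
    finally show "emeasure (density (PiM UNIV (\<lambda>_. lborel)) (\<lambda>f. \<Prod>i\<in>UNIV. \<phi> (f i))) (PiE UNIV A) = (\<Prod>i\<in>UNIV. emeasure (density lborel \<phi>) (A i))" .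
  qed simp
qed

lemma distr_PiM_density_vec:
  fixes \<phi> :: "'a::euclidean_space \<Rightarrow> ennreal"
  assumes \<phi>[measurable]: "\<phi> \<in> borel_measurable borel" and prob: "prob_space (density lborel \<phi>)"
  shows "distr (PiM (UNIV::'m::finite set) (\<lambda>_. density lborel \<phi>)) borel (\<lambda>f. \<chi> i. f i) = density lborel (\<lambda>v. \<Prod>i\<in>UNIV. \<phi> (v $ i))"
proof -
  have [measurable]: "(\<lambda>f. \<chi> i. f i) \<in> measurable (PiM UNIV (\<lambda>_::'m. lborel :: 'a measure)) borel"
    by (intro borel_measurable_vec_lambda) (auto intro: measurable_component_singleton)
  have "density lborel (\<lambda>v::'a^'m. \<Prod>i\<in>UNIV. \<phi> (v $ i)) = density (distr (PiM UNIV (\<lambda>_. lborel)) borel (\<lambda>f. \<chi> i. f i)) (\<lambda>v. \<Prod>i\<in>UNIV. \<phi> (v $ i))"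
    by (simp add: distr_PiM_lborel_vec)
  also have "\<dots> = distr (density (PiM UNIV (\<lambda>_. lborel)) (\<lambda>f. \<Prod>i\<in>UNIV. \<phi> (f i))) borel (\<lambda>f. \<chi> i. f i)"
    by (subst density_distr) auto
  finally show ?thesis
    by (simp add: PiM_density_lborel[OF assms])
qed

text \<open>The disc of squared radius \<open>a\<close> has area \<open>pi * a\<close>, which is
  linear in \<open>a\<close>; hence the constant density.\<close>

lemma distr_lborel_cmod_sq:
  "distr lborel borel (\<lambda>z::complex. (cmod z)\<^sup>2) = density lborel (\<lambda>t. ennreal pi * indicator {0..} t)" (is "?D = ?E")
proof (rule measure_eqI_generator_eq[where E = "range atMost" and \<Omega> = UNIV and A = "\<lambda>n. {..real n}"])
  show "Int_stable (range atMost :: real set set)" by (auto simp: Int_stable_def)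
  have eq: "emeasure ?D {..a} = ennreal (pi * max 0 a)" "emeasure ?E {..a} = ennreal (pi * max 0 a)" for a
  proof -
    have "(\<lambda>z::complex. (cmod z)\<^sup>2) -` {..a} = (if a < 0 then {} else cball 0 (sqrt a))"
    proof (intro set_eqI)
      fix z :: complex
      have "0 \<le> a \<and> cmod z \<le> sqrt a" if "(cmod z)\<^sup>2 \<le> a"
        using order_trans[OF zero_le_power2 that] real_le_rsqrt[OF that] by simp
      moreover have "(cmod z)\<^sup>2 \<le> a" if "0 \<le> a" "cmod z \<le> sqrt a"
        using power_mono[OF that(2), of 2] that(1) by simp
      ultimately have "(cmod z)\<^sup>2 \<le> a \<longleftrightarrow> 0 \<le> a \<and> cmod z \<le> sqrt a"
        by blast
      then show "z \<in> (\<lambda>z. (cmod z)\<^sup>2) -` {..a} \<longleftrightarrow> z \<in> (if a < 0 then {} else cball 0 (sqrt a))"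
        by (cases "a < 0") simp_all
    qed
    then show "emeasure ?D {..a} = ennreal (pi * max 0 a)"
      by (auto simp: emeasure_distr emeasure_cball unit_ball_vol_2 max_def)
    have "emeasure ?E {..a} = ennreal pi * (\<integral>\<^sup>+t. indicator {0..a} t \<partial>lborel)"
    proof -
      have "emeasure ?E {..a} = (\<integral>\<^sup>+t. ennreal pi * indicator {0..} t * indicator {..a} t \<partial>lborel)"
        by (subst emeasure_density) auto
      also have "\<dots> = (\<integral>\<^sup>+t. ennreal pi * indicator {0..a} t \<partial>lborel)"
        by (intro nn_integral_cong) (auto simp: indicator_def)
      finally show ?thesis by (simp only: nn_integral_cmult borel_measurable_indicator sets_lborel atLeastAtMost_borel)
    qed
    also have "\<dots> = ennreal (pi * max 0 a)"
      by (cases "0 \<le> a") (auto simp: ennreal_mult' max_def)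
    finally show "emeasure ?E {..a} = ennreal (pi * max 0 a)" .
  qed
  show "emeasure ?D X = emeasure ?E X" if "X \<in> range atMost" for X using that eq by auto
  show "emeasure ?D {..real n} \<noteq> \<infinity>" for n by (simp add: eq)
  show "(\<Union>n. {..real n}) = UNIV" by (auto simp: real_arch_simple)
qed (auto simp: borel_eq_atMost)

text \<open>Scaled so that the squared modulus is exponential with rate 1.\<close>

definition gauss_density :: "complex \<Rightarrow> ennreal" where
  "gauss_density z = ennreal (exp (- (cmod z)\<^sup>2) / pi)"

lemma gauss_density_measurable [measurable]: "gauss_density \<in> borel_measurable borel"
  unfolding gauss_density_def by measurable

lemma distr_gauss_cmod_sq:
  "distr (density lborel gauss_density) borel (\<lambda>z. (cmod z)\<^sup>2) = density lborel (exponential_density 1)"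
proof -
  have "distr (density lborel gauss_density) borel (\<lambda>z. (cmod z)\<^sup>2)
     = density (distr lborel borel (\<lambda>z::complex. (cmod z)\<^sup>2)) (\<lambda>t. ennreal (exp (-t) / pi))"
    by (subst density_distr) (auto simp: gauss_density_def[abs_def])
  also have "\<dots> = density lborel (\<lambda>t. ennreal pi * indicator {0..} t * ennreal (exp (-t) / pi))"
    by (simp add: distr_lborel_cmod_sq density_density_eq)
  also have "\<dots> = density lborel (exponential_density 1)"
    by (intro density_cong) (auto simp: exponential_density_def indicator_def simp flip: ennreal_mult)
  finally show ?thesis .
qed

lemma prob_space_gauss: "prob_space (density lborel gauss_density)"
proof -
  have "emeasure (density lborel gauss_density) (space (density lborel gauss_density))
    = emeasure (distr (density lborel gauss_density) borel (\<lambda>z. (cmod z)\<^sup>2)) UNIV"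
    by (subst emeasure_distr) auto
  also have "\<dots> = 1"
    using prob_space.emeasure_space_1[OF prob_space_erlang_density[of 1 0]] by (simp add: distr_gauss_cmod_sq)
  finally show ?thesis by (rule prob_spaceI)
qed

definition gauss_vec :: "(complex^'m) measure" where
  "gauss_vec = density lborel (\<lambda>v. \<Prod>i\<in>UNIV. gauss_density (v $ i))"

lemma sets_gauss_vec [simp, measurable_cong]: "sets gauss_vec = sets borel"
  by (simp add: gauss_vec_def)

lemma space_gauss_vec [simp]: "space gauss_vec = UNIV"
  by (simp add: gauss_vec_def)

lemma gauss_vec_eq: "(gauss_vec :: (complex^'m) measure) = distr (PiM UNIV (\<lambda>_. density lborel gauss_density)) borel (\<lambda>f. \<chi> i. f i)"
  unfolding gauss_vec_def by (rule distr_PiM_density_vec[symmetric]) (auto simp: prob_space_gauss)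

lemma gauss_vec_lambda_measurable: "(\<lambda>f. \<chi> i. f i) \<in> measurable (PiM UNIV (\<lambda>_::'m::finite. density lborel gauss_density)) borel"
  by (rule borel_measurable_vec_lambda) measurable

lemma prob_space_gauss_vec: "prob_space gauss_vec"
  unfolding gauss_vec_eq
  by (intro prob_space.prob_space_distr prob_space_PiM prob_space_gauss gauss_vec_lambda_measurable)

text \<open>The product density depends only on the norm, which makes the law invariant under linear
  isometries.\<close>

lemma gauss_vec_density: "(gauss_vec :: (complex^'m) measure) = density lborel (\<lambda>v. ennreal (exp (- (norm v)\<^sup>2) / pi ^ CARD('m)))"
proof -
  have "(\<Prod>i\<in>UNIV. gauss_density (v $ i)) = ennreal (exp (- (norm v)\<^sup>2) / pi ^ CARD('m))" for v :: "complex^'m"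
    by (simp add: gauss_density_def prod_ennreal prod_dividef norm_vec_def L2_set_def sum_nonneg exp_sum sum_negf[symmetric])
  then show ?thesis by (simp add: gauss_vec_def)
qed

lemma distr_gauss_vec_isometry:
  fixes f :: "complex^'m \<Rightarrow> complex^'m"
  assumes lin: "linear f" and iso: "\<And>x. norm (f x) = norm x"
  shows "distr gauss_vec borel f = (gauss_vec :: (complex^'m) measure)"
proof -
  have [measurable]: "f \<in> borel_measurable borel"
    using lin by (intro borel_measurable_continuous_onI linear_continuous_on) (simp add: linear_conv_bounded_linear)
  have "density (distr lborel borel f) (\<lambda>v. ennreal (exp (- (norm v)\<^sup>2) / pi ^ CARD('m)))
     = distr (density lborel (\<lambda>v. ennreal (exp (- (norm (f v))\<^sup>2) / pi ^ CARD('m)))) borel f"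
    by (rule density_distr) auto
  then show ?thesis
    by (simp add: lborel_distr_isometry[OF lin iso] iso gauss_vec_density)
qed

lemma PiM_exponential_eq:
  "distr (PiM (UNIV::'m::finite set) (\<lambda>_. density lborel gauss_density)) (PiM UNIV (\<lambda>_. borel)) (\<lambda>f i. (cmod (f i))\<^sup>2)
    = PiM UNIV (\<lambda>_. density lborel (exponential_density 1))" (is "?D = ?P")
proof -
  interpret G: prob_space "density lborel gauss_density" by (rule prob_space_gauss)
  interpret E: prob_space "density lborel (exponential_density 1)" by (rule prob_space_erlang_density) simp
  interpret PG: product_sigma_finite "\<lambda>_::'m. density lborel gauss_density" by standard
  interpret PE: product_sigma_finite "\<lambda>_::'m. density lborel (exponential_density 1)" by standard
  have m: "(\<lambda>f i. (cmod (f i))\<^sup>2) \<in> measurable (PiM UNIV (\<lambda>_::'m. density lborel gauss_density)) (PiM UNIV (\<lambda>_. borel))"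
    by (rule measurable_PiM_single') (auto intro!: measurable_compose[OF measurable_component_singleton] simp: space_PiM)
  show ?thesis
  proof (rule PE.PiM_eqI)
    show "sets ?D = sets ?P" by (simp cong: sets_PiM_cong)
    fix A :: "'m \<Rightarrow> real set" assume "\<And>i. i \<in> UNIV \<Longrightarrow> A i \<in> sets (density lborel (exponential_density 1))"
    then have [measurable]: "A i \<in> sets borel" for i by simp
    have pre: "(\<lambda>z. (cmod z)\<^sup>2) -` A i \<in> sets borel" for i
      using measurable_sets_borel[of "\<lambda>z::complex. (cmod z)\<^sup>2" borel "A i"] by simp
    have "emeasure ?D (PiE UNIV A) = emeasure (PiM UNIV (\<lambda>_. density lborel gauss_density)) (PiE UNIV (\<lambda>i. (\<lambda>z. (cmod z)\<^sup>2) -` A i))"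
      using m by (subst emeasure_distr) (auto intro!: arg_cong2[where f=emeasure] sets_PiM_I_finite simp: space_PiM)
    also have "\<dots> = (\<Prod>i\<in>UNIV. emeasure (density lborel gauss_density) ((\<lambda>z. (cmod z)\<^sup>2) -` A i))"
      using pre by (intro PG.emeasure_PiM) auto
    also have "\<dots> = (\<Prod>i\<in>UNIV. emeasure (distr (density lborel gauss_density) borel (\<lambda>z. (cmod z)\<^sup>2)) (A i))"
      by (simp add: emeasure_distr)
    finally show "emeasure ?D (PiE UNIV A) = (\<Prod>i\<in>UNIV. emeasure (density lborel (exponential_density 1)) (A i))"
      by (simp only: distr_gauss_cmod_sq)
  qed simp
qed

lemma nn_integral_gauss_vec_cmod_sq:
  assumes h: "h \<in> borel_measurable (PiM (UNIV::'m::finite set) (\<lambda>_. borel))"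
  shows "(\<integral>\<^sup>+z. h (\<lambda>i. (cmod (z $ i))\<^sup>2) \<partial>gauss_vec) = (\<integral>\<^sup>+e. h e \<partial>PiM UNIV (\<lambda>_. density lborel (exponential_density 1)))"
proof -
  have m: "(\<lambda>f i. (cmod (f i))\<^sup>2) \<in> measurable (PiM UNIV (\<lambda>_::'m. density lborel gauss_density)) (PiM UNIV (\<lambda>_. borel))"
    by (rule measurable_PiM_single') (auto intro!: measurable_compose[OF measurable_component_singleton] simp: space_PiM)
  have m': "(\<lambda>z::complex^'m. \<lambda>i. (cmod (z $ i))\<^sup>2) \<in> measurable borel (PiM UNIV (\<lambda>_. borel))"
    by (rule measurable_PiM_single') (auto simp: space_PiM)
  show ?thesis
    unfolding gauss_vec_eq PiM_exponential_eq[symmetric]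
    by (subst nn_integral_distr[OF gauss_vec_lambda_measurable], use h m' in \<open>auto intro: measurable_compose\<close>)
       (subst nn_integral_distr[OF m], simp_all add: h)
qed

abbreviation expo :: "real measure" where
  "expo \<equiv> density lborel (exponential_density 1)"

lemma prob_space_expo: "prob_space expo"
  by (rule prob_space_erlang_density) simp

text \<open>A sum of independent exponentials is Erlang. The parameter of
  \<open>erlang_density\<close> is the shape minus one, hence \<open>card K - 1\<close>.\<close>

lemma distributed_sum_PiM_expo:
  assumes J: "finite J" "K \<subseteq> J" "K \<noteq> {}"
  shows "distr (PiM J (\<lambda>_. expo)) lborel (\<lambda>y. \<Sum>j\<in>K. y j) = density lborel (erlang_density (card K - 1) 1)"
proof -
  interpret E: prob_space expo by (rule prob_space_expo)
  interpret P: prob_space "PiM J (\<lambda>_. expo)" by (intro prob_space_PiM prob_space_expo)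
  have K: "finite K" using J finite_subset by blast
  have comp: "distr (PiM J (\<lambda>_. expo)) borel (\<lambda>y. y j) = expo" if "j \<in> K" for j
  proof -
    have "distr (PiM J (\<lambda>_. expo)) borel (\<lambda>y. y j) = distr (PiM J (\<lambda>_. expo)) expo (\<lambda>y. y j)"
      by (rule distr_cong) auto
    also have "\<dots> = expo" using that J by (intro distr_PiM_component) (auto intro: prob_space_expo)
    finally show ?thesis .
  qed
  have "P.indep_vars (\<lambda>_. borel) (\<lambda>j y. y j) K"
  proof (subst P.indep_vars_iff_distr_eq_PiM'[OF J(3)])
    show "P.random_variable borel (\<lambda>y. y j)" if "j \<in> K" for j
      using that J by (intro measurable_compose[OF measurable_component_singleton]) auto
    have "distr (PiM J (\<lambda>_. expo)) (PiM K (\<lambda>_. borel)) (\<lambda>x. \<lambda>i\<in>K. x i) = distr (PiM J (\<lambda>_. expo)) (PiM K (\<lambda>_. expo)) (\<lambda>x. \<lambda>i\<in>K. x i)"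
      by (rule distr_cong) (simp_all cong: sets_PiM_cong)
    also have "\<dots> = PiM K (\<lambda>_. expo)"
      using J by (intro distr_PiM_reindex[of J "\<lambda>_. expo" "\<lambda>i. i" K, simplified]) (auto intro: prob_space_expo)
    also have "\<dots> = PiM K (\<lambda>j. distr (PiM J (\<lambda>_. expo)) borel (\<lambda>y. y j))"
      by (rule PiM_cong) (auto simp: comp)
    finally show "distr (PiM J (\<lambda>_. expo)) (PiM K (\<lambda>_. borel)) (\<lambda>x. \<lambda>i\<in>K. x i) = PiM K (\<lambda>j. distr (PiM J (\<lambda>_. expo)) borel (\<lambda>y. y j))" .
  qed
  moreover have "distributed (PiM J (\<lambda>_. expo)) lborel (\<lambda>y. y j) (exponential_density 1)" if "j \<in> K" for j
  proof -
    have "distr (PiM J (\<lambda>_. expo)) lborel (\<lambda>y. y j) = distr (PiM J (\<lambda>_. expo)) borel (\<lambda>y. y j)"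
      by (rule distr_cong) auto
    moreover have "(\<lambda>y. y j) \<in> measurable (PiM J (\<lambda>_. expo)) borel"
      using that J by (intro measurable_compose[OF measurable_component_singleton]) auto
    ultimately show ?thesis
      using comp[OF that] by (simp add: distributed_def)
  qed
  ultimately have "distributed (PiM J (\<lambda>_. expo)) lborel (\<lambda>y. \<Sum>j\<in>K. y j) (erlang_density (card K - 1) 1)"
    using J K by (intro P.exponential_distributed_sum) auto
  then show ?thesis by (simp add: distributed_def)
qed

text \<open>The coordinates named by \<open>f\<close> stay separate, the others in \<open>R\<close>
  enter only through their sum, a single Erlang variable, and those outside \<open>R\<close>
  integrate to one. Strict inclusion gives that sum a density.\<close>

lemma nn_integral_expo_split:
  fixes f :: "'n::finite \<Rightarrow> 'm::finite"
  assumes f: "inj f" and R: "range f \<subset> R"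
    and F[measurable]: "F \<in> borel_measurable (borel \<Otimes>\<^sub>M borel)"
  shows "(\<integral>\<^sup>+e. F (\<chi> i. e (f i), \<Sum>j\<in>R-range f. e j) \<partial>PiM UNIV (\<lambda>_::'m. expo))
    = (\<integral>\<^sup>+a. \<integral>\<^sup>+s. ennreal (\<Prod>i\<in>UNIV. exponential_density 1 (a $ i)) * ennreal (erlang_density (card R - CARD('n) - 1) 1 s) * F (a, s) \<partial>lborel \<partial>lborel)"
proof -
  interpret E: prob_space expo by (rule prob_space_expo)
  interpret P: product_sigma_finite "\<lambda>_::'m. expo" by standard
  let ?I = "range f" and ?J = "- range f" and ?K = "R - range f"
  define H where "H a = (\<integral>\<^sup>+s. F (a, s) \<partial>density lborel (erlang_density (card ?K - 1) 1))" for a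
  have pe: "prob_space (density lborel (erlang_density (card ?K - 1) 1))"
    by (rule prob_space_erlang_density) simp
  interpret er: prob_space "density lborel (erlang_density (card ?K - 1) 1)" by (rule pe)
  have [measurable]: "H \<in> borel_measurable borel"
    unfolding H_def by measurable
  have comp[measurable]: "(\<lambda>e. e j) \<in> borel_measurable (PiM J (\<lambda>_::'m. expo))" if "j \<in> J" for j J
    using that by (intro measurable_compose[OF measurable_component_singleton]) auto
  have vecm: "(\<lambda>e. \<chi> i. e (f i)) \<in> borel_measurable (PiM J (\<lambda>_::'m. expo))" if "range f \<subseteq> J" for J
    using that by (intro borel_measurable_vec_lambda comp) auto
  have "(\<integral>\<^sup>+e. F (\<chi> i. e (f i), \<Sum>j\<in>?K. e j) \<partial>PiM (?I \<union> ?J) (\<lambda>_. expo))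
    = (\<integral>\<^sup>+x. \<integral>\<^sup>+y. F (\<chi> i. merge ?I ?J (x, y) (f i), \<Sum>j\<in>?K. merge ?I ?J (x, y) j) \<partial>PiM ?J (\<lambda>_. expo) \<partial>PiM ?I (\<lambda>_. expo))"
    by (rule P.product_nn_integral_fold)
       (auto intro!: measurable_compose[OF _ F] measurable_Pair vecm borel_measurable_sum comp)
  also have "\<dots> = (\<integral>\<^sup>+x. H (\<chi> i. x (f i)) \<partial>PiM ?I (\<lambda>_. expo))"
  proof (intro nn_integral_cong)
    fix x
    have "(\<integral>\<^sup>+y. F (\<chi> i. merge ?I ?J (x, y) (f i), \<Sum>j\<in>?K. merge ?I ?J (x, y) j) \<partial>PiM ?J (\<lambda>_. expo))
      = (\<integral>\<^sup>+y. F (\<chi> i. x (f i), \<Sum>j\<in>?K. y j) \<partial>PiM ?J (\<lambda>_. expo))"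
      by (intro nn_integral_cong arg_cong[where f=F]) (auto simp: merge_def intro!: sum.cong)
    also have "\<dots> = (\<integral>\<^sup>+s. F (\<chi> i. x (f i), s) \<partial>distr (PiM ?J (\<lambda>_. expo)) lborel (\<lambda>y. \<Sum>j\<in>?K. y j))"
      by (subst nn_integral_distr) (auto intro!: borel_measurable_sum comp)
    also have "\<dots> = H (\<chi> i. x (f i))"
      using R by (subst distributed_sum_PiM_expo) (auto simp: H_def)
    finally show "(\<integral>\<^sup>+y. F (\<chi> i. merge ?I ?J (x, y) (f i), \<Sum>j\<in>?K. merge ?I ?J (x, y) j) \<partial>PiM ?J (\<lambda>_. expo)) = H (\<chi> i. x (f i))" .
  qed
  also have "\<dots> = (\<integral>\<^sup>+e. H (\<chi> i. e i) \<partial>distr (PiM ?I (\<lambda>_. expo)) (PiM (UNIV :: 'n set) (\<lambda>_. expo)) (\<lambda>\<omega>. \<lambda>n\<in>UNIV. \<omega> (f n)))"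
  proof -
    have "(\<lambda>e. \<chi> i. e i) \<in> borel_measurable (PiM (UNIV :: 'n set) (\<lambda>_. expo))"
      by (intro borel_measurable_vec_lambda measurable_compose[OF measurable_component_singleton]) auto
    then have "(\<lambda>e. H (\<chi> i. e i)) \<in> borel_measurable (PiM (UNIV :: 'n set) (\<lambda>_. expo))"
      by measurable
    moreover have "(\<lambda>\<omega>. \<lambda>n\<in>UNIV. \<omega> (f n)) \<in> measurable (PiM ?I (\<lambda>_. expo)) (PiM (UNIV :: 'n set) (\<lambda>_. expo))"
      by (intro measurable_restrict measurable_component_singleton) auto
    ultimately show ?thesis
      by (subst nn_integral_distr) (simp_all add: restrict_def)
  qed
  also have "\<dots> = (\<integral>\<^sup>+e. H (\<chi> i. e i) \<partial>PiM (UNIV :: 'n set) (\<lambda>_. expo))"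
    using f by (subst distr_PiM_reindex) (auto intro: prob_space_expo)
  also have "\<dots> = (\<integral>\<^sup>+a. H a \<partial>distr (PiM (UNIV :: 'n set) (\<lambda>_. expo)) borel (\<lambda>e. \<chi> i. e i))"
    by (rule nn_integral_distr[symmetric])
       (auto intro!: borel_measurable_vec_lambda measurable_compose[OF measurable_component_singleton])
  also have "\<dots> = (\<integral>\<^sup>+a. (\<Prod>i\<in>UNIV. ennreal (exponential_density 1 (a $ i))) * H a \<partial>lborel)"
    by (subst distr_PiM_density_vec) (auto intro: prob_space_expo simp: nn_integral_density)
  also have "\<dots> = (\<integral>\<^sup>+a. \<integral>\<^sup>+s. ennreal (\<Prod>i\<in>UNIV. exponential_density 1 (a $ i)) * ennreal (erlang_density (card R - CARD('n) - 1) 1 s) * F (a, s) \<partial>lborel \<partial>lborel)"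
  proof (rule nn_integral_cong)
    fix a :: "real^'n"
    have "card ?K = card R - CARD('n)"
      using R f by (subst card_Diff_subset) (auto simp: card_image)
    then have "H a = (\<integral>\<^sup>+s. ennreal (erlang_density (card R - CARD('n) - 1) 1 s) * F (a, s) \<partial>lborel)"
      by (simp add: H_def nn_integral_density)
    then show "(\<Prod>i\<in>UNIV. ennreal (exponential_density 1 (a $ i))) * H a = (\<integral>\<^sup>+s. ennreal (\<Prod>i\<in>UNIV. exponential_density 1 (a $ i)) * ennreal (erlang_density (card R - CARD('n) - 1) 1 s) * F (a, s) \<partial>lborel)"
      by (simp add: prod_ennreal nn_integral_cmult[symmetric] mult.assoc)
  qed
  finally show ?thesis by simp
qed

lemma nn_integral_lborel_scale:
  fixes h :: "'a::euclidean_space \<Rightarrow> ennreal"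
  assumes [measurable]: "h \<in> borel_measurable borel" and t: "0 < t"
  shows "(\<integral>\<^sup>+a. h a \<partial>lborel) = ennreal (t ^ DIM('a)) * (\<integral>\<^sup>+p. h (t *\<^sub>R p) \<partial>lborel)"
  using t by (subst lborel_affine[of t 0]) (simp_all add: nn_integral_density nn_integral_distr nn_integral_cmult)

text \<open>Polar coordinates for the sum of the entries: the total \<open>t\<close> and the
  proportions \<open>p\<close> separate. The \<open>t\<close>-integral is a Gamma integral, and what
  remains in \<open>p\<close> is the Dirichlet density.\<close>

lemma nn_integral_dirichlet:
  fixes f :: "'n::finite \<Rightarrow> 'm::finite"
  assumes f: "inj f" and R: "range f \<subset> R"
    and \<Psi>[measurable]: "\<Psi> \<in> borel_measurable borel"
  shows "(\<integral>\<^sup>+e. \<Psi> (\<chi> i. e (f i) / (\<Sum>j\<in>R. e j)) \<partial>PiM UNIV (\<lambda>_::'m. expo))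
    = ennreal (fact (card R - 1) / fact (card R - CARD('n) - 1)) *
      (\<integral>\<^sup>+p. \<Psi> p * ennreal ((1 - (\<Sum>i\<in>UNIV. p $ i)) ^ (card R - CARD('n) - 1)) * indicator open_simplex p \<partial>lborel)"
proof -
  \<comment> \<open>\<open>k + 1\<close> coordinates of \<open>R\<close> lie outside the range of
    \<open>f\<close>, so \<open>k\<close> is the Erlang parameter and the exponent of the last
    proportion.\<close>
  define k where "k = card R - CARD('n) - 1"
  have "card (range f) < card R" using R by (intro psubset_card_mono) auto
  then have N: "card R = CARD('n) + k + 1" using f by (simp add: k_def card_image)
  let ?S = "\<lambda>a :: real^'n. \<Sum>i\<in>UNIV. a $ i"
  let ?w = "\<lambda>a :: real^'n. \<lambda>s. ennreal (\<Prod>i\<in>UNIV. exponential_density 1 (a $ i)) * ennreal (erlang_density k 1 s)"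
  let ?D = "\<integral>\<^sup>+p. \<Psi> p * ennreal ((1 - ?S p) ^ k) * indicator open_simplex p \<partial>lborel"
  have sumR: "(\<Sum>j\<in>R. e j) = ?S (\<chi> i. e (f i)) + (\<Sum>j\<in>R-range f. e j)" for e :: "'m \<Rightarrow> real"
  proof -
    have "(\<Sum>j\<in>R. e j) = (\<Sum>j\<in>range f. e j) + (\<Sum>j\<in>R-range f. e j)"
      using R by (subst sum.subset_diff[of "range f" R]) auto
    also have "(\<Sum>j\<in>range f. e j) = ?S (\<chi> i. e (f i))"
      using f by (simp add: sum.reindex)
    finally show ?thesis .
  qed
  define F where "F = (\<lambda>(a :: real^'n, s). \<Psi> (\<chi> i. a $ i / (?S a + s)))"
  have vm: "(\<lambda>x. \<chi> i. fst x $ i / (?S (fst x) + snd x)) \<in> borel_measurable (borel \<Otimes>\<^sub>M borel :: ((real^'n) \<times> real) measure)"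
    by (intro borel_measurable_vec_lambda) measurable
  have [measurable]: "F \<in> borel_measurable (borel \<Otimes>\<^sub>M borel)"
    unfolding F_def split_def by (rule measurable_compose[OF vm \<Psi>])
  have "(\<integral>\<^sup>+e. \<Psi> (\<chi> i. e (f i) / (\<Sum>j\<in>R. e j)) \<partial>PiM UNIV (\<lambda>_::'m. expo))
    = (\<integral>\<^sup>+e. F (\<chi> i. e (f i), \<Sum>j\<in>R-range f. e j) \<partial>PiM UNIV (\<lambda>_::'m. expo))"
    unfolding sumR by (simp add: F_def)
  also have "\<dots> = (\<integral>\<^sup>+a. \<integral>\<^sup>+s. ?w a s * F (a, s) \<partial>lborel \<partial>lborel)"
    unfolding k_def by (rule nn_integral_expo_split[OF f R]) simp
  \<comment> \<open>Shifting the Erlang variable by \<open>?S a\<close> replaces it by the total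
    over \<open>R\<close>, the denominator of the proportions.\<close>
  also have "\<dots> = (\<integral>\<^sup>+a. \<integral>\<^sup>+t. ?w a (t - ?S a) * F (a, t - ?S a) \<partial>lborel \<partial>lborel)"
  proof (rule nn_integral_cong)
    fix a :: "real^'n"
    have "(\<integral>\<^sup>+s. ?w a s * F (a, s) \<partial>lborel) = (\<integral>\<^sup>+s. ?w a s * F (a, s) \<partial>distr lborel borel ((+) (- ?S a)))"
      by (simp add: lborel_distr_plus)
    also have "\<dots> = (\<integral>\<^sup>+t. ?w a (t - ?S a) * F (a, t - ?S a) \<partial>lborel)"
      by (subst nn_integral_distr) auto
    finally show "(\<integral>\<^sup>+s. ?w a s * F (a, s) \<partial>lborel) = (\<integral>\<^sup>+t. ?w a (t - ?S a) * F (a, t - ?S a) \<partial>lborel)" .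
  qed
  also have "\<dots> = (\<integral>\<^sup>+t. \<integral>\<^sup>+a. ?w a (t - ?S a) * F (a, t - ?S a) \<partial>lborel \<partial>lborel)"
    by (rule lborel_pair.Fubini') measurable
  also have "\<dots> = (\<integral>\<^sup>+t. ennreal (1 / fact k) * (ennreal (t ^ (CARD('n) + k) * exp (- t)) * indicator {0..} t) * ?D \<partial>lborel)"
  proof (rule nn_integral_cong_AE)
    have "AE t in lborel. t \<noteq> (0::real)" by (rule AE_lborel_singleton)
    then show "AE t in lborel. (\<integral>\<^sup>+a. ?w a (t - ?S a) * F (a, t - ?S a) \<partial>lborel)
      = ennreal (1 / fact k) * (ennreal (t ^ (CARD('n) + k) * exp (- t)) * indicator {0..} t) * ?D"
    proof eventually_elim
      case (elim t)
      show ?case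
      proof (cases "t < 0")
        case True
        have w0: "?w a (t - ?S a) = 0" for a
        proof (cases "\<exists>i. a $ i < 0")
          case False
          then have "0 \<le> ?S a" by (intro sum_nonneg) (auto simp: not_less)
          with True show ?thesis by (simp add: erlang_density_def)
        next
          case True
          then have "(\<Prod>i\<in>UNIV. exponential_density 1 (a $ i)) = 0"
            by (auto simp: prod_zero_iff exponential_density_def)
          then show ?thesis by (simp only: ennreal_0 mult_zero_left)
        qed
        show ?thesis using True by (simp only: w0) simp
      next
        case False
        with elim have t: "0 < t" by simp
        have St: "?S (t *\<^sub>R p) = t * ?S p" for p by (simp add: sum_distrib_left)
        \<comment> \<open>Rescaling by \<open>t\<close> turns entries into proportions and
          contributes \<open>t ^ CARD('n)\<close>; with the Erlang power this yields the exponent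
          \<open>CARD('n) + k\<close>.\<close>
        have "(\<integral>\<^sup>+a. ?w a (t - ?S a) * F (a, t - ?S a) \<partial>lborel)
          = ennreal (t ^ CARD('n)) * (\<integral>\<^sup>+p. ?w (t *\<^sub>R p) (t - ?S (t *\<^sub>R p)) * F (t *\<^sub>R p, t - ?S (t *\<^sub>R p)) \<partial>lborel)"
          using t by (subst nn_integral_lborel_scale[of _ t]) auto
        also have "(\<integral>\<^sup>+p. ?w (t *\<^sub>R p) (t - ?S (t *\<^sub>R p)) * F (t *\<^sub>R p, t - ?S (t *\<^sub>R p)) \<partial>lborel)
          = (\<integral>\<^sup>+p. ennreal (t ^ k * exp (- t) / fact k) * (\<Psi> p * ennreal ((1 - ?S p) ^ k) * indicator open_simplex p) \<partial>lborel)"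
        proof (rule nn_integral_cong_AE)
          \<comment> \<open>The densities use weak inequalities and the simplex strict ones, so the
            two sides can differ on the boundary: for instance, the Erlang density with
            \<open>k = 0\<close> is 1 at 0. Boundary points are a null set.\<close>
          have "AE p in lborel. (\<chi> i. 1) \<bullet> (p :: real^'n) \<noteq> 1"
            by (rule AE_lborel_hyperplane) (simp add: vec_eq_iff)
          moreover have "AE p in lborel. \<forall>i\<in>UNIV. (p :: real^'n) $ i \<noteq> 0"
            by (intro AE_finite_allI AE_lborel_vec_nth_neq_const) simp
          ultimately show "AE p in lborel. ?w (t *\<^sub>R p) (t - ?S (t *\<^sub>R p)) * F (t *\<^sub>R p, t - ?S (t *\<^sub>R p))
             = ennreal (t ^ k * exp (- t) / fact k) * (\<Psi> p * ennreal ((1 - ?S p) ^ k) * indicator open_simplex p)"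
          proof eventually_elim
            case (elim p)
            have ne: "?S p \<noteq> 1" "\<And>i. p $ i \<noteq> 0" using elim by (auto simp: inner_vec_def)
            have F: "F (t *\<^sub>R p, t - ?S (t *\<^sub>R p)) = \<Psi> p"
              using t by (simp add: F_def vec_eq_iff)
            have diff: "t - ?S (t *\<^sub>R p) = t * (1 - ?S p)" unfolding St by (simp add: algebra_simps)
            have w: "?w (t *\<^sub>R p) (t - ?S (t *\<^sub>R p)) = ennreal (t ^ k * exp (- t) / fact k) * (ennreal ((1 - ?S p) ^ k) * indicator open_simplex p)"
            proof (cases "p \<in> open_simplex")
              case True
              then have p: "\<And>i. 0 < p $ i" "?S p < 1" by (auto simp: open_simplex_def)
              have "(\<Prod>i\<in>UNIV. exponential_density 1 ((t *\<^sub>R p) $ i)) = (\<Prod>i\<in>UNIV. exp (- (t * p $ i)))"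
                using p t by (intro prod.cong refl) (simp add: exponential_density_def not_less less_imp_le)
              also have "\<dots> = exp (- (t * ?S p))"
                by (simp add: exp_sum[symmetric] sum_negf) (rule sum_distrib_left[symmetric])
              finally have 1: "(\<Prod>i\<in>UNIV. exponential_density 1 ((t *\<^sub>R p) $ i)) = exp (- (t * ?S p))" .
              have 2: "erlang_density k 1 (t - ?S (t *\<^sub>R p)) = (t * (1 - ?S p)) ^ k * exp (- (t * (1 - ?S p))) / fact k"
                unfolding diff using p t by (simp add: erlang_density_def mult_less_0_iff)
              have "exp (- (t * ?S p)) * ((t * (1 - ?S p)) ^ k * exp (- (t * (1 - ?S p))) / fact k)
                 = t ^ k * exp (- t) / fact k * (1 - ?S p) ^ k"
              proof -
                have "exp (- (t * ?S p)) * exp (- (t * (1 - ?S p))) = exp (- t)"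
                  by (simp add: exp_add[symmetric] right_diff_distrib)
                then show ?thesis by (simp add: power_mult_distrib mult_ac)
              qed
              then show ?thesis
                using True p t unfolding 1 2 by (simp flip: ennreal_mult)
            next
              case False
              then have "(\<exists>i. p $ i < 0) \<or> 1 < ?S p"
                using ne by (auto simp: open_simplex_def not_less order_le_less)
              then have "(\<exists>i. p $ i < 0) \<or> t - ?S (t *\<^sub>R p) < 0"
                unfolding diff using t by (auto simp: mult_less_0_iff)
              then have "?w (t *\<^sub>R p) (t - ?S (t *\<^sub>R p)) = 0"
              proof
                assume "\<exists>i. p $ i < 0"
                then have "(\<Prod>i\<in>UNIV. exponential_density 1 ((t *\<^sub>R p) $ i)) = 0"
                  using t by (auto simp: prod_zero_iff exponential_density_def mult_less_0_iff)
                then show ?thesis by (simp only: ennreal_0 mult_zero_left)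
              qed (simp add: erlang_density_def)
              with False show ?thesis by simp
            qed
            show ?case unfolding F w by (simp add: mult_ac)
          qed
        qed
        also have "\<dots> = ennreal (t ^ k * exp (- t) / fact k) * ?D"
          by (rule nn_integral_cmult) measurable
        also have "ennreal (t ^ CARD('n)) * (ennreal (t ^ k * exp (- t) / fact k) * ?D)
          = ennreal (t ^ CARD('n) * (t ^ k * exp (- t) / fact k)) * ?D"
          using t by (subst ennreal_mult) (simp_all add: mult.assoc)
        also have "t ^ CARD('n) * (t ^ k * exp (- t) / fact k) = 1 / fact k * (t ^ (CARD('n) + k) * exp (- t))"
          by (simp add: power_add)
        also have "ennreal \<dots> = ennreal (1 / fact k) * (ennreal (t ^ (CARD('n) + k) * exp (- t)) * indicator {0..} t)"
          using t by (subst ennreal_mult) auto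
        finally show ?thesis .
      qed
    qed
  qed
  also have "\<dots> = ennreal (1 / fact k) * (\<integral>\<^sup>+t. ennreal (t ^ (CARD('n) + k) * exp (- t)) * indicator {0..} t \<partial>lborel) * ?D"
    by (simp add: nn_integral_multc nn_integral_cmult)
  also have "\<dots> = ennreal (1 / fact k * fact (CARD('n) + k)) * ?D"
    by (subst nn_intergal_power_times_exp_Ici) (simp flip: ennreal_mult')
  also have "1 / fact k * fact (CARD('n) + k) = (fact (card R - 1) / fact k :: real)"
    by (simp add: N)
  finally show ?thesis by (simp add: k_def)
qed

section \<open>Haar measure on the unitary group\<close>

definition is_haar :: "(complex^'m^'m) measure \<Rightarrow> bool" where
  "is_haar \<mu> \<longleftrightarrow> prob_space \<mu> \<and> sets \<mu> = sets borel \<and> emeasure \<mu> {U. unitary_mat U} = 1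
    \<and> (\<forall>V. unitary_mat V \<longrightarrow> distr \<mu> borel (\<lambda>U. V ** U) = \<mu>)"

lemma continuous_on_matrix_mult [continuous_intros]:
  fixes f g :: "'x::topological_space \<Rightarrow> complex^'m^'m"
  assumes "continuous_on S f" "continuous_on S g"
  shows "continuous_on S (\<lambda>x. f x ** g x)"
  unfolding matrix_matrix_mult_def by (intro continuous_intros continuous_on_vec_lambda assms)

lemma continuous_on_cadj [continuous_intros]:
  fixes f :: "'x::topological_space \<Rightarrow> complex^'m^'m"
  assumes "continuous_on S f"
  shows "continuous_on S (\<lambda>x. cadj (f x))"
  unfolding cadj_def by (intro continuous_intros continuous_on_vec_lambda assms)

lemma matrix_mult_measurable [measurable]:
  fixes V :: "complex^'m^'m"
  shows "(\<lambda>U :: complex^'m^'m. V ** U) \<in> borel_measurable borel"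
  using continuous_on_matrix_mult[of UNIV "\<lambda>_. V" "\<lambda>U. U"] by (intro borel_measurable_continuous_onI) (simp add: continuous_on_id)

lemma cadj_measurable [measurable]: "(cadj :: complex^'m^'m \<Rightarrow> _) \<in> borel_measurable borel"
  by (intro borel_measurable_continuous_onI continuous_intros)

lemma closed_unitary: "closed {U :: complex^'m^'m. unitary_mat U}"
  unfolding unitary_mat_def by (intro closed_Collect_eq continuous_intros)

lemma is_haar_AE_unitary:
  assumes "is_haar \<mu>"
  shows "AE U in \<mu>. unitary_mat U"
proof -
  interpret prob_space \<mu> using assms by (simp add: is_haar_def)
  have "{U. unitary_mat U} \<in> sets \<mu>" using assms borel_closed[OF closed_unitary] by (simp add: is_haar_def)
  then show ?thesis
    using AE_in_set_eq_1[of "{U. unitary_mat U}"] assms by (simp add: is_haar_def emeasure_eq_measure)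
qed

text \<open>Let \<open>V\<close> have law \<open>\<nu>\<close> and \<open>U\<close> law
  \<open>\<mu>\<close>. By left invariance of \<open>\<mu>\<close>, \<open>cadj V ** U\<close> has
  law \<open>\<mu>\<close>; replacing \<open>V\<close> by \<open>U ** V\<close>, it also has the law
  of \<open>cadj V\<close>. Fubini equates the two.\<close>

lemma is_haar_emeasure_cadj:
  assumes \<mu>: "is_haar \<mu>" and \<nu>: "is_haar \<nu>" and A: "A \<in> sets borel"
  shows "emeasure \<mu> A = emeasure \<nu> (cadj -` A)"
proof -
  interpret M: prob_space \<mu> using \<mu> by (simp add: is_haar_def)
  interpret N: prob_space \<nu> using \<nu> by (simp add: is_haar_def)
  interpret P: pair_sigma_finite \<nu> \<mu> ..
  have [measurable_cong]: "sets \<mu> = sets borel" "sets \<nu> = sets borel"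
    using \<mu> \<nu> by (auto simp: is_haar_def)
  then have sp[simp]: "space \<mu> = UNIV" "space \<nu> = UNIV" by (auto dest: sets_eq_imp_space_eq)
  note [measurable] = A
  have [measurable]: "(\<lambda>p. cadj (fst p) ** snd p) \<in> measurable (\<nu> \<Otimes>\<^sub>M \<mu>) borel"
  proof -
    have "(\<lambda>p. cadj (fst p) ** snd p) \<in> borel_measurable (borel :: ((complex^'a^'a) \<times> (complex^'a^'a)) measure)"
      by (intro borel_measurable_continuous_onI continuous_intros)
    then show ?thesis
      by (subst measurable_cong_sets[of _ "borel :: ((complex^'a^'a) \<times> (complex^'a^'a)) measure" _ borel])
         (auto simp: borel_prod[symmetric] intro!: sets_pair_measure_cong simp: \<open>sets \<mu> = sets borel\<close> \<open>sets \<nu> = sets borel\<close>)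
  qed
  have "(\<integral>\<^sup>+V. \<integral>\<^sup>+U. indicator A (cadj V ** U) \<partial>\<mu> \<partial>\<nu>) = (\<integral>\<^sup>+V. emeasure \<mu> A \<partial>\<nu>)"
  proof (rule nn_integral_cong_AE)
    show "AE V in \<nu>. (\<integral>\<^sup>+U. indicator A (cadj V ** U) \<partial>\<mu>) = emeasure \<mu> A"
      using is_haar_AE_unitary[OF \<nu>]
    proof eventually_elim
      case (elim V)
      have "(\<integral>\<^sup>+U. indicator A (cadj V ** U) \<partial>\<mu>) = (\<integral>\<^sup>+U. indicator A U \<partial>distr \<mu> borel (\<lambda>U. cadj V ** U))"
        by (subst nn_integral_distr) auto
      also have "distr \<mu> borel (\<lambda>U. cadj V ** U) = \<mu>"
        using \<mu> unitary_cadj[OF elim] by (auto simp: is_haar_def)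
      finally show ?case by simp
    qed
  qed
  moreover have "(\<integral>\<^sup>+V. \<integral>\<^sup>+U. indicator A (cadj V ** U) \<partial>\<mu> \<partial>\<nu>) = (\<integral>\<^sup>+U. \<integral>\<^sup>+V. indicator A (cadj V ** U) \<partial>\<nu> \<partial>\<mu>)"
    by (rule P.Fubini'[symmetric]) (simp add: split_def)
  moreover have "\<dots> = (\<integral>\<^sup>+U. emeasure \<nu> (cadj -` A) \<partial>\<mu>)"
  proof (rule nn_integral_cong_AE)
    show "AE U in \<mu>. (\<integral>\<^sup>+V. indicator A (cadj V ** U) \<partial>\<nu>) = emeasure \<nu> (cadj -` A)"
      using is_haar_AE_unitary[OF \<mu>]
    proof eventually_elim
      case (elim U)
      have pre: "cadj -` A \<in> sets borel" using measurable_sets_borel[of cadj borel A] by simp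
      have "(\<integral>\<^sup>+V. indicator A (cadj V ** U) \<partial>\<nu>) = (\<integral>\<^sup>+V. indicator A (cadj V ** U) \<partial>distr \<nu> borel (\<lambda>V. U ** V))"
        using \<nu> elim by (auto simp: is_haar_def)
      also have "\<dots> = (\<integral>\<^sup>+V. indicator A (cadj (U ** V) ** U) \<partial>\<nu>)"
      proof (subst nn_integral_distr)
        have "(\<lambda>V. cadj V ** U) \<in> borel_measurable borel"
          by (intro borel_measurable_continuous_onI continuous_intros)
        then show "(\<lambda>V. indicator A (cadj V ** U) :: ennreal) \<in> borel_measurable (distr \<nu> borel (\<lambda>V. U ** V))"
          by measurable
      qed auto
      also have "\<dots> = (\<integral>\<^sup>+V. indicator (cadj -` A) V \<partial>\<nu>)"
        using elim by (intro nn_integral_cong) (simp add: cadj_mult matrix_mul_assoc[symmetric] unitary_mat_def indicator_def)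
      finally show ?case using pre by simp
    qed
  qed
  ultimately show ?thesis
    by (simp add: M.emeasure_space_1[simplified] N.emeasure_space_1[simplified])
qed

text \<open>Applied to the pairs \<open>\<mu>\<close>, \<open>\<nu>\<close> and
  \<open>\<nu>\<close>, \<open>\<nu>\<close>, the preceding identity gives the same value for both
  measures of a set.\<close>

lemma is_haar_unique:
  assumes "is_haar \<mu>" "is_haar \<nu>"
  shows "\<mu> = \<nu>"
proof (rule measure_eqI)
  show "sets \<mu> = sets \<nu>" using assms by (simp add: is_haar_def)
  fix A assume "A \<in> sets \<mu>"
  then have "A \<in> sets borel" using assms by (simp add: is_haar_def)
  then show "emeasure \<mu> A = emeasure \<nu> A"
    using is_haar_emeasure_cadj assms by metis
qed

section \<open>Existence of Haar measure by Gram-Schmidt orthonormalisation\<close>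

function gram_schmidt :: "complex^'m^'m \<Rightarrow> 'm::finite \<Rightarrow> complex^'m" where
  "gram_schmidt A k = (let v = column k A - (\<Sum>j | to_nat j < to_nat k. cdot (gram_schmidt A j) (column k A) *s gram_schmidt A j)
     in complex_of_real (1 / norm v) *s v)"
  by auto
termination
  by (relation "Wellfounded.measure (\<lambda>(A, k). to_nat k)") auto

declare gram_schmidt.simps [simp del]

lemma matrix_vector_mult_axis: "A *v axis k 1 = column k (A :: complex^'n^'m)"
  by (simp add: matrix_vector_mult_def column_def axis_def vec_eq_iff if_distrib[where f="\<lambda>a. _ * a"] cong: if_cong)

lemma cdot_diff_right: "cdot x (y - z) = cdot x y - cdot x z"
  by (simp add: cdot_def right_diff_distrib sum_subtractf)

lemma cdot_scale_right: "cdot x (a *s y) = a * cdot x y"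
  by (simp add: cdot_def sum_distrib_left mult_ac)

lemma cdot_sum_right: "cdot x (\<Sum>j\<in>S. f j) = (\<Sum>j\<in>S. cdot x (f j))"
  by (simp add: cdot_def sum_distrib_left sum.swap[of _ S])

lemma norm_complex_scale:
  fixes v :: "complex^'n"
  shows "norm (complex_of_real r *s v) = \<bar>r\<bar> * norm v"
proof -
  have "complex_of_real r *s v = r *\<^sub>R v"
    by (simp only: vec_eq_iff vector_smult_component vector_scaleR_component) (simp add: scaleR_conv_of_real)
  then show ?thesis by simp
qed

text \<open>Only inner products, norms and linear combinations of columns are used, and a unitary
  respects them all. This equivariance will carry left invariance to the orthonormalised matrix.
  Columns are processed in the order of \<open>to_nat\<close>, as the index type itself has
  none.\<close>

lemma gram_schmidt_mult:
  assumes V: "unitary_mat V"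
  shows "gram_schmidt (V ** A) k = V *v gram_schmidt A k"
proof (induction k rule: measure_induct_rule[of to_nat])
  case (less k)
  have col: "column k (V ** A) = V *v column k A"
    by (simp add: column_def matrix_matrix_mult_def matrix_vector_mult_def vec_eq_iff)
  have dot: "cdot (V *v x) (V *v y) = cdot x y" for x y
    using V by (simp add: cdot_mult_vec matrix_vector_mul_assoc unitary_mat_def)
  define v where "v = column k A - (\<Sum>j | to_nat j < to_nat k. cdot (gram_schmidt A j) (column k A) *s gram_schmidt A j)"
  have "column k (V ** A) - (\<Sum>j | to_nat j < to_nat k. cdot (gram_schmidt (V ** A) j) (column k (V ** A)) *s gram_schmidt (V ** A) j)
    = V *v v"
    by (simp add: v_def less col dot matrix_vector_mult_diff_distrib vector_scalar_commute[symmetric] vec.linear_sum matrix_vector_mul_linear_gen)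
  then show ?case
    using V by (simp add: gram_schmidt.simps[of _ k] Let_def v_def[symmetric] unitary_norm vector_scalar_commute)
qed

text \<open>Also valid for a vanishing residual: division by zero gives 0, so both sides are
  0.\<close>

lemma gram_schmidt_step:
  "column k A - (\<Sum>j | to_nat j < to_nat k. cdot (gram_schmidt A j) (column k A) *s gram_schmidt A j)
    = complex_of_real (norm (column k A - (\<Sum>j | to_nat j < to_nat k. cdot (gram_schmidt A j) (column k A) *s gram_schmidt A j))) *s gram_schmidt A k"
  by (subst (3) gram_schmidt.simps) (auto simp: Let_def vector_smult_assoc)

text \<open>Orthonormalisation is triangular: an output involves only its own and earlier columns.
  This support condition is what rules out a vanishing residual.\<close>

lemma gram_schmidt_in_range:
  fixes A :: "complex^'m^'m"
  shows "\<exists>c. gram_schmidt A k = A *v c \<and> (\<forall>i. to_nat k < to_nat i \<longrightarrow> c $ i = 0)"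
proof (induction k rule: measure_induct_rule[of to_nat])
  case (less k)
  then obtain c where c: "\<And>j. to_nat j < to_nat k \<Longrightarrow> gram_schmidt A j = A *v c j"
    "\<And>j i. to_nat j < to_nat k \<Longrightarrow> to_nat j < to_nat i \<Longrightarrow> c j $ i = 0"
    by metis
  define d where "d = axis k 1 - (\<Sum>j | to_nat j < to_nat k. cdot (gram_schmidt A j) (column k A) *s c j)"
  have "A *v d = column k A - (\<Sum>j | to_nat j < to_nat k. cdot (gram_schmidt A j) (column k A) *s gram_schmidt A j)"
    by (simp add: d_def c(1) matrix_vector_mult_diff_distrib vector_scalar_commute[symmetric] vec.linear_sum[OF matrix_vector_mul_linear_gen] matrix_vector_mult_axis)
  then have "gram_schmidt A k = A *v (complex_of_real (1 / norm (A *v d)) *s d)"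
    by (subst gram_schmidt.simps) (simp add: Let_def vector_scalar_commute)
  moreover have "d $ i = 0" if "to_nat k < to_nat i" for i
    using that c(2) by (auto simp: d_def axis_def intro!: sum.neutral)
  ultimately show ?case by (intro exI[of _ "complex_of_real (1 / norm (A *v d)) *s d"]) simp
qed

text \<open>A vanishing residual would give a vector killed by \<open>A\<close> whose entry at
  \<open>k\<close> is 1, as the correction terms use only earlier columns.\<close>

lemma gram_schmidt_residual_nonzero:
  fixes A :: "complex^'m^'m"
  assumes A: "det A \<noteq> 0"
  shows "column k A - (\<Sum>j | to_nat j < to_nat k. cdot (gram_schmidt A j) (column k A) *s gram_schmidt A j) \<noteq> 0"
proof
  assume eq: "column k A - (\<Sum>j | to_nat j < to_nat k. cdot (gram_schmidt A j) (column k A) *s gram_schmidt A j) = 0"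
  obtain c where c: "\<And>j. gram_schmidt A j = A *v c j" "\<And>j i. to_nat j < to_nat i \<Longrightarrow> c j $ i = 0"
    using gram_schmidt_in_range[of A] by metis
  define d where "d = axis k 1 - (\<Sum>j | to_nat j < to_nat k. cdot (gram_schmidt A j) (column k A) *s c j)"
  have "A *v d = 0"
    using eq by (simp add: d_def c(1) matrix_vector_mult_diff_distrib vector_scalar_commute[symmetric] vec.linear_sum[OF matrix_vector_mul_linear_gen] matrix_vector_mult_axis)
  moreover have "\<exists>B. B ** A = mat 1"
    using A invertible_det_nz[of A] invertible_left_inverse[of A] by blast
  ultimately have "d = 0"
    by (auto simp: matrix_left_invertible_ker)
  moreover have "d $ k = 1"
    using c(2) by (auto simp: d_def axis_def intro!: sum.neutral)
  ultimately show False by simp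
qed

lemma norm_gram_schmidt:
  assumes "det A \<noteq> 0"
  shows "norm (gram_schmidt A k) = 1"
proof -
  define v where "v = column k A - (\<Sum>j | to_nat j < to_nat k. cdot (gram_schmidt A j) (column k A) *s gram_schmidt A j)"
  have "v \<noteq> 0" unfolding v_def by (rule gram_schmidt_residual_nonzero[OF assms])
  have "v = complex_of_real (norm v) *s gram_schmidt A k"
    unfolding v_def by (rule gram_schmidt_step)
  then have "norm v = norm (complex_of_real (norm v) *s gram_schmidt A k)"
    by simp
  also have "\<dots> = norm v * norm (gram_schmidt A k)"
    by (simp add: norm_complex_scale)
  finally show ?thesis using \<open>v \<noteq> 0\<close> by simp
qed

lemma gram_schmidt_orthogonal:
  assumes A: "det A \<noteq> 0" and ij: "to_nat i < to_nat k"
  shows "cdot (gram_schmidt A i) (gram_schmidt A k) = 0"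
  using ij
proof (induction k arbitrary: i rule: measure_induct_rule[of to_nat])
  case (less k)
  define v where "v = column k A - (\<Sum>j | to_nat j < to_nat k. cdot (gram_schmidt A j) (column k A) *s gram_schmidt A j)"
  have "v \<noteq> 0" unfolding v_def by (rule gram_schmidt_residual_nonzero[OF A])
  have v: "v = complex_of_real (norm v) *s gram_schmidt A k"
    unfolding v_def by (rule gram_schmidt_step)
  have orth: "cdot (gram_schmidt A i) (gram_schmidt A j) = (if j = i then 1 else 0)" if "to_nat j < to_nat k" for j
  proof (cases "j = i")
    case True
    then show ?thesis using norm_gram_schmidt[OF A] by (simp add: cdot_self)
  next
    case False
    then have "to_nat i < to_nat j \<or> to_nat j < to_nat i" by (meson linorder_neqE_nat to_nat_split inj_to_nat injD)
    then have "cdot (gram_schmidt A i) (gram_schmidt A j) = 0 \<or> cdot (gram_schmidt A j) (gram_schmidt A i) = 0"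
      using less.IH that less.prems by blast
    then show ?thesis using False by (metis cnj_cdot complex_cnj_zero)
  qed
  have "cdot (gram_schmidt A i) v = cdot (gram_schmidt A i) (column k A)
     - (\<Sum>j | to_nat j < to_nat k. cdot (gram_schmidt A j) (column k A) * cdot (gram_schmidt A i) (gram_schmidt A j))"
    unfolding v_def by (simp add: cdot_diff_right cdot_sum_right cdot_scale_right)
  also have "\<dots> = 0"
    using less.prems by (simp add: orth if_distrib[where f="\<lambda>a. _ * a"] cong: if_cong)
  finally have "complex_of_real (norm v) * cdot (gram_schmidt A i) (gram_schmidt A k) = 0"
    by (subst (asm) v) (simp add: cdot_scale_right)
  then show ?case using \<open>v \<noteq> 0\<close> by simp
qed

definition unitarization :: "complex^'m^'m \<Rightarrow> complex^'m^'m" where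
  "unitarization A = (\<chi> i j. gram_schmidt A j $ i)"

lemma unitary_unitarization:
  assumes "det A \<noteq> 0"
  shows "unitary_mat (unitarization A)"
proof -
  have "column j (unitarization A) = gram_schmidt A j" for j
    by (simp add: unitarization_def column_def vec_eq_iff)
  moreover have "cdot (gram_schmidt A i) (gram_schmidt A j) = 0" if "i \<noteq> j" for i j
  proof -
    have "to_nat i < to_nat j \<or> to_nat j < to_nat i" using that by (meson linorder_neqE_nat inj_to_nat injD)
    then show ?thesis using gram_schmidt_orthogonal[OF assms] by (metis cnj_cdot complex_cnj_zero)
  qed
  ultimately show ?thesis
    using norm_gram_schmidt[OF assms] by (auto simp: unitary_iff_columns cdot_self)
qed

lemma unitarization_mult: "unitary_mat V \<Longrightarrow> unitarization (V ** A) = V ** unitarization A"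
  unfolding unitarization_def
  by (simp add: gram_schmidt_mult) (simp add: vec_eq_iff matrix_matrix_mult_def matrix_vector_mult_def)

lemma gram_schmidt_measurable:
  fixes k :: "'m::finite"
  shows "(\<lambda>A. gram_schmidt A k) \<in> borel_measurable borel"
proof (induction k rule: measure_induct_rule[of to_nat])
  case (less k)
  have col: "(\<lambda>A :: complex^'m^'m. column k A) \<in> borel_measurable borel"
    unfolding column_def by (intro borel_measurable_continuous_onI continuous_on_vec_lambda continuous_intros)
  have nth: "(\<lambda>A. gram_schmidt A j $ i) \<in> borel_measurable borel" if "to_nat j < to_nat k" for i j :: 'm
    by (rule measurable_compose[OF less[OF that] borel_measurable_vec_nth])
  have coln: "(\<lambda>A :: complex^'m^'m. column k A $ i) \<in> borel_measurable borel" for i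
    by (rule measurable_compose[OF col borel_measurable_vec_nth])
  have dot: "(\<lambda>A. cdot (gram_schmidt A j) (column k A)) \<in> borel_measurable borel" if "to_nat j < to_nat k" for j :: 'm
  proof -
    have "(\<lambda>A. cnj (gram_schmidt A j $ i)) \<in> borel_measurable borel" for i
      by (rule measurable_compose[OF nth[OF that] borel_measurable_continuous_onI]) (intro continuous_intros)
    then show ?thesis
      unfolding cdot_def using coln by (intro borel_measurable_sum borel_measurable_times)
  qed
  have "(\<lambda>A. cdot (gram_schmidt A j) (column k A) *s gram_schmidt A j) \<in> borel_measurable borel" if "to_nat j < to_nat k" for j :: 'm
    unfolding vector_scalar_mult_def using nth[OF that] dot[OF that] by (intro borel_measurable_vec_lambda) measurable
  moreover define v where "v A = column k A - (\<Sum>j | to_nat j < to_nat k. cdot (gram_schmidt A j) (column k A) *s gram_schmidt A j)" for A :: "complex^'m^'m"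
  ultimately have v[measurable]: "v \<in> borel_measurable borel"
    unfolding v_def using col by (intro borel_measurable_diff borel_measurable_sum) auto
  have vn: "(\<lambda>A. v A $ i) \<in> borel_measurable borel" for i
    by (rule measurable_compose[OF v borel_measurable_vec_nth])
  have eq: "gram_schmidt A k = (\<chi> i. complex_of_real (1 / norm (v A)) * v A $ i)" for A
  proof -
    have "gram_schmidt A k = complex_of_real (1 / norm (v A)) *s v A"
      unfolding v_def by (subst gram_schmidt.simps) (simp only: Let_def)
    then show ?thesis by (simp add: vector_scalar_mult_def)
  qed
  show ?case
    unfolding eq using vn by (intro borel_measurable_vec_lambda borel_measurable_times) measurable
qed

lemma unitarization_measurable [measurable]: "unitarization \<in> borel_measurable borel"
  unfolding unitarization_def
  by (intro borel_measurable_vec_lambda measurable_compose[OF gram_schmidt_measurable borel_measurable_vec_nth])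

section \<open>Almost every matrix is invertible\<close>

lemma bounded_linear_matrix_vector: "bounded_linear (\<lambda>v :: complex^'n. B *v v)"
proof -
  have "linear (\<lambda>v :: complex^'n. B *v v)"
    by (intro linearI) (simp_all add: matrix_vector_right_distrib, simp add: vec_eq_iff matrix_vector_mult_def scaleR_sum_right)
  then show ?thesis by (simp add: linear_conv_bounded_linear)
qed

text \<open>A number beyond an operator bound of \<open>B\<close> is not an eigenvalue, so the
  polynomial has a nonzero value there.\<close>

lemma charpoly_nonzero: "charpoly (B :: complex^'n^'n) \<noteq> 0"
proof
  assume "charpoly B = 0"
  then have det: "det (\<chi> i j. (if i = j then t else 0) - B $ i $ j) = 0" for t
    by (simp flip: poly_charpoly)
  obtain K where K: "\<And>v :: complex^'n. norm (B *v v) \<le> norm v * K"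
    using bounded_linear.bounded[OF bounded_linear_matrix_vector] by blast
  define t where "t = \<bar>K\<bar> + 1"
  define C where "C = (\<chi> i j. (if i = j then complex_of_real t else 0) - B $ i $ j)"
  have "det C = 0" unfolding C_def by (rule det)
  then obtain v where v: "cdot v v = 1" "C *v v = 0" by (rule exists_kernel_vector)
  have "C *v v = complex_of_real t *s v - B *v v"
    by (simp add: C_def matrix_vector_mult_def vec_eq_iff left_diff_distrib sum_subtractf if_distrib[where f="\<lambda>a. a * _"] cong: if_cong)
  with v have "B *v v = complex_of_real t *s v" by simp
  then have "norm (B *v v) = \<bar>t\<bar> * norm v"
    by (simp only: norm_complex_scale)
  then have "t * norm v \<le> norm v * K"
    using K[of v] by (simp add: t_def)
  moreover have "norm v > 0" using v by (auto simp: cdot_def)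
  ultimately show False by (simp add: t_def mult.commute)
qed

lemma continuous_on_det: "continuous_on S (\<lambda>A :: complex^'n^'n. det A)"
  unfolding det_def by (intro continuous_intros)

text \<open>Along every line in the direction of the identity the determinant is a nonzero
  polynomial with finitely many roots. Translation invariance and Fubini turn this into a null set
  of singular matrices.\<close>

lemma AE_det_nonzero: "AE A in lborel. det (A :: complex^'m^'m) \<noteq> 0"
proof -
  define N where "N = {A :: complex^'m^'m. det A = 0}"
  have "closed N"
    unfolding N_def by (intro closed_Collect_eq continuous_on_det continuous_intros)
  then have [measurable]: "N \<in> sets borel" by simp
  have "(\<integral>\<^sup>+t. emeasure lborel N \<partial>(lborel :: real measure)) = (\<integral>\<^sup>+t. \<integral>\<^sup>+A. indicator N (t *\<^sub>R mat 1 + A) \<partial>lborel \<partial>lborel)"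
  proof (rule nn_integral_cong)
    fix t :: real
    have "emeasure lborel N = (\<integral>\<^sup>+A. indicator N A \<partial>distr lborel borel ((+) (t *\<^sub>R mat 1)))"
      by (simp add: lborel_distr_plus)
    also have "\<dots> = (\<integral>\<^sup>+A. indicator N (t *\<^sub>R mat 1 + A) \<partial>lborel)"
      by (subst nn_integral_distr) auto
    finally show "emeasure lborel N = \<dots>" .
  qed
  also have "\<dots> = (\<integral>\<^sup>+A. \<integral>\<^sup>+t. indicator N (t *\<^sub>R mat 1 + A) \<partial>lborel \<partial>lborel)"
    by (rule lborel_pair.Fubini'[symmetric]) measurable
  also have "\<dots> = (\<integral>\<^sup>+A. 0 \<partial>(lborel :: (complex^'m^'m) measure))"
  proof (rule nn_integral_cong)
    fix A :: "complex^'m^'m"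
    define Z where "Z = {t :: real. t *\<^sub>R mat 1 + A \<in> N}"
    have "det (t *\<^sub>R mat 1 + A) = poly (charpoly (- A)) (complex_of_real t)" for t
      unfolding poly_charpoly by (rule arg_cong[where f=det]) (auto simp: vec_eq_iff mat_def of_real_def)
    then have "Z = complex_of_real -` {z. poly (charpoly (- A)) z = 0}"
      by (auto simp: Z_def N_def)
    also have "finite \<dots>"
      by (intro finite_vimageI poly_roots_finite charpoly_nonzero) (simp add: inj_on_def)
    finally have "finite Z" .
    have "(\<integral>\<^sup>+t. indicator N (t *\<^sub>R mat 1 + A) \<partial>lborel) = (\<integral>\<^sup>+t. indicator Z t \<partial>lborel)"
      by (simp add: Z_def indicator_def)
    also have "\<dots> = emeasure lborel Z"
      using \<open>finite Z\<close> by (intro nn_integral_indicator) (auto intro: borel_closed finite_imp_closed)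
    also have "\<dots> = 0"
      using \<open>finite Z\<close> by (intro emeasure_lborel_countable countable_finite)
    finally show "(\<integral>\<^sup>+t. indicator N (t *\<^sub>R mat 1 + A) \<partial>lborel) = 0" .
  qed
  \<comment> \<open>The integral started from is the measure of \<open>N\<close> times the infinite
    length of the line; it is zero only if \<open>N\<close> is null.\<close>
  finally have "emeasure lborel N = 0" by (simp split: if_splits)
  then show ?thesis
    using borel_closed[OF \<open>closed N\<close>] by (intro AE_I[where N = N]) (auto simp: N_def)
qed

text \<open>Left multiplication by a unitary is an isometry of the matrix space, so it preserves the
  uniform law on the unit ball; equivariance of \<open>unitarization\<close> transfers the
  invariance to the unitary group.\<close>

lemma exists_haar: "\<exists>\<mu> :: (complex^'m^'m) measure. is_haar \<mu>"
proof -
  define B where "B = ball (0 :: complex^'m^'m) 1"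
  have B: "emeasure lborel B \<noteq> 0" "emeasure lborel B \<noteq> \<infinity>" "B \<in> sets borel"
    using content_ball_pos[of 1 "0::complex^'m^'m"] emeasure_lborel_ball_finite[of "0::complex^'m^'m" 1]
    by (auto simp: B_def measure_def)
  define \<mu>0 where "\<mu>0 = uniform_measure lborel B"
  interpret M: prob_space \<mu>0
    unfolding \<mu>0_def using B by (intro prob_space_uniform_measure) auto
  have [simp, measurable_cong]: "sets \<mu>0 = sets borel" by (simp add: \<mu>0_def)
  have [simp]: "space \<mu>0 = UNIV" by (simp add: \<mu>0_def)
  have inv: "distr \<mu>0 borel (\<lambda>A. V ** A) = \<mu>0" if V: "unitary_mat V" for V
  proof -
    have lin: "linear (\<lambda>A. V ** A)"
      by (intro linearI) (simp_all add: matrix_add_ldistrib, simp add: vec_eq_iff matrix_matrix_mult_def scaleR_sum_right)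
    have "\<mu>0 = density (distr lborel borel (\<lambda>A. V ** A)) (\<lambda>x. indicator B x / emeasure lborel B)"
      by (simp add: \<mu>0_def uniform_measure_def lborel_distr_isometry[OF lin unitary_norm_matrix[OF V]])
    also have "\<dots> = distr (density lborel (\<lambda>x. indicator B (V ** x) / emeasure lborel B)) borel (\<lambda>A. V ** A)"
      using B(3) by (subst density_distr) auto
    also have "(\<lambda>x. indicator B (V ** x) / emeasure lborel B) = (\<lambda>x. indicator B x / emeasure lborel B :: ennreal)"
      by (simp add: B_def indicator_def unitary_norm_matrix[OF V])
    finally show ?thesis by (simp add: \<mu>0_def uniform_measure_def)
  qed
  define \<mu> where "\<mu> = distr \<mu>0 borel unitarization"
  have "is_haar \<mu>"
    unfolding is_haar_def
  proof (intro conjI allI impI)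
    show "prob_space \<mu>" unfolding \<mu>_def by (rule M.prob_space_distr) measurable
    show "sets \<mu> = sets borel" by (simp add: \<mu>_def)
    have "AE A in \<mu>0. det A \<noteq> 0"
      unfolding \<mu>0_def using AE_det_nonzero B by (intro AE_uniform_measureI) auto
    then have "AE A in \<mu>0. A \<in> unitarization -` {U. unitary_mat U}"
      by eventually_elim (simp add: unitary_unitarization)
    moreover have "unitarization -` {U. unitary_mat U} \<in> sets (borel :: (complex^'m^'m) measure)"
      using measurable_sets_borel[OF unitarization_measurable, of "{U. unitary_mat U}"] borel_closed[OF closed_unitary] by simp
    ultimately have "M.prob (unitarization -` {U. unitary_mat U}) = 1"
      by (subst M.AE_in_set_eq_1[symmetric]) auto
    then show "emeasure \<mu> {U. unitary_mat U} = 1"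
      unfolding \<mu>_def using borel_closed[OF closed_unitary] by (subst emeasure_distr) (auto simp: M.emeasure_eq_measure)
    fix V :: "complex^'m^'m" assume V: "unitary_mat V"
    have "distr \<mu> borel (\<lambda>U. V ** U) = distr \<mu>0 borel (\<lambda>A. V ** unitarization A)"
      unfolding \<mu>_def by (subst distr_distr) (auto simp: comp_def)
    also have "\<dots> = distr \<mu>0 borel (\<lambda>A. unitarization (V ** A))"
      by (simp add: unitarization_mult[OF V])
    also have "\<dots> = distr (distr \<mu>0 borel (\<lambda>A. V ** A)) borel unitarization"
      by (subst distr_distr) (auto simp: comp_def)
    finally show "distr \<mu> borel (\<lambda>U. V ** U) = \<mu>" by (simp add: inv[OF V] \<mu>_def)
  qed
  then show ?thesis ..
qed

lemma is_haar_haar_unitary: "is_haar haar_unitary"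
proof -
  have "haar_unitary = (THE \<mu>. is_haar \<mu>)"
    by (simp add: haar_unitary_def is_haar_def)
  then show ?thesis
    using exists_haar is_haar_unique by (metis theI)
qed

section \<open>The density of the squared singular values\<close>

text \<open>Up to a constant, the transition density from the spectrum \<open>x\<close> with
  \<open>M\<close> rows to the spectrum \<open>y\<close> with \<open>N\<close> rows. Natural powers
  of \<open>1 / x $ j\<close> stand for the negative powers and make the cancellation in
  compositions purely algebraic.\<close>

definition kern :: "nat \<Rightarrow> nat \<Rightarrow> real^'n::{finite,linorder} \<Rightarrow> real^'n::_ \<Rightarrow> real" where
  "kern M N x y = (\<Prod>j\<in>UNIV. (1 / x $ j) ^ (M - CARD('n))) * (\<Prod>j\<in>UNIV. (y $ j) ^ (N - CARD('n)))
     * det (\<chi> j k. pos_pow (x $ k - y $ j) (M - N - 1)) * vandermonde y / vandermonde x"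

definition nonneg_vecs :: "(real^'n) set" where
  "nonneg_vecs = {y. \<forall>j. 0 \<le> y $ j}"

lemma nonneg_vecs_borel [measurable]: "nonneg_vecs \<in> sets borel"
  unfolding nonneg_vecs_def by measurable

lemma pos_pow_measurable [measurable]: "(\<lambda>a. pos_pow a k) \<in> borel_measurable borel"
  unfolding pos_pow_def by measurable

lemma kern_measurable [measurable]: "kern M N x \<in> borel_measurable borel"
  unfolding kern_def det_def vec_lambda_beta by measurable

lemma kern_measurable_pair [measurable]: "(\<lambda>(x, y). kern M N x y) \<in> borel_measurable (borel \<Otimes>\<^sub>M borel)"
  unfolding kern_def det_def split_def vec_lambda_beta by measurable

lemma sum_square_sign: "of_int (sign p) * of_int (sign p) = (1 :: real)"
  by (simp flip: of_int_mult)

text \<open>The determinant and the Vandermonde factor both change by the sign of the permutation,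
  and the signs cancel.\<close>

lemma kern_permute_left:
  assumes "\<sigma> permutes UNIV"
  shows "kern M N (\<chi> i. x $ \<sigma> i) y = kern M N x y"
proof -
  have "det (\<chi> j k. pos_pow (x $ \<sigma> k - y $ j) (M - N - 1)) = of_int (sign \<sigma>) * det (\<chi> j k. pos_pow (x $ k - y $ j) (M - N - 1))"
    using det_permute_columns[OF assms, of "\<chi> j k. pos_pow (x $ k - y $ j) (M - N - 1)"] by simp
  moreover have "(\<Prod>j\<in>UNIV. (1 / x $ \<sigma> j) ^ (M - CARD('a))) = (\<Prod>j\<in>UNIV. (1 / x $ j) ^ (M - CARD('a)))"
    by (rule prod.reindex_bij_betw[OF permutes_imp_bij[OF assms]])
  ultimately show ?thesis
    by (cases \<sigma> rule: sign_cases) (simp_all add: kern_def vandermonde_permute[OF assms])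
qed

lemma kern_permute_right:
  assumes "\<sigma> permutes UNIV"
  shows "kern M N x (\<chi> i. y $ \<sigma> i) = kern M N x y"
proof -
  have "det (\<chi> j k. pos_pow (x $ k - y $ \<sigma> j) (M - N - 1)) = of_int (sign \<sigma>) * det (\<chi> j k. pos_pow (x $ k - y $ j) (M - N - 1))"
    using det_permute_rows[OF assms, of "\<chi> j k. pos_pow (x $ k - y $ j) (M - N - 1)"] by simp
  moreover have "(\<Prod>j\<in>UNIV. (y $ \<sigma> j) ^ (N - CARD('a))) = (\<Prod>j\<in>UNIV. (y $ j) ^ (N - CARD('a)))"
    by (rule prod.reindex_bij_betw[OF permutes_imp_bij[OF assms]])
  ultimately show ?thesis
    by (cases \<sigma> rule: sign_cases) (simp_all add: kern_def vandermonde_permute[OF assms])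
qed

section \<open>Andreief's identity and the composition of kernels\<close>

lemma has_bochner_integral_vec_prod:
  fixes h :: "'n::finite \<Rightarrow> real \<Rightarrow> real"
  assumes "\<And>i. integrable lborel (h i)"
  shows "has_bochner_integral lborel (\<lambda>y :: real^'n. \<Prod>i\<in>UNIV. h i (y $ i)) (\<Prod>i\<in>UNIV. integral\<^sup>L lborel (h i))"
proof -
  interpret product_sigma_finite "\<lambda>_::'n. lborel :: real measure" by standard
  have m: "(\<lambda>f. \<chi> i. f i) \<in> measurable (PiM UNIV (\<lambda>_::'n. lborel :: real measure)) borel"
    by (intro borel_measurable_vec_lambda) (auto intro: measurable_component_singleton)
  have [measurable]: "h i \<in> borel_measurable borel" for i
    using borel_measurable_integrable[OF assms[of i]] by simp
  have hm: "(\<lambda>y :: real^'n. \<Prod>i\<in>UNIV. h i (y $ i)) \<in> borel_measurable borel"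
    by measurable
  have "integrable (PiM UNIV (\<lambda>_. lborel)) (\<lambda>f. \<Prod>i\<in>UNIV. h i (f i))"
    by (rule product_integrable_prod) (auto simp: assms)
  moreover have "(\<integral>f. (\<Prod>i\<in>UNIV. h i (f i)) \<partial>PiM UNIV (\<lambda>_. lborel)) = (\<Prod>i\<in>UNIV. integral\<^sup>L lborel (h i))"
    by (rule product_integral_prod) (auto simp: assms)
  ultimately show ?thesis
    by (subst distr_PiM_lborel_vec[symmetric])
       (simp add: has_bochner_integral_iff integrable_distr_eq[OF m hm] integral_distr[OF m hm])
qed

text \<open>Both determinants are expanded and the integrals factorise over coordinates. For each
  \<open>\<tau>\<close> the sum over \<open>\<sigma>\<close> is the sign of \<open>\<tau>\<close>
  times the moment determinant with rows permuted by \<open>\<tau>\<close>; the n! choices of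
  \<open>\<tau>\<close> contribute equally.\<close>

lemma has_bochner_integral_andreief:
  fixes f g :: "'n::finite \<Rightarrow> real \<Rightarrow> real"
  assumes "\<And>j k. integrable lborel (\<lambda>y. f k y * g j y)"
  shows "has_bochner_integral lborel (\<lambda>y :: real^'n. det (\<chi> j k. f k (y $ j)) * det (\<chi> j k. g j (y $ k)))
    (fact CARD('n) * det (\<chi> j k. \<integral>y. f k y * g j y \<partial>lborel))"
proof -
  let ?P = "{p. p permutes (UNIV :: 'n set)}"
  define m where "m j k = (\<integral>y. f k y * g j y \<partial>lborel)" for j k
  have expand: "det (\<chi> j k. f k (y $ j)) * det (\<chi> j k. g j (y $ k))
    = (\<Sum>\<tau>\<in>?P. \<Sum>\<sigma>\<in>?P. of_int (sign \<sigma>) * of_int (sign \<tau>) * (\<Prod>i\<in>UNIV. f (\<sigma> i) (y $ i) * g (\<tau> i) (y $ i)))" for y :: "real^'n"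
  proof -
    have "det (\<chi> j k. g j (y $ k)) = det (\<chi> k j. g j (y $ k))"
      by (subst det_transpose[symmetric]) (simp add: transpose_def)
    then show ?thesis
      by (simp add: det_def sum_product prod.distrib mult_ac) (subst sum.swap, simp add: mult_ac)
  qed
  have "has_bochner_integral lborel (\<lambda>y :: real^'n. \<Sum>\<tau>\<in>?P. \<Sum>\<sigma>\<in>?P. of_int (sign \<sigma>) * of_int (sign \<tau>) * (\<Prod>i\<in>UNIV. f (\<sigma> i) (y $ i) * g (\<tau> i) (y $ i)))
    (\<Sum>\<tau>\<in>?P. \<Sum>\<sigma>\<in>?P. of_int (sign \<sigma>) * of_int (sign \<tau>) * (\<Prod>i\<in>UNIV. m (\<tau> i) (\<sigma> i)))"
    unfolding m_def
    by (intro has_bochner_integral_sum has_bochner_integral_mult_right has_bochner_integral_vec_prod assms)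
  also have "(\<Sum>\<tau>\<in>?P. \<Sum>\<sigma>\<in>?P. of_int (sign \<sigma>) * of_int (sign \<tau>) * (\<Prod>i\<in>UNIV. m (\<tau> i) (\<sigma> i))) = (\<Sum>\<tau>\<in>?P. det (\<chi> j k. m j k))"
  proof (intro sum.cong refl)
    fix \<tau> assume "\<tau> \<in> ?P"
    then have \<tau>: "\<tau> permutes UNIV" by simp
    have "(\<Sum>\<sigma>\<in>?P. of_int (sign \<sigma>) * of_int (sign \<tau>) * (\<Prod>i\<in>UNIV. m (\<tau> i) (\<sigma> i))) = of_int (sign \<tau>) * det (\<chi> i. (\<chi> j k. m j k) $ \<tau> i)"
      by (simp add: det_def sum_distrib_left mult_ac)
    also have "\<dots> = det (\<chi> j k. m j k)"
      unfolding det_permute_rows[OF \<tau>] by (simp add: mult.assoc[symmetric] sum_square_sign)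
    finally show "(\<Sum>\<sigma>\<in>?P. of_int (sign \<sigma>) * of_int (sign \<tau>) * (\<Prod>i\<in>UNIV. m (\<tau> i) (\<sigma> i))) = det (\<chi> j k. m j k)" .
  qed
  also have "\<dots> = fact CARD('n) * det (\<chi> j k. m j k)"
    by (simp add: card_permutations)
  finally show ?thesis by (simp add: expand m_def)
qed

text \<open>Convolution with a step function raises the degree of a truncated power by one;
  iterated, it turns the interlacing indicator into the determinant of higher truncated
  powers.\<close>

lemma has_bochner_integral_pos_pow:
  "has_bochner_integral lborel (\<lambda>y. pos_pow (a - y) p * pos_pow (y - b) 0) (pos_pow (a - b) (Suc p) / real (Suc p))"
proof (cases "b < a")
  case True
  have "has_bochner_integral lborel (\<lambda>y. (a - y) ^ p * indicator {b..a} y) (- ((a - a) ^ Suc p) / real (Suc p) - (- ((a - b) ^ Suc p) / real (Suc p)))"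
  proof (rule has_bochner_integral_FTC_Icc_real)
    show "((\<lambda>y. - ((a - y) ^ Suc p) / real (Suc p)) has_real_derivative (a - y) ^ p) (at y)" for y
      by (rule derivative_eq_intros refl | simp)+
  qed (use True in \<open>auto intro!: continuous_intros\<close>)
  \<comment> \<open>The endpoints are excluded because \<open>pos_pow\<close> vanishes at 0 even for
    exponent 0, unlike the indicator of the closed interval.\<close>
  moreover have "AE y in lborel. (a - y) ^ p * indicator {b..a} y = pos_pow (a - y) p * pos_pow (y - b) 0"
    using AE_lborel_singleton[of a] AE_lborel_singleton[of b]
    by eventually_elim (auto simp: pos_pow_def indicator_def)
  ultimately show ?thesis
    using True by (subst (asm) has_bochner_integral_cong_AE) (auto simp: pos_pow_def)
next
  case False
  then have 1: "(\<lambda>y. pos_pow (a - y) p * pos_pow (y - b) 0) = (\<lambda>_. 0)"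
    by (auto simp: pos_pow_def fun_eq_iff)
  have 2: "pos_pow (a - b) (Suc p) / real (Suc p) = 0"
    using False by (simp add: pos_pow_def)
  show ?thesis unfolding 1 2 by (rule has_bochner_integral_zero)
qed

definition pos_distinct :: "real^'n \<Rightarrow> bool" where
  "pos_distinct x \<longleftrightarrow> (\<forall>i. 0 < x $ i) \<and> (\<forall>i j. i \<noteq> j \<longrightarrow> x $ i \<noteq> x $ j)"

lemma AE_distinct: "AE y in lborel. \<forall>i j. i \<noteq> j \<longrightarrow> (y :: real^'n) $ i \<noteq> y $ j"
proof -
  have "AE y in lborel. \<forall>i\<in>UNIV. \<forall>j\<in>UNIV. i \<noteq> j \<longrightarrow> (y :: real^'n) $ i \<noteq> y $ j"
    by (intro AE_finite_allI) (auto intro: AE_lborel_vec_nth_neq)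
  then show ?thesis by simp
qed

lemma AE_nth_neq_consts: "AE y in lborel. \<forall>i. (y :: real^'n) $ i \<noteq> c"
proof -
  have "AE y in lborel. \<forall>i\<in>UNIV. (y :: real^'n) $ i \<noteq> c"
    by (intro AE_finite_allI AE_lborel_vec_nth_neq_const) auto
  then show ?thesis by simp
qed

lemma AE_pos_distinct: "AE y in lborel. y \<in> nonneg_vecs \<longrightarrow> pos_distinct (y :: real^'n)"
  using AE_distinct AE_nth_neq_consts[of 0]
  by eventually_elim (auto simp: pos_distinct_def nonneg_vecs_def order_le_less)

lemma pos_distinct_permute:
  assumes "\<sigma> permutes UNIV"
  shows "pos_distinct (\<chi> i. y $ \<sigma> i) \<longleftrightarrow> pos_distinct y"
proof -
  have "bij \<sigma>" by (rule permutes_imp_bij[OF assms])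
  then show ?thesis
    by (auto simp: pos_distinct_def bij_def surj_def) (metis injD)+
qed

lemma nonneg_vecs_permute:
  assumes "\<sigma> permutes UNIV"
  shows "(\<chi> i. y $ \<sigma> i) \<in> nonneg_vecs \<longleftrightarrow> y \<in> nonneg_vecs"
proof -
  have "surj \<sigma>" by (rule permutes_surj[OF assms])
  then show ?thesis by (auto simp: nonneg_vecs_def surj_def) (metis)
qed

text \<open>Both arguments can be sorted without changing the kernel. Then the Vandermonde factors
  have no negative sign and the determinant is the interlacing indicator.\<close>

lemma kern_step_nonneg:
  assumes x: "pos_distinct x" and y: "y \<in> nonneg_vecs"
  shows "0 \<le> kern N (N - 1) x y"
proof -
  obtain \<sigma> where \<sigma>: "\<sigma> permutes UNIV" "(\<chi> i. x $ \<sigma> i) \<in> sorted_vecs" by (rule exists_sorting_permutation)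
  obtain \<tau> where \<tau>: "\<tau> permutes UNIV" "(\<chi> i. y $ \<tau> i) \<in> sorted_vecs" by (rule exists_sorting_permutation)
  define a b where "a = (\<chi> i. x $ \<sigma> i)" and "b = (\<chi> i. y $ \<tau> i)"
  have kern: "kern N (N - 1) x y = kern N (N - 1) a b"
    by (simp add: a_def b_def kern_permute_left[OF \<sigma>(1)] kern_permute_right[OF \<tau>(1)])
  have "pos_distinct a" using x \<sigma> by (simp add: a_def pos_distinct_permute)
  then have a: "\<And>i. 0 < a $ i" "\<And>i j. i < j \<Longrightarrow> a $ i < a $ j"
    using \<sigma>(2) unfolding a_def[symmetric] by (auto simp: pos_distinct_def sorted_vecs_def order_le_less)
  have b: "b \<in> nonneg_vecs" using y \<tau> by (simp add: b_def nonneg_vecs_permute)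
  show ?thesis
  proof (cases "vandermonde b = 0")
    case True
    then show ?thesis unfolding kern by (simp add: kern_def)
  next
    case False
    have b': "b $ i < b $ j" if "i < j" for i j
    proof -
      have "i \<noteq> j" using that by simp
      then have "b $ i \<noteq> b $ j" using False by (auto simp: vandermonde_eq_0_iff)
      moreover have "b $ i \<le> b $ j" using \<tau>(2) that unfolding b_def[symmetric] by (simp add: sorted_vecs_def)
      ultimately show ?thesis by simp
    qed
    have "N - (N - 1) - 1 = 0" by simp
    moreover have "0 \<le> det (\<chi> j k. pos_pow (a $ k - b $ j) 0)"
      using det_step_interlace[of a b] a b' by simp
    ultimately show ?thesis
      unfolding kern unfolding kern_def using a b vandermonde_pos[of a] vandermonde_pos[of b] b'
      by (intro divide_nonneg_pos mult_nonneg_nonneg prod_nonneg) (auto simp: less_imp_le nonneg_vecs_def)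
  qed
qed

text \<open>Almost everywhere all factors in the middle variable cancel except two determinants, to
  which Andreief's identity applies. Nonnegativity comes along, since a positive multiple of the new
  kernel is the integral of a nonnegative function.\<close>

lemma kern_compose:
  fixes x z :: "real^'n::{finite,linorder}"
  assumes N: "CARD('n) < N" "N < M"
    and x: "pos_distinct x" and z: "z \<in> nonneg_vecs"
    and nonneg: "\<And>y. y \<in> nonneg_vecs \<Longrightarrow> 0 \<le> kern M N x y"
  shows "0 \<le> kern M (N - 1) x z"
    and "(\<integral>\<^sup>+y. ennreal (kern M N x y) * ennreal (kern N (N - 1) y z) * indicator nonneg_vecs y \<partial>lborel)
      = ennreal (fact CARD('n) / real (M - N) ^ CARD('n)) * ennreal (kern M (N - 1) x z)"
proof -
  define p where "p = M - N - 1"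
  have p: "M - N = Suc p" using N by (simp add: p_def)
  let ?d = "\<lambda>y :: real^'n::_. det (\<chi> j k. pos_pow (x $ k - y $ j) p) * det (\<chi> j k. pos_pow (y $ k - z $ j) 0)"
  define c where "c = (\<Prod>j\<in>UNIV. (1 / x $ j) ^ (M - CARD('n))) * (\<Prod>j\<in>UNIV. (z $ j) ^ (N - 1 - CARD('n))) * vandermonde z / vandermonde x"
  define G where "G y = kern M N x y * kern N (N - 1) y z * indicator nonneg_vecs y" for y
  have [measurable]: "G \<in> borel_measurable borel"
  proof -
    have "(\<lambda>y. kern N (N - 1) y z) \<in> borel_measurable borel"
      unfolding kern_def det_def vec_lambda_beta by measurable
    then show ?thesis unfolding G_def by measurable
  qed
  have Gd: "AE y in lborel. c * ?d y = G y"
    using AE_pos_distinct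
  proof eventually_elim
    case (elim y)
    show ?case
    proof (cases "y \<in> nonneg_vecs")
      case True
      then have y: "pos_distinct y" using elim by simp
      have v: "vandermonde y \<noteq> 0" using y by (auto simp: vandermonde_eq_0_iff pos_distinct_def)
      have "(\<Prod>j\<in>UNIV. (y $ j) ^ (N - CARD('n))) * (\<Prod>j\<in>UNIV. (1 / y $ j) ^ (N - CARD('n))) = 1"
        using y unfolding prod.distrib[symmetric] power_mult_distrib[symmetric]
        by (intro prod.neutral) (auto simp: pos_distinct_def dual_order.strict_implies_not_eq)
      moreover have "A * Y * D * v / vx * (Y' * B * D' * vz / v) = Y * Y' * (A * B * vz / vx) * (D * D') * (v / v)"
        for A Y D v vx Y' B D' vz :: real
        by (simp add: divide_inverse mult_ac)
      moreover have "N - (N - 1) - 1 = 0" by simp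
      ultimately have "kern M N x y * kern N (N - 1) y z = 1 * c * ?d y * (vandermonde y / vandermonde y)"
        by (simp only: kern_def c_def p_def)
      then show ?thesis using True v by (simp add: G_def)
    next
      case False
      \<comment> \<open>The restriction to nonnegative \<open>y\<close> is automatic: for
        nonnegative \<open>z\<close>, a negative entry of \<open>y\<close> annihilates a column of
        the step matrix. The whole-space identity therefore suffices.\<close>
      then obtain k where "y $ k < 0" by (auto simp: nonneg_vecs_def not_le)
      then have "column k (\<chi> j k. pos_pow (y $ k - z $ j) 0) = 0"
        using z by (auto simp: column_def vec_eq_iff pos_pow_def nonneg_vecs_def not_less intro: order_trans[OF less_imp_le])
      then have "det (\<chi> j k. pos_pow (y $ k - z $ j) 0) = 0" by (rule det_zero_column)
      then show ?thesis using False by (simp add: G_def)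
    qed
  qed
  have int: "has_bochner_integral lborel (\<lambda>y. c * ?d y)
     (c * (fact CARD('n) * det (\<chi> j k. \<integral>y. pos_pow (x $ k - y) p * pos_pow (y - z $ j) 0 \<partial>lborel)))"
    using has_bochner_integral_pos_pow
    by (intro has_bochner_integral_mult_right has_bochner_integral_andreief) (auto simp: has_bochner_integral_iff)
  \<comment> \<open>Each of the n rows yields a factor \<open>1 / Suc p\<close>, and
    \<open>Suc p = M - N\<close>; this is the power in the constant.\<close>
  have "(\<integral>y. pos_pow (x $ k - y) p * pos_pow (y - z $ j) 0 \<partial>lborel) = 1 / real (Suc p) * pos_pow (x $ k - z $ j) (Suc p)" for j k
    using has_bochner_integral_pos_pow[of "x $ k" p "z $ j"] by (simp add: has_bochner_integral_iff)
  then have "(\<chi> j k. \<integral>y. pos_pow (x $ k - y) p * pos_pow (y - z $ j) 0 \<partial>lborel)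
    = (\<chi> j. (1 / real (Suc p)) *s (\<chi> k. pos_pow (x $ k - z $ j) (Suc p)))"
    by (simp add: vec_eq_iff)
  then have "det (\<chi> j k. \<integral>y. pos_pow (x $ k - y) p * pos_pow (y - z $ j) 0 \<partial>lborel)
    = (1 / real (Suc p)) ^ CARD('n) * det (\<chi> j k. pos_pow (x $ k - z $ j) (Suc p))"
    by (simp only: det_rows_mul) simp
  moreover have "M - (N - 1) - 1 = Suc p" using N by (simp add: p_def)
  ultimately have val: "c * (fact CARD('n) * det (\<chi> j k. \<integral>y. pos_pow (x $ k - y) p * pos_pow (y - z $ j) 0 \<partial>lborel))
     = fact CARD('n) / real (M - N) ^ CARD('n) * kern M (N - 1) x z"
    unfolding p kern_def c_def by (simp add: power_divide mult_ac)
  have G: "has_bochner_integral lborel G (fact CARD('n) / real (M - N) ^ CARD('n) * kern M (N - 1) x z)"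
  proof -
    have "(\<lambda>y. c * ?d y) \<in> borel_measurable lborel"
      using int by (simp only: has_bochner_integral_iff borel_measurable_integrable)
    from has_bochner_integral_cong_AE[OF this _ Gd] int show ?thesis
      unfolding val by simp
  qed
  have Gnn: "AE y in lborel. 0 \<le> G y"
    using AE_pos_distinct
    by eventually_elim (auto simp: G_def indicator_def intro!: mult_nonneg_nonneg nonneg kern_step_nonneg[OF _ z, unfolded One_nat_def])
  then have nn: "0 \<le> fact CARD('n) / real (M - N) ^ CARD('n) * kern M (N - 1) x z"
    using G integral_nonneg_AE[OF Gnn] by (simp only: has_bochner_integral_iff)
  have f: "fact CARD('n) / real (M - N) ^ CARD('n) > 0" using N by simp
  show "0 \<le> kern M (N - 1) x z"
  proof (rule ccontr)
    assume "\<not> ?thesis"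
    then have "fact CARD('n) / real (M - N) ^ CARD('n) * kern M (N - 1) x z < 0"
      by (intro mult_pos_neg f) simp
    with nn show False by simp
  qed
  have "(\<integral>\<^sup>+y. ennreal (kern M N x y) * ennreal (kern N (N - 1) y z) * indicator nonneg_vecs y \<partial>lborel) = (\<integral>\<^sup>+y. ennreal (G y) \<partial>lborel)"
    by (intro nn_integral_cong) (simp add: G_def indicator_def ennreal_mult' nonneg)
  also have "\<dots> = ennreal (fact CARD('n) / real (M - N) ^ CARD('n) * kern M (N - 1) x z)"
    using nn_integral_eq_integral[OF _ Gnn] G by (simp only: has_bochner_integral_iff)
  finally show "(\<integral>\<^sup>+y. ennreal (kern M N x y) * ennreal (kern N (N - 1) y z) * indicator nonneg_vecs y \<partial>lborel)
      = ennreal (fact CARD('n) / real (M - N) ^ CARD('n)) * ennreal (kern M (N - 1) x z)"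
    using f by (simp only: ennreal_mult' less_imp_le)
qed

text \<open>Downward induction on the number of remaining rows: a single removal gives an indicator,
  and each further one is a composition with a one-step kernel.\<close>

lemma kern_nonneg:
  fixes x y :: "real^'n::{finite,linorder}"
  assumes x: "pos_distinct x" and N: "CARD('n) \<le> N" "N < M" and y: "y \<in> nonneg_vecs"
  shows "0 \<le> kern M N x y"
proof -
  have "N \<le> M - 1" using N by simp
  then have "\<forall>y\<in>nonneg_vecs. 0 \<le> kern M N x y"
  proof (induction rule: inc_induct)
    case base
    show ?case using kern_step_nonneg[OF x] by blast
  next
    case (step k)
    then show ?case
      using kern_compose(1)[of "Suc k" M x] x N by auto
  qed
  then show ?thesis using y by blast
qed

section \<open>The one-step kernel as the law of perturbed roots\<close>

lemma nn_integral_symmetric: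
  fixes F :: "real^'n::{finite,linorder} \<Rightarrow> ennreal"
  assumes F[measurable]: "F \<in> borel_measurable borel" and sym: "symmetric F"
  shows "(\<integral>\<^sup>+y. F y \<partial>lborel) = fact CARD('n) * (\<integral>\<^sup>+y. F y * indicator sorted_vecs y \<partial>lborel)"
proof -
  let ?P = "{\<sigma>. \<sigma> permutes (UNIV :: 'n set)}"
  let ?p = "\<lambda>\<sigma> (y :: real^'n::_). (\<chi> i. y $ \<sigma> i)"
  have [measurable]: "sorted_vecs \<in> sets (borel :: (real^'n::_) measure)"
    by (rule borel_closed[OF closed_sorted_vecs])
  have pm[measurable]: "?p \<sigma> \<in> borel_measurable borel" for \<sigma>
    by (intro borel_measurable_vec_lambda borel_measurable_vec_nth)
  have "(\<integral>\<^sup>+y. F y \<partial>lborel) = (\<integral>\<^sup>+y. (\<Sum>\<sigma>\<in>?P. F (?p \<sigma> y) * indicator sorted_vecs (?p \<sigma> y)) \<partial>lborel)"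
  proof (rule nn_integral_cong_AE)
    show "AE y in lborel. F y = (\<Sum>\<sigma>\<in>?P. F (?p \<sigma> y) * indicator sorted_vecs (?p \<sigma> y))"
      using AE_distinct
    proof eventually_elim
      case (elim y)
      obtain \<sigma> where \<sigma>: "\<sigma> permutes UNIV" "?p \<sigma> y \<in> sorted_vecs" by (rule exists_sorting_permutation)
      \<comment> \<open>Distinct entries have only one sorting permutation, so almost every point
        lies in exactly one of the n! chambers.\<close>
      have uniq: "\<tau> = \<sigma>" if \<tau>: "\<tau> permutes UNIV" "?p \<tau> y \<in> sorted_vecs" for \<tau>
      proof -
        have "rpoly (?p \<tau> y) = rpoly (?p \<sigma> y)" using \<tau> \<sigma> by (simp add: rpoly_permute)
        then have "?p \<tau> y = ?p \<sigma> y" using \<tau> \<sigma> inj_on_rpoly_sorted by (auto dest: inj_onD)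
        then have "y $ \<tau> i = y $ \<sigma> i" for i by (simp add: vec_eq_iff)
        then show ?thesis using elim by (auto simp: fun_eq_iff)
      qed
      have "(\<Sum>\<tau>\<in>?P. F (?p \<tau> y) * indicator sorted_vecs (?p \<tau> y)) = (\<Sum>\<tau>\<in>{\<sigma>}. F (?p \<tau> y) * indicator sorted_vecs (?p \<tau> y))"
        using \<sigma>(1) uniq by (intro sum.mono_neutral_right) (auto simp: finite_permutations indicator_def)
      also have "\<dots> = F y" using \<sigma> sym by (simp add: symmetric_def)
      finally show ?case ..
    qed
  qed
  also have "\<dots> = (\<Sum>\<sigma>\<in>?P. \<integral>\<^sup>+y. F (?p \<sigma> y) * indicator sorted_vecs (?p \<sigma> y) \<partial>lborel)"
    by (rule nn_integral_sum) measurable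
  also have "\<dots> = (\<Sum>\<sigma>\<in>?P. \<integral>\<^sup>+y. F y * indicator sorted_vecs y \<partial>lborel)"
  proof (intro sum.cong refl)
    fix \<sigma> assume "\<sigma> \<in> ?P"
    then have "bij \<sigma>" by (simp add: permutes_bij)
    have "(\<integral>\<^sup>+y. F (?p \<sigma> y) * indicator sorted_vecs (?p \<sigma> y) \<partial>lborel) = (\<integral>\<^sup>+y. F y * indicator sorted_vecs y \<partial>distr lborel borel (?p \<sigma>))"
      by (subst nn_integral_distr) auto
    then show "(\<integral>\<^sup>+y. F (?p \<sigma> y) * indicator sorted_vecs (?p \<sigma> y) \<partial>lborel) = (\<integral>\<^sup>+y. F y * indicator sorted_vecs y \<partial>lborel)"
      by (simp add: distr_lborel_reindex[OF \<open>bij \<sigma>\<close>])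
  qed
  also have "\<dots> = fact CARD('n) * (\<integral>\<^sup>+y. F y * indicator sorted_vecs y \<partial>lborel)"
    by (simp add: card_permutations)
  finally show ?thesis .
qed

lemma continuous_on_coeff_pert_poly: "continuous_on A (\<lambda>p :: real^'n. coeff (pert_poly x p))"
proof (rule continuous_on_coordinatewise_then_product)
  show "continuous_on A (\<lambda>p :: real^'n. coeff (pert_poly x p) k)" for k
    by (simp add: pert_poly_def coeff_sum) (intro continuous_intros)
qed

text \<open>On sorted vectors the one-step kernel is the Dirichlet density transported by
  \<open>root_weights\<close>: the last weight gives powers of \<open>y\<close> and
  \<open>x\<close>, the Jacobian the Vandermonde quotient, the determinant the indicator of the
  interlacing region. The factor n! accounts for the orderings of \<open>y\<close>.\<close>

lemma nn_integral_kern_step_sorted: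
  fixes x :: "real^'n::{finite,linorder}"
  assumes x: "\<And>i j. i < j \<Longrightarrow> x $ i < x $ j" "\<And>i. 0 < x $ i" and N: "CARD('n) < N"
    and \<Phi>[measurable]: "\<Phi> \<in> borel_measurable borel"
  shows "(\<integral>\<^sup>+y. \<Phi> (coeff (rpoly y)) * ennreal (kern N (N - 1) x y) * indicator nonneg_vecs y \<partial>lborel)
    = fact CARD('n) * (\<integral>\<^sup>+p. \<Phi> (coeff (pert_poly x p)) * ennreal ((1 - (\<Sum>i\<in>UNIV. p $ i)) ^ (N - CARD('n) - 1)) * indicator open_simplex p \<partial>lborel)"
proof -
  have x': "\<And>i j. i \<noteq> j \<Longrightarrow> x $ i \<noteq> x $ j" "\<And>i. x $ i \<noteq> 0"
    using x by (metis linorder_neqE order_less_irrefl)+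
  have rm[measurable]: "(\<lambda>y :: real^'n::_. coeff (rpoly y)) \<in> borel_measurable borel"
    by (intro borel_measurable_continuous_onI continuous_on_coeff_rpoly)
  have pm[measurable]: "(\<lambda>p. coeff (pert_poly x p)) \<in> borel_measurable borel"
    by (intro borel_measurable_continuous_onI continuous_on_coeff_pert_poly)
  define F where "F y = \<Phi> (coeff (rpoly y)) * ennreal (kern N (N - 1) x y) * indicator nonneg_vecs y" for y
  define k where "k = N - CARD('n) - 1"
  have k: "N - CARD('n) = Suc k" "N - 1 - CARD('n) = k" "N - (N - 1) - 1 = 0" using N by (auto simp: k_def)
  have [measurable]: "F \<in> borel_measurable borel"
    unfolding F_def by measurable
  have "symmetric F"
    by (auto simp: symmetric_def F_def rpoly_permute kern_permute_right nonneg_vecs_permute indicator_def)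
  then have "(\<integral>\<^sup>+y. F y \<partial>lborel) = fact CARD('n) * (\<integral>\<^sup>+y. F y * indicator sorted_vecs y \<partial>lborel)"
    by (intro nn_integral_symmetric) auto
  also have "(\<integral>\<^sup>+y. F y * indicator sorted_vecs y \<partial>lborel)
    = (\<integral>\<^sup>+y. \<Phi> (coeff (pert_poly x (root_weights x y))) * ennreal ((1 - (\<Sum>i\<in>UNIV. root_weights x y $ i)) ^ k)
        * ennreal (\<bar>vandermonde y\<bar> / ((\<Prod>i\<in>UNIV. x $ i) * \<bar>vandermonde x\<bar>)) * indicator (inter_box x) y \<partial>lborel)"
  proof (rule nn_integral_cong_AE)
    \<comment> \<open>\<open>interlace\<close> admits equalities between \<open>x\<close> and
      \<open>y\<close> that \<open>inter_box\<close> excludes; they form a null set.\<close>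
    have "AE y in lborel. \<forall>i\<in>UNIV. \<forall>j. (y :: real^'n::_) $ j \<noteq> x $ i"
      by (intro AE_finite_allI AE_nth_neq_consts) auto
    with AE_distinct AE_nth_neq_consts[of 0]
    show "AE y in lborel. F y * indicator sorted_vecs y = \<Phi> (coeff (pert_poly x (root_weights x y))) * ennreal ((1 - (\<Sum>i\<in>UNIV. root_weights x y $ i)) ^ k)
        * ennreal (\<bar>vandermonde y\<bar> / ((\<Prod>i\<in>UNIV. x $ i) * \<bar>vandermonde x\<bar>)) * indicator (inter_box x) y"
    proof eventually_elim
      case (elim y)
      show ?case
      proof (cases "y \<in> sorted_vecs \<and> y \<in> nonneg_vecs")
        case False
        moreover have "y \<in> inter_box x \<Longrightarrow> y \<in> sorted_vecs \<and> y \<in> nonneg_vecs"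
          using inter_box_sorted by (auto simp: inter_box_def nonneg_vecs_def less_imp_le)
        ultimately show ?thesis by (auto simp: F_def indicator_def)
      next
        case True
        have y: "y $ i < y $ j" if "i < j" for i j
        proof -
          have "y $ i \<noteq> y $ j" using elim that by auto
          moreover have "y $ i \<le> y $ j" using True that by (simp add: sorted_vecs_def)
          ultimately show ?thesis by simp
        qed
        have y0: "0 < y $ i" for i using True elim by (auto simp: nonneg_vecs_def order_le_less)
        have yx: "y $ j \<noteq> x $ i" for i j using elim by auto
        have box: "interlace x y \<longleftrightarrow> y \<in> inter_box x"
        proof -
          have "x $ k \<le> y $ j \<longleftrightarrow> x $ k < y $ j" for j k using yx by (metis order_le_less)
          then show ?thesis using y0 by (auto simp: interlace_def inter_box_def)
        qed
        have vx: "0 < vandermonde x" and vy: "0 < vandermonde y"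
          using x y by (auto intro: vandermonde_pos)
        have det: "det (\<chi> j k. pos_pow (x $ k - y $ j) 0) = (if y \<in> inter_box x then 1 else 0)"
          using det_step_interlace[of x y] x(1) y by (simp add: box)
        show ?thesis
        proof (cases "y \<in> inter_box x")
          case False
          then show ?thesis by (simp add: F_def kern_def k det)
        next
          case inb: True
          have "pert_poly x (root_weights x y) = rpoly y"
            using pert_poly_eq_rpoly_iff[OF x'] by simp
          moreover have "kern N (N - 1) x y = (1 - (\<Sum>i\<in>UNIV. root_weights x y $ i)) ^ k * (\<bar>vandermonde y\<bar> / ((\<Prod>i\<in>UNIV. x $ i) * \<bar>vandermonde x\<bar>))"
          proof -
            \<comment> \<open>Of the \<open>Suc k\<close> powers of \<open>1 / x $ j\<close>,
              \<open>k\<close> belong to the Dirichlet weight and one to the Jacobian.\<close>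
            have "(\<Prod>j\<in>UNIV. (1 / x $ j) ^ Suc k) = 1 / ((\<Prod>i\<in>UNIV. x $ i) ^ k * (\<Prod>i\<in>UNIV. x $ i))"
              by (simp add: prod_dividef prod_power_distrib power_one_over prod.distrib field_simps)
            moreover have "1 - (\<Sum>i\<in>UNIV. root_weights x y $ i) = (\<Prod>i\<in>UNIV. y $ i) / (\<Prod>i\<in>UNIV. x $ i)"
              using x' by (intro one_minus_sum_root_weights)
            ultimately show ?thesis
              using inb vx vy unfolding kern_def k det by (simp add: power_divide prod_power_distrib)
          qed
          moreover have "0 \<le> (1 - (\<Sum>i\<in>UNIV. root_weights x y $ i)) ^ k"
          proof -
            have "root_weights x y \<in> open_simplex" using root_weights_image[OF x] inb by blast
            then show ?thesis by (simp add: open_simplex_def)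
          qed
          ultimately show ?thesis
            using True inb by (simp add: F_def mult.assoc flip: ennreal_mult')
        qed
      qed
    qed
  qed
  also have "\<dots> = (\<integral>\<^sup>+p. \<Phi> (coeff (pert_poly x p)) * ennreal ((1 - (\<Sum>i\<in>UNIV. p $ i)) ^ k) * indicator open_simplex p \<partial>lborel)"
    using x by (intro nn_integral_root_weights[symmetric]) auto
  finally show ?thesis by (simp add: F_def k_def)
qed

definition weights_of :: "'m set \<Rightarrow> ('n \<Rightarrow> 'm) \<Rightarrow> complex^'m \<Rightarrow> real^'n" where
  "weights_of R f z = (\<chi> i. (cmod (z $ f i))\<^sup>2 / (\<Sum>j\<in>R. (cmod (z $ j))\<^sup>2))"

lemma nn_integral_gauss_weights:
  fixes f :: "'n::finite \<Rightarrow> 'm::finite"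
  assumes f: "inj f" and R: "range f \<subset> R"
    and \<Psi>[measurable]: "\<Psi> \<in> borel_measurable borel"
  shows "(\<integral>\<^sup>+z. \<Psi> (weights_of R f z) \<partial>gauss_vec)
    = ennreal (fact (card R - 1) / fact (card R - CARD('n) - 1)) *
      (\<integral>\<^sup>+p. \<Psi> p * ennreal ((1 - (\<Sum>i\<in>UNIV. p $ i)) ^ (card R - CARD('n) - 1)) * indicator open_simplex p \<partial>lborel)"
proof -
  have "(\<lambda>e. \<chi> i. e (f i) / (\<Sum>j\<in>R. e j)) \<in> borel_measurable (PiM (UNIV::'m set) (\<lambda>_. borel :: real measure))"
    by (intro borel_measurable_vec_lambda) measurable
  then have "(\<lambda>e. \<Psi> (\<chi> i. e (f i) / (\<Sum>j\<in>R. e j))) \<in> borel_measurable (PiM (UNIV::'m set) (\<lambda>_. borel :: real measure))"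
    by measurable
  from nn_integral_gauss_vec_cmod_sq[OF this] show ?thesis
    by (simp add: weights_of_def nn_integral_dirichlet[OF f R \<Psi>])
qed

section \<open>Removing one row\<close>

definition ctrans :: "complex^'n^'m \<Rightarrow> complex^'m^'n" where
  "ctrans Y = (\<chi> k i. cnj (Y $ i $ k))"

text \<open>Writing row selection as a form \<open>Y\<^sup>* P Y\<close> allows the selecting
  projection \<open>P\<close> to be rotated while \<open>Y\<close> is kept.\<close>

definition herm_form :: "complex^'m^'m \<Rightarrow> complex^'n^'m \<Rightarrow> complex^'n^'n" where
  "herm_form P Y = ctrans Y ** P ** Y"

definition restr_mat :: "'m set \<Rightarrow> complex^'m^'m" where
  "restr_mat R = (\<chi> i j. if i = j \<and> i \<in> R then 1 else 0)"

definition sq_sum :: "'m set \<Rightarrow> complex^'m \<Rightarrow> real" where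
  "sq_sum R z = (\<Sum>j\<in>R. (cmod (z $ j))\<^sup>2)"

text \<open>The orthogonal projection, inside the coordinate subspace of \<open>R\<close>, along the restriction of
  \<open>cnj z\<close> to \<open>R\<close> (with junk value \<open>restr_mat R\<close> if that restriction vanishes).\<close>
definition drop_mat :: "'m set \<Rightarrow> complex^'m \<Rightarrow> complex^'m^'m" where
  "drop_mat R z = (\<chi> i j. restr_mat R $ i $ j - (if i \<in> R \<and> j \<in> R then cnj (z $ i) * z $ j / of_real (sq_sum R z) else 0))"

lemma herm_form_mult: "herm_form P (Y ** W) = cadj W ** herm_form P Y ** W"
proof -
  have "ctrans (Y ** W) = cadj W ** ctrans Y"
    by (simp add: ctrans_def cadj_def matrix_matrix_mult_def vec_eq_iff mult_ac)
  then show ?thesis by (simp add: herm_form_def matrix_mul_assoc)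
qed

lemma herm_form_mult_left: "herm_form P (V ** Y) = herm_form (cadj V ** P ** V) Y"
proof -
  have "ctrans (V ** Y) = ctrans Y ** cadj V"
    by (simp add: ctrans_def cadj_def matrix_matrix_mult_def vec_eq_iff mult_ac)
  then show ?thesis by (simp add: herm_form_def matrix_mul_assoc)
qed

lemma gram_eq_herm_form: "gram R Y = herm_form (restr_mat R) Y"
proof -
  have "restr_mat R ** Y = (\<chi> i k. if i \<in> R then Y $ i $ k else 0)"
    by (auto simp: restr_mat_def matrix_matrix_mult_def vec_eq_iff if_distrib[where f="\<lambda>a. a * _"] cong: if_cong)
  then show ?thesis
    by (simp add: herm_form_def matrix_mul_assoc[symmetric])
       (simp add: matrix_matrix_mult_def vec_eq_iff ctrans_def gram_def if_distrib[where f="\<lambda>a. _ * a"] sum.If_cases cong: if_cong)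
qed

lemma cadj_gram [simp]: "cadj (gram R Y) = gram R Y"
  by (simp add: cadj_def gram_def vec_eq_iff mult.commute)

lemma gram_UNIV_unitary: "unitary_mat U \<Longrightarrow> gram UNIV (U ** X) = gram UNIV X"
proof -
  assume "unitary_mat U"
  moreover have "restr_mat UNIV = (mat 1 :: complex^'a^'a)"
    by (simp add: restr_mat_def mat_def)
  ultimately show ?thesis
    by (simp add: gram_eq_herm_form herm_form_mult_left unitary_mat_def)
qed

text \<open>The unit vector along the conjugate of \<open>z\<close> on \<open>R\<close> is completed
  to a unitary, whose adjoint sends it to the coordinate vector of \<open>r\<close>. Deleting
  coordinate \<open>r\<close> after that rotation is the projection along the vector.\<close>

lemma drop_mat_eq_unitary_conj:
  assumes r: "r \<in> R" and z: "sq_sum R z \<noteq> 0"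
  obtains V where "unitary_mat V" "drop_mat R z = cadj V ** restr_mat (R - {r}) ** V"
proof -
  define s where "s = sqrt (sq_sum R z)"
  have s: "s > 0" "s * s = sq_sum R z"
  proof -
    have "0 \<le> sq_sum R z" by (simp add: sq_sum_def sum_nonneg)
    with z show "s > 0" "s * s = sq_sum R z" by (simp_all add: s_def)
  qed
  define w where "w = (\<chi> j. if j \<in> R then cnj (z $ j) / of_real s else 0)"
  have "cdot w w = (\<Sum>j\<in>R. z $ j * cnj (z $ j)) / (of_real s * of_real s)"
    by (simp add: cdot_def w_def if_distrib[where f="\<lambda>a. a * _"] if_distrib[where f=cnj] sum.If_cases sum_divide_distrib cong: if_cong)
  also have "(\<Sum>j\<in>R. z $ j * cnj (z $ j)) = of_real (sq_sum R z)"
    by (simp only: sq_sum_def of_real_sum complex_norm_square)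
  finally have ww: "cdot w w = 1" using s z by (simp flip: of_real_mult)
  obtain V0 where V0: "unitary_mat V0" "\<And>i. i \<in> {r} \<Longrightarrow> column i V0 = w"
    "\<And>i j. i \<notin> R \<or> j \<notin> R \<Longrightarrow> V0 $ i $ j = (if i = j then 1 else 0)"
    by (rule exists_unitary_extension[of "{r}" R "\<lambda>_. w"]) (use r ww in \<open>auto simp: w_def\<close>)
  define V where "V = cadj V0"
  have V: "unitary_mat V" using V0(1) by (simp add: V_def unitary_cadj)
  have Vr: "V $ r $ j = (if j \<in> R then z $ j / of_real s else 0)" for j
  proof -
    have "V0 $ j $ r = w $ j" using V0(2)[of r] by (simp add: column_def vec_eq_iff)
    then show ?thesis by (simp add: V_def cadj_def w_def)
  qed
  have Vo: "V $ i $ j = (if i = j then 1 else 0)" if "i \<notin> R \<or> j \<notin> R" for i j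
    using V0(3)[of j i] that by (auto simp: V_def cadj_def)
  have "(cadj V ** restr_mat (R - {r}) ** V) $ j $ k = drop_mat R z $ j $ k" for j k
  proof -
    have RV: "restr_mat (R - {r}) ** V = (\<chi> i k. if i \<in> R - {r} then V $ i $ k else 0)"
      by (auto simp: restr_mat_def matrix_matrix_mult_def vec_eq_iff if_distrib[where f="\<lambda>a. a * _"] cong: if_cong)
    have "(cadj V ** restr_mat (R - {r}) ** V) $ j $ k = (cadj V ** (restr_mat (R - {r}) ** V)) $ j $ k"
      by (simp only: matrix_mul_assoc)
    also have "\<dots> = (\<Sum>i\<in>UNIV. cnj (V $ i $ j) * (if i \<in> R - {r} then V $ i $ k else 0))"
      unfolding RV by (simp only: matrix_matrix_mult_def cadj_def vec_lambda_beta)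
    also have "\<dots> = (\<Sum>i\<in>R-{r}. cnj (V $ i $ j) * V $ i $ k)"
      by (rule sum.mono_neutral_cong_right) auto
    \<comment> \<open>Restoring index \<open>r\<close>, and then the indices outside
      \<open>R\<close>, completes the sum to a product of two columns of \<open>V\<close>, which
      unitarity evaluates.\<close>
    also have "\<dots> = (\<Sum>i\<in>R. cnj (V $ i $ j) * V $ i $ k) - cnj (V $ r $ j) * V $ r $ k"
      using r by (simp add: sum_diff1)
    also have "(\<Sum>i\<in>R. cnj (V $ i $ j) * V $ i $ k) = (\<Sum>i\<in>UNIV. cnj (V $ i $ j) * V $ i $ k) - (\<Sum>i\<in>-R. cnj (V $ i $ j) * V $ i $ k)"
      by (simp add: sum.subset_diff[of R UNIV] Compl_eq_Diff_UNIV)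
    also have "(\<Sum>i\<in>UNIV. cnj (V $ i $ j) * V $ i $ k) = (if j = k then 1 else 0)"
      using V unfolding unitary_iff_columns by (simp add: cdot_def column_def)
    also have "(\<Sum>i\<in>-R. cnj (V $ i $ j) * V $ i $ k) = (\<Sum>i\<in>-R. if i = j then (if j = k then 1 else 0) else 0)"
      by (intro sum.cong refl) (auto simp: Vo)
    also have "\<dots> = (if j = k \<and> j \<notin> R then 1 else 0)" by simp
    also have "cnj (V $ r $ j) * V $ r $ k = (if j \<in> R \<and> k \<in> R then cnj (z $ j) * z $ k / of_real (sq_sum R z) else 0)"
      by (simp add: Vr flip: s(2))
    finally show ?thesis
      by (simp add: drop_mat_def restr_mat_def)
  qed
  then have "drop_mat R z = cadj V ** restr_mat (R - {r}) ** V" by (simp add: vec_eq_iff)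
  with V show ?thesis ..
qed

text \<open>After diagonalisation each eigenvalue is a diagonal entry of a Gram matrix, hence a sum
  of squares.\<close>

lemma real_eigvals_gram_nonneg:
  assumes "real_eigvals (gram R Y) x" "\<And>j k. j \<noteq> k \<Longrightarrow> x $ j \<noteq> x $ k"
  shows "0 \<le> x $ k"
proof -
  obtain W where W: "unitary_mat W" "cadj W ** gram R Y ** W = (\<chi> i j. if i = j then complex_of_real (x $ i) else 0)"
    using exists_unitary_diagonalization[OF cadj_gram assms] .
  have "complex_of_real (x $ k) = gram R (Y ** W) $ k $ k"
    using W(2) by (simp add: gram_eq_herm_form herm_form_mult vec_eq_iff)
  also have "\<dots> = complex_of_real (\<Sum>j\<in>R. (cmod ((Y ** W) $ j $ k))\<^sup>2)"
    by (simp only: gram_def vec_lambda_beta of_real_sum complex_norm_square) (simp add: mult.commute)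
  finally have "x $ k = (\<Sum>j\<in>R. (cmod ((Y ** W) $ j $ k))\<^sup>2)"
    by (simp only: of_real_eq_iff)
  then show ?thesis by (simp add: sum_nonneg)
qed

text \<open>In the eigenbasis of the Gram matrix the columns of \<open>Y'\<close> are orthogonal on
  \<open>R\<close> with squared norms \<open>x $ k\<close>. Their normalisations become the rows
  \<open>f k\<close> of \<open>V\<close>; the projection then subtracts a rank-one matrix whose
  weights are the normalised squared moduli of \<open>V *v z\<close> at these coordinates.\<close>

lemma charpoly_drop_mat:
  fixes Y :: "complex^'n::{finite,linorder}^'m" and f :: "'n \<Rightarrow> 'm"
  assumes ev: "real_eigvals (gram R Y) x" and x: "pos_distinct x" and f: "inj f" "range f \<subseteq> R"
  obtains V where "unitary_mat V"
    "\<And>z. charpoly (herm_form (drop_mat R z) Y)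
      = pert_poly x (\<chi> i. (cmod ((V *v z) $ f i))\<^sup>2 / sq_sum R (V *v z))"
proof -
  have x0: "0 < x $ k" and xd: "j \<noteq> k \<Longrightarrow> x $ j \<noteq> x $ k" for j k using x by (auto simp: pos_distinct_def)
  obtain W where W: "unitary_mat W" "cadj W ** gram R Y ** W = (\<chi> i j. if i = j then complex_of_real (x $ i) else 0)"
    using exists_unitary_diagonalization[OF cadj_gram ev xd] .
  define Y' where "Y' = Y ** W"
  have gram': "(\<Sum>j\<in>R. cnj (Y' $ j $ k) * Y' $ j $ l) = (if k = l then complex_of_real (x $ k) else 0)" for k l
  proof -
    have "gram R Y' = (\<chi> i j. if i = j then complex_of_real (x $ i) else 0)"
      using W(2) by (simp add: Y'_def gram_eq_herm_form herm_form_mult)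
    then show ?thesis by (simp add: gram_def vec_eq_iff)
  qed
  define q where "q k = (\<chi> j. if j \<in> R then Y' $ j $ k / of_real (sqrt (x $ k)) else 0)" for k
  have qq: "cdot (q k) (q l) = (if k = l then 1 else 0)" for k l
  proof -
    have "cdot (q k) (q l) = (\<Sum>j\<in>R. cnj (Y' $ j $ k) * Y' $ j $ l) / (of_real (sqrt (x $ k)) * of_real (sqrt (x $ l)))"
      by (simp add: cdot_def q_def if_distrib[where f="\<lambda>a. a * _"] if_distrib[where f=cnj] sum.If_cases sum_divide_distrib cong: if_cong)
    also have "\<dots> = (if k = l then 1 else 0)"
      using x0[of k] by (auto simp: gram' simp flip: of_real_mult)
    finally show ?thesis .
  qed
  obtain V0 where V0: "unitary_mat V0" "\<And>i. i \<in> range f \<Longrightarrow> column i V0 = q (inv f i)"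
    "\<And>i j. i \<notin> R \<or> j \<notin> R \<Longrightarrow> V0 $ i $ j = (if i = j then 1 else 0)"
    by (rule exists_unitary_extension[of "range f" R "\<lambda>i. q (inv f i)"])
       (use f qq in \<open>auto simp: q_def inv_f_f inj_eq\<close>)
  \<comment> \<open>The transpose is taken, not the adjoint: \<open>z\<close> is paired with the
    columns of \<open>Y'\<close> without conjugation.\<close>
  define V where "V = transpose V0"
  have V: "unitary_mat V"
  proof -
    have "cadj V ** V = transpose (V0 ** cadj V0)"
      by (simp add: V_def cadj_def transpose_def matrix_matrix_mult_def vec_eq_iff mult.commute)
    then show ?thesis
      using unitary_mat_right[OF V0(1)] by (simp add: unitary_mat_def transpose_mat)
  qed
  have Vf: "V $ f k $ j = q k $ j" for k j
    using V0(2)[of "f k"] f by (simp add: V_def transpose_def column_def vec_eq_iff inv_f_f)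
  have Vo: "V $ i $ j = (if i = j then 1 else 0)" if "i \<notin> R \<or> j \<notin> R" for i j
    using V0(3)[of j i] that by (auto simp: V_def transpose_def)
  have zf: "(\<Sum>j\<in>R. z $ j * Y' $ j $ k) = of_real (sqrt (x $ k)) * (V *v z) $ f k" for z k
  proof -
    have "(V *v z) $ f k = (\<Sum>j\<in>UNIV. q k $ j * z $ j)"
      by (simp add: matrix_vector_mult_def Vf)
    also have "\<dots> = (\<Sum>j\<in>R. z $ j * Y' $ j $ k / of_real (sqrt (x $ k)))"
      by (rule sum.mono_neutral_cong_right) (auto simp: q_def)
    also have "\<dots> = (\<Sum>j\<in>R. z $ j * Y' $ j $ k) / of_real (sqrt (x $ k))"
      by (rule sum_divide_distrib[symmetric])
    finally show ?thesis using x0[of k] by simp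
  qed
  \<comment> \<open>\<open>V\<close> preserves the full norm and fixes every coordinate outside
    \<open>R\<close>, so it preserves the part over \<open>R\<close>.\<close>
  have sq: "sq_sum R (V *v z) = sq_sum R z" for z
  proof -
    have split: "(norm y)\<^sup>2 = sq_sum R y + (\<Sum>j\<in>-R. (cmod (y $ j))\<^sup>2)" for y :: "complex^'m"
      by (simp add: norm_vec_def L2_set_def sum_nonneg sq_sum_def sum.subset_diff[of R UNIV] Compl_eq_Diff_UNIV)
    have "(V *v z) $ j = z $ j" if "j \<notin> R" for j
      using that by (simp add: matrix_vector_mult_def Vo if_distrib[where f="\<lambda>a. a * _"] cong: if_cong)
    then show ?thesis
      using split[of z] split[of "V *v z"] unitary_norm[OF V, of z] by simp
  qed
  have "charpoly (herm_form (drop_mat R z) Y) = pert_poly x (\<chi> i. (cmod ((V *v z) $ f i))\<^sup>2 / sq_sum R (V *v z))" for z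
  proof -
    define \<rho> where "\<rho> = sq_sum R z"
    define z' where "z' = V *v z"
    have form: "herm_form (drop_mat R z) Y' $ k $ l = (if k = l then complex_of_real (x $ k) else 0)
        - cnj (of_real (sqrt (x $ k)) * z' $ f k) * (of_real (sqrt (x $ l)) * z' $ f l) / of_real \<rho>" for k l
    proof -
      have "herm_form (drop_mat R z) Y' $ k $ l = (\<Sum>i\<in>UNIV. \<Sum>j\<in>UNIV. cnj (Y' $ i $ k) * drop_mat R z $ i $ j * Y' $ j $ l)"
        by (simp add: herm_form_def matrix_mul_assoc[symmetric])
           (simp add: matrix_matrix_mult_def ctrans_def sum_distrib_left mult_ac)
      also have "\<dots> = (\<Sum>i\<in>UNIV. \<Sum>j\<in>UNIV. cnj (Y' $ i $ k) * restr_mat R $ i $ j * Y' $ j $ l)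
         - (\<Sum>i\<in>UNIV. \<Sum>j\<in>UNIV. cnj (Y' $ i $ k) * (if i \<in> R \<and> j \<in> R then cnj (z $ i) * z $ j / of_real \<rho> else 0) * Y' $ j $ l)"
        by (simp add: drop_mat_def algebra_simps sum_subtractf \<rho>_def cong: if_cong)
      also have "(\<Sum>i\<in>UNIV. \<Sum>j\<in>UNIV. cnj (Y' $ i $ k) * restr_mat R $ i $ j * Y' $ j $ l) = gram R Y' $ k $ l"
        by (simp add: gram_eq_herm_form herm_form_def matrix_mul_assoc[symmetric])
           (simp add: matrix_matrix_mult_def ctrans_def sum_distrib_left mult_ac)
      also have "(\<Sum>i\<in>UNIV. \<Sum>j\<in>UNIV. cnj (Y' $ i $ k) * (if i \<in> R \<and> j \<in> R then cnj (z $ i) * z $ j / of_real \<rho> else 0) * Y' $ j $ l)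
        = (\<Sum>i\<in>R. \<Sum>j\<in>R. cnj (Y' $ i $ k) * (cnj (z $ i) * z $ j / of_real \<rho>) * Y' $ j $ l)"
        by (intro sum.mono_neutral_cong_right ballI) (auto intro!: sum.mono_neutral_cong_right)
      also have "\<dots> = cnj (\<Sum>i\<in>R. z $ i * Y' $ i $ k) * (\<Sum>j\<in>R. z $ j * Y' $ j $ l) / of_real \<rho>"
        by (simp add: sum_product sum_divide_distrib mult_ac) (rule sum.swap)
      finally show ?thesis
        by (simp add: zf z'_def) (simp add: gram_def gram')
    qed
    have "charpoly (herm_form (drop_mat R z) Y) = charpoly (herm_form (drop_mat R z) Y')"
      by (simp add: Y'_def herm_form_mult charpoly_unitary_conj[OF W(1)])
    also have "\<dots> = pert_poly x (\<chi> i. (cmod (z' $ f i))\<^sup>2 / \<rho>)"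
    proof (rule poly_eq_poly_eq_iff[THEN iffD1], rule ext)
      fix t
      have coef: "cnj (of_real (sqrt (x $ i)) * z' $ f i) / of_real \<rho> * (of_real (sqrt (x $ i)) * z' $ f i)
         = complex_of_real ((cmod (z' $ f i))\<^sup>2 / \<rho> * x $ i)" for i
      proof -
        have "of_real (sqrt (x $ i)) * of_real (sqrt (x $ i)) = complex_of_real (x $ i)"
          using x0[of i] by (simp flip: of_real_mult)
        moreover have "cnj (z' $ f i) * z' $ f i = complex_of_real ((cmod (z' $ f i))\<^sup>2)"
          by (simp only: complex_norm_square) (simp add: mult.commute)
        moreover have "cnj (of_real (sqrt (x $ i)) * z' $ f i) / of_real \<rho> * (of_real (sqrt (x $ i)) * z' $ f i)
          = (of_real (sqrt (x $ i)) * of_real (sqrt (x $ i))) * (cnj (z' $ f i) * z' $ f i) / of_real \<rho>"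
          by simp
        ultimately show ?thesis by (simp add: mult_ac)
      qed
      have "poly (charpoly (herm_form (drop_mat R z) Y')) t
        = det (\<chi> i j. (if i = j then t - complex_of_real (x $ i) else 0) + cnj (of_real (sqrt (x $ i)) * z' $ f i) / of_real \<rho> * (of_real (sqrt (x $ j)) * z' $ f j))"
        unfolding poly_charpoly by (rule arg_cong[where f=det]) (simp add: vec_eq_iff form)
      also have "\<dots> = (\<Prod>i\<in>UNIV. t - complex_of_real (x $ i))
        + (\<Sum>i\<in>UNIV. cnj (of_real (sqrt (x $ i)) * z' $ f i) / of_real \<rho> * (of_real (sqrt (x $ i)) * z' $ f i) * (\<Prod>j\<in>UNIV-{i}. t - complex_of_real (x $ j)))"
        by (rule det_diag_rank_one)
      finally show "poly (charpoly (herm_form (drop_mat R z) Y')) t = poly (pert_poly x (\<chi> i. (cmod (z' $ f i))\<^sup>2 / \<rho>)) t"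
        unfolding coef by (simp add: poly_pert_poly)
    qed
    finally show ?thesis by (simp add: z'_def \<rho>_def sq)
  qed
  with V show ?thesis by (rule that)
qed

lemma real_eigvals_permute: "\<sigma> permutes UNIV \<Longrightarrow> real_eigvals A (\<chi> i. x $ \<sigma> i) \<longleftrightarrow> real_eigvals A x"
  by (simp add: real_eigvals_iff_rpoly rpoly_permute)

lemma coeff_charpoly_measurable: "(\<lambda>M :: complex^'n^'n. coeff (charpoly M)) \<in> borel_measurable borel"
  by (intro borel_measurable_continuous_onI continuous_on_coeff_charpoly)

lemma coeff_rpoly_measurable [measurable]: "(\<lambda>y :: real^'n. coeff (rpoly y)) \<in> borel_measurable borel"
  by (intro borel_measurable_continuous_onI continuous_on_coeff_rpoly)

text \<open>The Dirichlet normaliser for \<open>n\<close> out of \<open>N\<close> coordinates,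
  divided by n! because the one-step kernel counts every ordering of the new spectrum.\<close>

definition step_const :: "nat \<Rightarrow> nat \<Rightarrow> real" where
  "step_const n N = fact (N - 1) / fact (N - n - 1) / fact n"

text \<open>The rotation \<open>V\<close> of the rank-one reduction depends on \<open>Y\<close> but
  not on \<open>z\<close>, so invariance of the Gaussian vector removes it and only the law of the
  weights remains.\<close>

lemma nn_integral_gauss_drop:
  fixes Y :: "complex^'n::{finite,linorder}^'m"
  assumes ev: "real_eigvals (gram R Y) x" and x: "pos_distinct x" and R: "CARD('n) < card R"
    and \<Phi>[measurable]: "\<Phi> \<in> borel_measurable borel"
  shows "(\<integral>\<^sup>+z. \<Phi> (coeff (charpoly (herm_form (drop_mat R z) Y))) \<partial>gauss_vec)
    = ennreal (step_const CARD('n) (card R)) *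
      (\<integral>\<^sup>+y. \<Phi> (coeff (rpoly y)) * ennreal (kern (card R) (card R - 1) x y) * indicator nonneg_vecs y \<partial>lborel)"
proof -
  obtain \<sigma> where \<sigma>: "\<sigma> permutes UNIV" "(\<chi> i. x $ \<sigma> i) \<in> sorted_vecs" by (rule exists_sorting_permutation)
  define a where "a = (\<chi> i. x $ \<sigma> i)"
  have eva: "real_eigvals (gram R Y) a" using ev \<sigma>(1) by (simp add: a_def real_eigvals_permute)
  have pda: "pos_distinct a" using x \<sigma>(1) by (simp add: a_def pos_distinct_permute)
  have a: "a $ i < a $ j" if "i < j" for i j
  proof -
    have "a $ i \<noteq> a $ j" using pda that by (auto simp: pos_distinct_def)
    moreover have "a $ i \<le> a $ j" using \<sigma>(2) that unfolding a_def[symmetric] by (simp add: sorted_vecs_def)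
    ultimately show ?thesis by simp
  qed
  have a0: "0 < a $ i" for i using pda by (simp add: pos_distinct_def)
  obtain f :: "'n \<Rightarrow> 'm" where f: "inj f" "range f \<subseteq> R"
    using card_le_inj[of "UNIV :: 'n set" R] R by auto
  have psub: "range f \<subset> R"
    using f R by (metis card_image nat_neq_iff psubsetI)
  obtain V where V: "unitary_mat V" "\<And>z. charpoly (herm_form (drop_mat R z) Y)
      = pert_poly a (\<chi> i. (cmod ((V *v z) $ f i))\<^sup>2 / sq_sum R (V *v z))"
    using charpoly_drop_mat[OF eva pda f] by blast
  have pert: "charpoly (herm_form (drop_mat R z) Y) = pert_poly a (weights_of R f (V *v z))" for z
    by (simp add: V(2) weights_of_def sq_sum_def)
  have [measurable]: "(\<lambda>p. coeff (pert_poly a p)) \<in> borel_measurable borel"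
    by (intro borel_measurable_continuous_onI continuous_on_coeff_pert_poly)
  have [measurable]: "weights_of R f \<in> borel_measurable borel"
    unfolding weights_of_def by (intro borel_measurable_vec_lambda) measurable
  have lin: "linear (\<lambda>z. V *v z)"
    using bounded_linear_matrix_vector by (simp add: linear_conv_bounded_linear)
  have [measurable]: "(\<lambda>z. V *v z) \<in> borel_measurable borel"
    by (intro borel_measurable_continuous_onI linear_continuous_on bounded_linear_matrix_vector)
  have "(\<integral>\<^sup>+z. \<Phi> (coeff (charpoly (herm_form (drop_mat R z) Y))) \<partial>gauss_vec)
    = (\<integral>\<^sup>+z. \<Phi> (coeff (pert_poly a (weights_of R f z))) \<partial>distr gauss_vec borel (\<lambda>z. V *v z))"
    unfolding pert by (subst nn_integral_distr) auto
  also have "distr gauss_vec borel (\<lambda>z. V *v z) = gauss_vec"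
    by (rule distr_gauss_vec_isometry[OF lin unitary_norm[OF V(1)]])
  also have "(\<integral>\<^sup>+z. \<Phi> (coeff (pert_poly a (weights_of R f z))) \<partial>gauss_vec)
    = ennreal (fact (card R - 1) / fact (card R - CARD('n) - 1)) *
      (\<integral>\<^sup>+p. \<Phi> (coeff (pert_poly a p)) * ennreal ((1 - (\<Sum>i\<in>UNIV. p $ i)) ^ (card R - CARD('n) - 1)) * indicator open_simplex p \<partial>lborel)"
    by (rule nn_integral_gauss_weights[OF f(1) psub]) measurable
  also have "\<dots> = ennreal (step_const CARD('n) (card R)) * (fact CARD('n) *
      (\<integral>\<^sup>+p. \<Phi> (coeff (pert_poly a p)) * ennreal ((1 - (\<Sum>i\<in>UNIV. p $ i)) ^ (card R - CARD('n) - 1)) * indicator open_simplex p \<partial>lborel))"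
  proof -
    have "ennreal (fact (card R - 1) / fact (card R - CARD('n) - 1)) = ennreal (step_const CARD('n) (card R)) * fact CARD('n)"
      by (simp add: step_const_def ennreal_fact[symmetric] flip: ennreal_mult')
    then show ?thesis by (simp add: mult.assoc)
  qed
  also have "(fact CARD('n) *
      (\<integral>\<^sup>+p. \<Phi> (coeff (pert_poly a p)) * ennreal ((1 - (\<Sum>i\<in>UNIV. p $ i)) ^ (card R - CARD('n) - 1)) * indicator open_simplex p \<partial>lborel))
     = (\<integral>\<^sup>+y. \<Phi> (coeff (rpoly y)) * ennreal (kern (card R) (card R - 1) a y) * indicator nonneg_vecs y \<partial>lborel)"
    by (rule nn_integral_kern_step_sorted[symmetric]) (use a a0 R in auto)
  also have "(\<lambda>y. kern (card R) (card R - 1) a y) = kern (card R) (card R - 1) x"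
    by (simp add: a_def fun_eq_iff kern_permute_left[OF \<sigma>(1)])
  finally show ?thesis .
qed

lemma AE_gauss_sq_sum_nonzero:
  assumes "R \<noteq> {}"
  shows "AE z in gauss_vec. sq_sum R (z :: complex^'m) \<noteq> 0"
proof -
  obtain r where r: "r \<in> R" using assms by blast
  have "AE z in lborel. (axis r 1 :: complex^'m) \<bullet> z \<noteq> 0"
    by (rule AE_lborel_hyperplane) (simp add: axis_eq_0_iff)
  then have "AE z in gauss_vec. (axis r 1 :: complex^'m) \<bullet> z \<noteq> 0"
    unfolding gauss_vec_density by (subst AE_density) auto
  then show ?thesis
  proof eventually_elim
    case (elim z)
    then have "z $ r \<noteq> 0" by (auto simp: inner_axis')
    moreover have "(cmod (z $ r))\<^sup>2 \<le> sq_sum R z"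
      unfolding sq_sum_def using r by (intro member_le_sum) auto
    ultimately show ?case by (smt (verit) zero_less_power2 norm_eq_zero)
  qed
qed

lemma continuous_on_herm_form:
  fixes g :: "'x::topological_space \<Rightarrow> complex^'m^'m" and h :: "'x \<Rightarrow> complex^'n^'m"
  assumes "continuous_on S g" "continuous_on S h"
  shows "continuous_on S (\<lambda>x. herm_form (g x) (h x))"
  unfolding herm_form_def matrix_matrix_mult_def ctrans_def
  by (intro continuous_intros continuous_on_vec_lambda assms)

lemma mult_right_measurable [measurable]:
  fixes X :: "complex^'n^'m"
  shows "(\<lambda>U :: complex^'m^'m. U ** X) \<in> borel_measurable borel"
  unfolding matrix_matrix_mult_def
  by (intro borel_measurable_continuous_onI continuous_on_vec_lambda continuous_intros)

lemma gram_measurable [measurable]: "(gram R :: complex^'n^'m \<Rightarrow> _) \<in> borel_measurable borel"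
proof -
  have "continuous_on UNIV (\<lambda>Y :: complex^'n^'m. herm_form (restr_mat R) Y)"
    by (intro continuous_on_herm_form continuous_intros)
  then show ?thesis
    by (intro borel_measurable_continuous_onI) (simp add: gram_eq_herm_form[abs_def])
qed

lemma drop_mat_measurable [measurable]: "(drop_mat R :: complex^'m \<Rightarrow> _) \<in> borel_measurable borel"
proof -
  have cnjm: "(\<lambda>z :: complex^'m. cnj (z $ i)) \<in> borel_measurable borel" for i
    by (intro borel_measurable_continuous_onI continuous_intros)
  have entry: "(\<lambda>z :: complex^'m. cnj (z $ i) * z $ j / complex_of_real (\<Sum>j\<in>R. (cmod (z $ j))\<^sup>2)) \<in> borel_measurable borel" for i j
    by (intro borel_measurable_divide borel_measurable_times cnjm borel_measurable_vec_nth) measurable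
  have "(\<lambda>z :: complex^'m. if c then cnj (z $ i) * z $ j / complex_of_real (\<Sum>j\<in>R. (cmod (z $ j))\<^sup>2) else 0) \<in> borel_measurable borel" for i j c
    using entry by (cases c) (simp_all only: if_True if_False borel_measurable_const)
  then show ?thesis
    unfolding drop_mat_def sq_sum_def
    by (intro borel_measurable_vec_lambda borel_measurable_diff borel_measurable_const)
qed

lemma herm_form_drop_measurable:
  fixes X :: "complex^'n^'m"
  shows "(\<lambda>(z, U :: complex^'m^'m). coeff (charpoly (herm_form (drop_mat R z) (U ** X)))) \<in> borel_measurable (borel \<Otimes>\<^sub>M borel)"
proof -
  have "(\<lambda>p. herm_form (fst p) (snd p)) \<in> borel_measurable (borel :: ((complex^'m^'m) \<times> (complex^'n^'m)) measure)"
    by (intro borel_measurable_continuous_onI continuous_on_herm_form continuous_intros)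
  then have h: "(\<lambda>p. herm_form (fst p) (snd p)) \<in> borel_measurable (borel \<Otimes>\<^sub>M borel :: ((complex^'m^'m) \<times> (complex^'n^'m)) measure)"
    by (simp add: borel_prod)
  have "(\<lambda>(z, U :: complex^'m^'m). (drop_mat R z, U ** X)) \<in> measurable (borel \<Otimes>\<^sub>M borel) (borel \<Otimes>\<^sub>M borel)"
    by measurable
  from measurable_compose[OF measurable_compose[OF this h] coeff_charpoly_measurable]
  show ?thesis by (simp add: split_def)
qed

text \<open>For fixed \<open>z\<close> a unitary \<open>V\<close> carries the projection to the
  deletion of row \<open>r\<close>, and Haar invariance replaces \<open>U\<close> by
  \<open>V ** U\<close>. The value is the same for almost every \<open>z\<close>, so it may be
  averaged over a Gaussian \<open>z\<close> and the integrals exchanged.\<close>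

lemma haar_remove_row:
  fixes X :: "complex^'n::{finite,linorder}^'m" and \<Phi> :: "(nat \<Rightarrow> complex) \<Rightarrow> ennreal"
  assumes r: "r \<in> R" and \<Phi>[measurable]: "\<Phi> \<in> borel_measurable borel"
  shows "(\<integral>\<^sup>+U. \<Phi> (coeff (charpoly (gram (R - {r}) (U ** X)))) \<partial>haar_unitary)
    = (\<integral>\<^sup>+U. \<integral>\<^sup>+z. \<Phi> (coeff (charpoly (herm_form (drop_mat R z) (U ** X)))) \<partial>gauss_vec \<partial>haar_unitary)"
proof -
  have H: "is_haar (haar_unitary :: (complex^'m^'m) measure)" by (rule is_haar_haar_unitary)
  interpret H: prob_space "haar_unitary :: (complex^'m^'m) measure" using H by (simp add: is_haar_def)
  interpret G: prob_space "gauss_vec :: (complex^'m) measure" by (rule prob_space_gauss_vec)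
  interpret P: pair_sigma_finite "gauss_vec :: (complex^'m) measure" "haar_unitary :: (complex^'m^'m) measure" ..
  have sH[measurable_cong]: "sets (haar_unitary :: (complex^'m^'m) measure) = sets borel" using H by (simp add: is_haar_def)
  note [measurable] = coeff_charpoly_measurable
  let ?I = "\<integral>\<^sup>+U. \<Phi> (coeff (charpoly (gram (R - {r}) (U ** X)))) \<partial>haar_unitary"
  have [measurable]: "(\<lambda>p. coeff (charpoly (herm_form (drop_mat R (fst p)) (snd p ** X)))) \<in> borel_measurable (gauss_vec \<Otimes>\<^sub>M haar_unitary)"
    using herm_form_drop_measurable[of R X]
    by (simp add: split_def measurable_cong_sets[OF sets_pair_measure_cong[OF sets_gauss_vec sH] refl])
  have "?I = (\<integral>\<^sup>+z. ?I \<partial>(gauss_vec :: (complex^'m) measure))"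
    using G.emeasure_space_1 by simp
  also have "\<dots> = (\<integral>\<^sup>+z. \<integral>\<^sup>+U. \<Phi> (coeff (charpoly (herm_form (drop_mat R z) (U ** X)))) \<partial>haar_unitary \<partial>gauss_vec)"
  proof (rule nn_integral_cong_AE)
    have "R \<noteq> {}" using r by auto
    then have "AE z in gauss_vec. sq_sum R (z :: complex^'m) \<noteq> 0" by (rule AE_gauss_sq_sum_nonzero)
    then show "AE z in gauss_vec. ?I = (\<integral>\<^sup>+U. \<Phi> (coeff (charpoly (herm_form (drop_mat R z) (U ** X)))) \<partial>haar_unitary)"
    proof eventually_elim
      case (elim z)
      obtain V where V: "unitary_mat V" "drop_mat R z = cadj V ** restr_mat (R - {r}) ** V"
        using drop_mat_eq_unitary_conj[OF r elim] .
      have "?I = (\<integral>\<^sup>+U. \<Phi> (coeff (charpoly (gram (R - {r}) (U ** X)))) \<partial>distr haar_unitary borel (\<lambda>U. V ** U))"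
        using H V(1) by (simp add: is_haar_def)
      also have "\<dots> = (\<integral>\<^sup>+U. \<Phi> (coeff (charpoly (gram (R - {r}) (V ** U ** X)))) \<partial>haar_unitary)"
        by (subst nn_integral_distr) auto
      also have "\<dots> = (\<integral>\<^sup>+U. \<Phi> (coeff (charpoly (herm_form (drop_mat R z) (U ** X)))) \<partial>haar_unitary)"
        by (simp add: V(2) gram_eq_herm_form herm_form_mult_left flip: matrix_mul_assoc)
      finally show ?case .
    qed
  qed
  also have "\<dots> = (\<integral>\<^sup>+U. \<integral>\<^sup>+z. \<Phi> (coeff (charpoly (herm_form (drop_mat R z) (U ** X)))) \<partial>gauss_vec \<partial>haar_unitary)"
    by (rule P.Fubini'[symmetric]) (simp add: split_def)
  finally show ?thesis .
qed

section \<open>Removing several rows\<close>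

text \<open>The proportionality constant for \<open>m - d - 1\<close> remaining rows; the last factor comes from
  integrating out the squared singular values of the intermediate matrix.\<close>
primrec row_const :: "nat \<Rightarrow> nat \<Rightarrow> nat \<Rightarrow> real" where
  "row_const n m 0 = step_const n m"
| "row_const n m (Suc d) = row_const n m d * step_const n (m - Suc d) * (fact n / real (Suc d) ^ n)"

lemma step_const_nonneg: "0 \<le> step_const n N"
  by (simp add: step_const_def)

lemma row_const_nonneg: "0 \<le> row_const n m d"
  by (induction d) (simp_all add: step_const_nonneg)

lemma coeff_rpoly_mem_image_iff:
  assumes "sym_set A"
  shows "coeff (rpoly y) \<in> (\<lambda>y. coeff (rpoly y)) ` A \<longleftrightarrow> y \<in> A"
proof
  assume "coeff (rpoly y) \<in> (\<lambda>y. coeff (rpoly y)) ` A"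
  then obtain z where z: "z \<in> A" "rpoly y = rpoly z" by (auto simp: coeff_inject)
  from z(2) obtain \<sigma> where "\<sigma> permutes UNIV" "y = (\<chi> i. z $ \<sigma> i)" by (rule rpoly_eqE)
  with z(1) assms show "y \<in> A" unfolding sym_set_def by blast
qed (rule imageI)

lemma image_coeff_rpoly_sym_borel:
  fixes A :: "(real^'n::{finite,linorder}) set"
  assumes A: "A \<in> sets borel" "sym_set A"
  shows "(\<lambda>y. coeff (rpoly y)) ` A \<in> sets borel"
proof -
  have "(\<lambda>y. coeff (rpoly y)) ` A = (\<lambda>y. coeff (rpoly y)) ` (A \<inter> sorted_vecs)"
  proof (intro equalityI image_subsetI)
    fix y assume "y \<in> A"
    moreover obtain \<sigma> where \<sigma>: "\<sigma> permutes UNIV" "(\<chi> i. y $ \<sigma> i) \<in> sorted_vecs" by (rule exists_sorting_permutation)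
    ultimately have "(\<chi> i. y $ \<sigma> i) \<in> A \<inter> sorted_vecs"
      using A(2) unfolding sym_set_def by blast
    moreover have "coeff (rpoly y) = coeff (rpoly (\<chi> i. y $ \<sigma> i))" by (simp add: rpoly_permute \<sigma>)
    ultimately show "coeff (rpoly y) \<in> (\<lambda>y. coeff (rpoly y)) ` (A \<inter> sorted_vecs)"
      by (simp only: image_iff) (rule bexI, rule refl)
  qed auto
  then show ?thesis by (simp add: image_coeff_rpoly_borel A)
qed

text \<open>Induction on the number of removed rows minus one. Keeping \<open>R\<close> and the test
  function \<open>\<Phi>\<close> general lets the conditional expectation over the last removal
  serve as the test function for one row more.\<close>

lemma haar_eigenvalue_law:
  fixes X :: "complex^'n::{finite,linorder}^'m" and \<Phi> :: "(nat \<Rightarrow> complex) \<Rightarrow> ennreal"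
  assumes ev: "real_eigvals (gram UNIV X) x" and x: "pos_distinct x"
    and \<Phi>: "\<Phi> \<in> borel_measurable borel"
    and R: "card R + Suc d = CARD('m)" "CARD('n) \<le> card R"
  shows "(\<integral>\<^sup>+U. \<Phi> (coeff (charpoly (gram R (U ** X)))) \<partial>haar_unitary)
    = ennreal (row_const CARD('n) CARD('m) d) *
      (\<integral>\<^sup>+y. \<Phi> (coeff (rpoly y)) * ennreal (kern CARD('m) (card R) x y) * indicator nonneg_vecs y \<partial>lborel)"
  using \<Phi> R
proof (induction d arbitrary: R \<Phi>)
  case 0
  note [measurable] = "0.prems"(1)
  have H: "is_haar (haar_unitary :: (complex^'m^'m) measure)" by (rule is_haar_haar_unitary)
  interpret H: prob_space "haar_unitary :: (complex^'m^'m) measure" using H by (simp add: is_haar_def)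
  have "card (- R) = 1" using "0.prems" by (simp add: Compl_eq_Diff_UNIV card_Diff_subset)
  then obtain r where r: "- R = {r}" by (auto simp: card_1_singleton_iff)
  then have R: "R = UNIV - {r}" by auto
  have cR: "card R = CARD('m) - 1" using "0.prems" by simp
  let ?c = "ennreal (step_const CARD('n) CARD('m)) *
      (\<integral>\<^sup>+y. \<Phi> (coeff (rpoly y)) * ennreal (kern CARD('m) (CARD('m) - 1) x y) * indicator nonneg_vecs y \<partial>lborel)"
  have "(\<integral>\<^sup>+U. \<Phi> (coeff (charpoly (gram R (U ** X)))) \<partial>haar_unitary)
    = (\<integral>\<^sup>+U. \<integral>\<^sup>+z. \<Phi> (coeff (charpoly (herm_form (drop_mat UNIV z) (U ** X)))) \<partial>gauss_vec \<partial>haar_unitary)"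
    unfolding R by (rule haar_remove_row) auto
  also have "\<dots> = (\<integral>\<^sup>+U. ?c \<partial>(haar_unitary :: (complex^'m^'m) measure))"
  proof (rule nn_integral_cong_AE)
    show "AE U in haar_unitary. (\<integral>\<^sup>+z. \<Phi> (coeff (charpoly (herm_form (drop_mat UNIV z) (U ** X)))) \<partial>gauss_vec) = ?c"
      using is_haar_AE_unitary[OF H]
    proof eventually_elim
      case (elim U)
      have "real_eigvals (gram UNIV (U ** X)) x" using ev elim by (simp add: gram_UNIV_unitary)
      moreover have "CARD('n) < CARD('m)" using "0.prems" by simp
      ultimately show ?case
        using x by (subst nn_integral_gauss_drop) auto
    qed
  qed
  also have "\<dots> = ?c" using H.emeasure_space_1 by simp
  finally show ?case by (simp only: row_const.simps cR)
next
  case (Suc d)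
  note [measurable] = Suc.prems(1)
  have H: "is_haar (haar_unitary :: (complex^'m^'m) measure)" by (rule is_haar_haar_unitary)
  have sH[measurable_cong]: "sets (haar_unitary :: (complex^'m^'m) measure) = sets borel" using H by (simp add: is_haar_def)
  note [measurable] = coeff_charpoly_measurable
  have "R \<noteq> UNIV" using Suc.prems by auto
  then obtain r where r: "r \<notin> R" by auto
  define R' where "R' = insert r R"
  define N where "N = card R'"
  have R: "R = R' - {r}" "r \<in> R'" using r by (auto simp: R'_def)
  have N: "card R = N - 1" "CARD('n) < N" "N + Suc d = CARD('m)" "N < CARD('m)" "CARD('n) \<le> N"
    using Suc.prems r by (auto simp: N_def R'_def)
  \<comment> \<open>Up to \<open>step_const\<close>, the expectation given the spectrum
    \<open>w\<close> before the last removal. It is symmetric in \<open>w\<close>, hence a function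
    \<open>\<Psi>\<close> of the characteristic polynomial.\<close>
  define G where "G w = (\<integral>\<^sup>+y. \<Phi> (coeff (rpoly y)) * ennreal (kern N (N - 1) w y) * indicator nonneg_vecs y \<partial>lborel)" for w :: "real^'n::_"
  have [measurable]: "G \<in> borel_measurable borel"
    unfolding G_def by (intro sigma_finite_measure.borel_measurable_nn_integral[OF sigma_finite_lborel]) measurable
  have "symmetric G"
    by (simp add: symmetric_def G_def kern_permute_left)
  then obtain \<Psi> where \<Psi>[measurable]: "\<Psi> \<in> borel_measurable borel" and \<Psi>G: "\<And>y. \<Psi> (coeff (rpoly y)) = G y"
    using symmetric_factor[of G] by auto
  \<comment> \<open>The positive, pairwise distinct spectra, to which the one-step law applies.
    Testing the induction hypothesis on the complement shows that they occur almost surely.\<close>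
  let ?B = "(\<lambda>y :: real^'n::_. coeff (rpoly y)) ` {y. pos_distinct y}"
  have [measurable]: "?B \<in> sets borel" 
  proof (rule image_coeff_rpoly_sym_borel)
    show "{y :: real^'n::_. pos_distinct y} \<in> sets borel" unfolding pos_distinct_def by measurable
    show "sym_set {y :: real^'n::_. pos_distinct y}" by (simp add: sym_set_def pos_distinct_permute)
  qed
  have IH: "(\<integral>\<^sup>+U. h (coeff (charpoly (gram R' (U ** X)))) \<partial>haar_unitary)
    = ennreal (row_const CARD('n) CARD('m) d) *
      (\<integral>\<^sup>+y. h (coeff (rpoly y)) * ennreal (kern CARD('m) N x y) * indicator nonneg_vecs y \<partial>lborel)"
    if "h \<in> borel_measurable borel" for h
    unfolding N_def using N that by (intro Suc.IH) (auto simp: N_def)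
  have "(\<integral>\<^sup>+U. indicator (- ?B) (coeff (charpoly (gram R' (U ** X)))) \<partial>haar_unitary)
    = ennreal (row_const CARD('n) CARD('m) d) *
      (\<integral>\<^sup>+y. indicator (- ?B) (coeff (rpoly y)) * ennreal (kern CARD('m) N x y) * indicator nonneg_vecs y \<partial>lborel)"
    by (rule IH) (auto intro!: borel_measurable_indicator)
  also have "(\<integral>\<^sup>+y. indicator (- ?B) (coeff (rpoly y)) * ennreal (kern CARD('m) N x y) * indicator nonneg_vecs y \<partial>lborel)
    = (\<integral>\<^sup>+y. 0 \<partial>(lborel :: (real^'n::_) measure))"
    using AE_pos_distinct by (intro nn_integral_cong_AE, eventually_elim) (auto simp: indicator_def)
  finally have zero: "(\<integral>\<^sup>+U. indicator (- ?B) (coeff (charpoly (gram R' (U ** X)))) \<partial>haar_unitary) = 0" by simp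
  have AEB: "AE U in haar_unitary. coeff (charpoly (gram R' (U ** X))) \<in> ?B"
  proof -
    have "(\<lambda>U. indicator (- ?B) (coeff (charpoly (gram R' (U ** X)))) :: ennreal) \<in> borel_measurable haar_unitary"
    proof -
      have "indicator (- ?B) \<in> borel_measurable (borel :: (nat \<Rightarrow> complex) measure)"
        by (intro borel_measurable_indicator) auto
      moreover have "(\<lambda>U. coeff (charpoly (gram R' (U ** X)))) \<in> measurable haar_unitary borel" by measurable
      ultimately show ?thesis by (rule measurable_compose_rev)
    qed
    from nn_integral_0_iff_AE[OF this] zero show ?thesis
      by (auto simp: indicator_def elim!: eventually_mono split: if_splits)
  qed
  have "(\<integral>\<^sup>+U. \<Phi> (coeff (charpoly (gram R (U ** X)))) \<partial>haar_unitary)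
    = (\<integral>\<^sup>+U. \<integral>\<^sup>+z. \<Phi> (coeff (charpoly (herm_form (drop_mat R' z) (U ** X)))) \<partial>gauss_vec \<partial>haar_unitary)"
    unfolding R(1) by (rule haar_remove_row[OF R(2) Suc.prems(1)])
  also have "\<dots> = (\<integral>\<^sup>+U. ennreal (step_const CARD('n) N) * \<Psi> (coeff (charpoly (gram R' (U ** X)))) \<partial>haar_unitary)"
  proof (rule nn_integral_cong_AE)
    show "AE U in haar_unitary. (\<integral>\<^sup>+z. \<Phi> (coeff (charpoly (herm_form (drop_mat R' z) (U ** X)))) \<partial>gauss_vec)
      = ennreal (step_const CARD('n) N) * \<Psi> (coeff (charpoly (gram R' (U ** X))))"
      using AEB
    proof eventually_elim
      case (elim U)
      then obtain w :: "real^'n::_" where w: "pos_distinct w" "coeff (charpoly (gram R' (U ** X))) = coeff (rpoly w)" by auto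
      then have "real_eigvals (gram R' (U ** X)) w" by (simp add: real_eigvals_iff_rpoly poly_eq_iff)
      from nn_integral_gauss_drop[OF this w(1) _ Suc.prems(1)] N show ?case
        by (simp add: w(2) \<Psi>G G_def N_def)
    qed
  qed
  also have "\<dots> = ennreal (step_const CARD('n) N) * (\<integral>\<^sup>+U. \<Psi> (coeff (charpoly (gram R' (U ** X)))) \<partial>haar_unitary)"
    by (rule nn_integral_cmult) measurable
  also have "(\<integral>\<^sup>+U. \<Psi> (coeff (charpoly (gram R' (U ** X)))) \<partial>haar_unitary)
    = ennreal (row_const CARD('n) CARD('m) d) *
      (\<integral>\<^sup>+w. G w * ennreal (kern CARD('m) N x w) * indicator nonneg_vecs w \<partial>lborel)"
    by (simp add: IH \<Psi>G)
  also have "(\<integral>\<^sup>+w. G w * ennreal (kern CARD('m) N x w) * indicator nonneg_vecs w \<partial>lborel)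
    = (\<integral>\<^sup>+w. \<integral>\<^sup>+y. \<Phi> (coeff (rpoly y)) * indicator nonneg_vecs y *
        (ennreal (kern CARD('m) N x w) * ennreal (kern N (N - 1) w y) * indicator nonneg_vecs w) \<partial>lborel \<partial>lborel)"
    unfolding G_def by (intro nn_integral_cong, subst nn_integral_multc[symmetric], measurable)
       (subst nn_integral_multc[symmetric], measurable, simp add: mult_ac)
  \<comment> \<open>Exchanging the integrals moves the intermediate spectrum \<open>w\<close>
    inside, where the two kernels compose.\<close>
  also have "\<dots> = (\<integral>\<^sup>+y. \<integral>\<^sup>+w. \<Phi> (coeff (rpoly y)) * indicator nonneg_vecs y *
        (ennreal (kern CARD('m) N x w) * ennreal (kern N (N - 1) w y) * indicator nonneg_vecs w) \<partial>lborel \<partial>lborel)"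
    by (rule lborel_pair.Fubini') measurable
  also have "\<dots> = (\<integral>\<^sup>+y. \<Phi> (coeff (rpoly y)) * indicator nonneg_vecs y *
        (ennreal (fact CARD('n) / real (CARD('m) - N) ^ CARD('n)) * ennreal (kern CARD('m) (N - 1) x y)) \<partial>lborel)"
  proof (rule nn_integral_cong)
    fix y :: "real^'n::_"
    have m: "(\<lambda>w. kern N (N - 1) w y) \<in> borel_measurable borel"
      unfolding kern_def det_def vec_lambda_beta by measurable
    have "(\<integral>\<^sup>+w. \<Phi> (coeff (rpoly y)) * indicator nonneg_vecs y *
        (ennreal (kern CARD('m) N x w) * ennreal (kern N (N - 1) w y) * indicator nonneg_vecs w) \<partial>lborel)
      = \<Phi> (coeff (rpoly y)) * indicator nonneg_vecs y *
        (\<integral>\<^sup>+w. ennreal (kern CARD('m) N x w) * ennreal (kern N (N - 1) w y) * indicator nonneg_vecs w \<partial>lborel)"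
      using m by (intro nn_integral_cmult) measurable
    then show "(\<integral>\<^sup>+w. \<Phi> (coeff (rpoly y)) * indicator nonneg_vecs y *
        (ennreal (kern CARD('m) N x w) * ennreal (kern N (N - 1) w y) * indicator nonneg_vecs w) \<partial>lborel)
      = \<Phi> (coeff (rpoly y)) * indicator nonneg_vecs y *
        (ennreal (fact CARD('n) / real (CARD('m) - N) ^ CARD('n)) * ennreal (kern CARD('m) (N - 1) x y))"
      using kern_compose(2)[OF N(2) N(4) x, of y] kern_nonneg[OF x N(5) N(4)]
      by (cases "y \<in> nonneg_vecs") auto
  qed
  also have "\<dots> = ennreal (fact CARD('n) / real (CARD('m) - N) ^ CARD('n)) *
      (\<integral>\<^sup>+y. \<Phi> (coeff (rpoly y)) * ennreal (kern CARD('m) (N - 1) x y) * indicator nonneg_vecs y \<partial>lborel)"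
    by (subst nn_integral_cmult[symmetric]) (measurable, simp add: mult_ac)
  also have "ennreal (step_const CARD('n) N) * (ennreal (row_const CARD('n) CARD('m) d) *
     (ennreal (fact CARD('n) / real (CARD('m) - N) ^ CARD('n)) *
      (\<integral>\<^sup>+y. \<Phi> (coeff (rpoly y)) * ennreal (kern CARD('m) (N - 1) x y) * indicator nonneg_vecs y \<partial>lborel)))
    = ennreal (row_const CARD('n) CARD('m) (Suc d)) *
      (\<integral>\<^sup>+y. \<Phi> (coeff (rpoly y)) * ennreal (kern CARD('m) (N - 1) x y) * indicator nonneg_vecs y \<partial>lborel)"
  proof -
    have "CARD('m) - N = Suc d" "CARD('m) - Suc d = N" using N by auto
    then have "row_const CARD('n) CARD('m) (Suc d)
      = row_const CARD('n) CARD('m) d * step_const CARD('n) N * (fact CARD('n) / real (CARD('m) - N) ^ CARD('n))"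
      by (simp only: row_const.simps)
    moreover have "0 \<le> fact CARD('n) / real (CARD('m) - N) ^ CARD('n)" by simp
    ultimately have "ennreal (row_const CARD('n) CARD('m) (Suc d)) = ennreal (row_const CARD('n) CARD('m) d)
        * ennreal (step_const CARD('n) N) * ennreal (fact CARD('n) / real (CARD('m) - N) ^ CARD('n))"
      by (simp only: ennreal_mult row_const_nonneg step_const_nonneg mult_nonneg_nonneg)
    then show ?thesis by (simp only: mult_ac)
  qed
  finally show ?case by (simp only: N(1))
qed

section \<open>Truncations and events invariant under permutation\<close>

lemma kern_density:
  fixes x y :: "real^'n::{finite,linorder}"
  assumes "\<And>k. 0 < x $ k" "CARD('n) \<le> M"
  shows "(\<Prod>j\<in>UNIV. x $ j powr (real CARD('n) - real M)) * (\<Prod>j\<in>UNIV. (y $ j) ^ (N - CARD('n)))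
      * det (\<chi> j k. pos_pow (x $ k - y $ j) (M - N - 1)) * vandermonde y / vandermonde x = kern M N x y"
proof -
  have "x $ j powr (real CARD('n) - real M) = (1 / x $ j) ^ (M - CARD('n))" for j
  proof -
    have "real CARD('n) - real M = - real (M - CARD('n))" using assms(2) by (simp add: of_nat_diff)
    then have "x $ j powr (real CARD('n) - real M) = inverse (x $ j powr real (M - CARD('n)))"
      by (simp only: powr_minus)
    also have "\<dots> = (1 / x $ j) ^ (M - CARD('n))"
      by (simp only: powr_realpow[OF assms(1)] power_inverse inverse_eq_divide power_one_over)
    finally show ?thesis .
  qed
  then show ?thesis by (simp add: kern_def)
qed

definition restrict_rows :: "'m set \<Rightarrow> complex^'n^'m \<Rightarrow> complex^'n^'m" where
  "restrict_rows L X = (\<chi> j k. if j \<in> L then X $ j $ k else 0)"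

lemma trunc_mult_eq: "trunc_mult L U X = U ** restrict_rows L X"
  unfolding vec_eq_iff trunc_mult_def restrict_rows_def matrix_matrix_mult_def vec_lambda_beta
  by (intro allI sum.mono_neutral_cong_left) auto

lemma gram_restrict_rows: "gram UNIV (restrict_rows L X) = gram L X"
  unfolding vec_eq_iff gram_def restrict_rows_def vec_lambda_beta
  by (intro allI sum.mono_neutral_cong_right) auto

text \<open>Symmetry of \<open>A\<close> makes the event a condition on the characteristic
  polynomial alone: membership in the image of \<open>A\<close> under the coefficient map, a Borel
  set whose indicator is a test function for the law of the spectrum.\<close>

lemma measure_squared_singular_values:
  fixes R L :: "'m::finite set" and X :: "complex^'n::{finite,linorder}^'m"
  assumes n: "CARD('n) \<le> card R" and R: "card R + 1 \<le> CARD('m)"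
    and ev: "real_eigvals (gram L X) x" and x: "\<And>k. x $ k \<noteq> 0" "\<And>j k. j \<noteq> k \<Longrightarrow> x $ j \<noteq> x $ k"
    and A: "A \<in> sets borel" "sym_set A"
  shows "measure haar_unitary {U. \<exists>y\<in>A. real_eigvals (gram R (trunc_mult L U X)) y}
    = row_const CARD('n) CARD('m) (CARD('m) - card R - 1) *
      (LINT y : A \<inter> {y. \<forall>j. 0 \<le> y $ j} | lborel. kern CARD('m) (card R) x y)"
proof -
  note [measurable] = A(1)
  have H: "is_haar (haar_unitary :: (complex^'m^'m) measure)" by (rule is_haar_haar_unitary)
  have sH[measurable_cong]: "sets (haar_unitary :: (complex^'m^'m) measure) = sets borel" using H by (simp add: is_haar_def)
  interpret H: prob_space "haar_unitary :: (complex^'m^'m) measure" using H by (simp add: is_haar_def)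
  define d where "d = CARD('m) - card R - 1"
  have d: "card R + Suc d = CARD('m)" using R by (simp add: d_def)
  have pd: "pos_distinct x"
    using real_eigvals_gram_nonneg[OF ev x(2)] x by (simp add: pos_distinct_def less_le)
  have ev': "real_eigvals (gram UNIV (restrict_rows L X)) x" using ev by (simp add: gram_restrict_rows)
  define E where "E = (\<lambda>y :: real^'n::_. coeff (rpoly y)) ` A"
  have E: "E \<in> sets borel" unfolding E_def by (rule image_coeff_rpoly_sym_borel[OF A])
  have EA: "coeff (rpoly y) \<in> E \<longleftrightarrow> y \<in> A" for y
    unfolding E_def by (rule coeff_rpoly_mem_image_iff[OF A(2)])
  let ?S = "{U. \<exists>y\<in>A. real_eigvals (gram R (trunc_mult L U X)) y}"
  have eq: "coeff (charpoly (gram R (U ** restrict_rows L X))) \<in> E \<longleftrightarrow> U \<in> ?S" for U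
    by (auto simp: E_def real_eigvals_iff_rpoly trunc_mult_eq coeff_inject)
  let ?f = "\<lambda>y. indicator (A \<inter> {y. \<forall>j. 0 \<le> y $ j}) y * kern CARD('m) (card R) x y"
  have k: "(\<lambda>y. kern CARD('m) (card R) x y) \<in> borel_measurable borel"
    unfolding kern_def det_def vec_lambda_beta by measurable
  have f: "?f \<in> borel_measurable borel"
    using k A(1) nonneg_vecs_borel unfolding nonneg_vecs_def by measurable
  have f0: "0 \<le> ?f y" for y
    using kern_nonneg[OF pd n, of "CARD('m)" y] R by (auto simp: indicator_def nonneg_vecs_def)
  have meas: "(\<lambda>U. coeff (charpoly (gram R (U ** restrict_rows L X)))) \<in> measurable haar_unitary borel"
    by (rule measurable_compose[OF _ coeff_charpoly_measurable]) measurable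
  from measurable_sets[OF this E] have S: "?S \<in> sets haar_unitary"
    using eq by (simp add: vimage_def sets_eq_imp_space_eq[OF sH])
  have "emeasure haar_unitary ?S = (\<integral>\<^sup>+U. indicator E (coeff (charpoly (gram R (U ** restrict_rows L X)))) \<partial>haar_unitary)"
    unfolding nn_integral_indicator[OF S, symmetric]
    by (intro nn_integral_cong) (simp only: indicator_def eq)
  also have "\<dots> = ennreal (row_const CARD('n) CARD('m) d) *
      (\<integral>\<^sup>+y. indicator E (coeff (rpoly y)) * ennreal (kern CARD('m) (card R) x y) * indicator nonneg_vecs y \<partial>lborel)"
    by (rule haar_eigenvalue_law[OF ev' pd _ d n]) (rule borel_measurable_indicator[OF E])
  also have "(\<integral>\<^sup>+y. indicator E (coeff (rpoly y)) * ennreal (kern CARD('m) (card R) x y) * indicator nonneg_vecs y \<partial>lborel)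
    = (\<integral>\<^sup>+y. ennreal (?f y) \<partial>lborel)"
    by (intro nn_integral_cong) (auto simp: EA indicator_def nonneg_vecs_def)
  finally have "emeasure haar_unitary ?S = ennreal (row_const CARD('n) CARD('m) d) * (\<integral>\<^sup>+y. ennreal (?f y) \<partial>lborel)" .
  then have "measure haar_unitary ?S = row_const CARD('n) CARD('m) d * enn2real (\<integral>\<^sup>+y. ennreal (?f y) \<partial>lborel)"
    by (simp add: measure_def enn2real_mult row_const_nonneg)
  also have "enn2real (\<integral>\<^sup>+y. ennreal (?f y) \<partial>lborel) = integral\<^sup>L lborel ?f"
    using f f0 by (subst integral_eq_nn_integral) auto
  finally show ?thesis
    by (simp add: d_def set_lebesgue_integral_def)
qed

text \<open>\<open>R\<close> and \<open>L\<close> have sizes n + \<nu> and l. The density of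
  unordered values is expressed through probabilities of symmetric Borel sets; the constant is
  quantified before \<open>X\<close> and sees only \<open>card R\<close>, with n and m fixed by the
  types.\<close>

theorem theorem2p1:
  shows "\<exists>c :: nat \<Rightarrow> real.
    \<forall>(R :: 'm::finite set) (L :: 'm set) (X :: complex^('n::{finite,linorder})^'m) (x :: real^('n::{finite,linorder})).
      CARD('n::{finite,linorder}) \<le> card L \<and> CARD('n::{finite,linorder}) \<le> card R \<and> card R + 1 \<le> CARD('m)
      \<and> real_eigvals (gram L X) x \<and> (\<forall>k. x $ k \<noteq> 0) \<and> (\<forall>j k. j \<noteq> k \<longrightarrow> x $ j \<noteq> x $ k)
      \<longrightarrow>
      (\<forall>A :: (real^('n::{finite,linorder})) set. A \<in> sets borel \<and> sym_set A \<longrightarrow>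
         measure haar_unitary {U. \<exists>y\<in>A. real_eigvals (gram R (trunc_mult L U X)) y}
         = c (card R) *
           (LINT y : A \<inter> {y. \<forall>j. 0 \<le> y $ j} | lborel.
              (\<Prod>j\<in>UNIV. x $ j powr (real CARD('n::{finite,linorder}) - real CARD('m)))
            * (\<Prod>j\<in>UNIV. (y $ j) ^ (card R - CARD('n::{finite,linorder})))
            * det (\<chi> j k. pos_pow (x $ k - y $ j) (CARD('m) - card R - 1))
            * vandermonde y / vandermonde x))"
\<comment> \<open>\<open>CARD('m) - N - 1\<close> is the number of removed rows minus one, since
  \<open>row_const\<close> starts at index 0 with a single removal.\<close>
proof (intro exI[of _ "\<lambda>N. row_const CARD('n) CARD('m) (CARD('m) - N - 1)"] allI impI, elim conjE)
  fix R L :: "'m set" and X :: "complex^'n::_^'m" and x :: "real^'n::_" and A :: "(real^'n::_) set"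
  assume n: "CARD('n) \<le> card R" and R: "card R + 1 \<le> CARD('m)"
    and ev: "real_eigvals (gram L X) x" and x: "\<forall>k. x $ k \<noteq> 0" "\<forall>j k. j \<noteq> k \<longrightarrow> x $ j \<noteq> x $ k"
    and A: "A \<in> sets borel" "sym_set A"
  have "0 < x $ k" for k
    using real_eigvals_gram_nonneg[OF ev, of k] x by (simp add: less_le)
  then show "measure haar_unitary {U. \<exists>y\<in>A. real_eigvals (gram R (trunc_mult L U X)) y}
         = row_const CARD('n) CARD('m) (CARD('m) - card R - 1) *
           (LINT y : A \<inter> {y. \<forall>j. 0 \<le> y $ j} | lborel.
              (\<Prod>j\<in>UNIV. x $ j powr (real CARD('n) - real CARD('m)))
            * (\<Prod>j\<in>UNIV. (y $ j) ^ (card R - CARD('n)))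
            * det (\<chi> j k. pos_pow (x $ k - y $ j) (CARD('m) - card R - 1))
            * vandermonde y / vandermonde x)"
    using n R x by (subst kern_density) (auto intro!: measure_squared_singular_values[OF n R ev _ _ A, simplified])
qed

end
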